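(* Let $k$ be a field of characteristic $0$, and let $A, B$ be connected graded commutative $k$-algebras of finite type. Then the following are equivalent: (a) $\bar A \simeq \bar B$ as graded $k$-vector spaces; (b) $J^{\vee}(A) \simeq J^{\vee}(B)$ as graded algebras; (c) $J^{\vee}(A) \simeq J^{\vee}(B)$ as graded Hopf algebras.
   Context: Graded vector spaces $M=\{M_n\}_{n\ge 0}$ are non-negatively graded over $k$ and of finite type (each $M_n$ finite dimensional); $\bar M$ denotes the positive degree part. The tensor product is the graded one, with braiding $x\otimes y\mapsto (-1)^{|x||y|}y\otimes x$, so "commutative" means graded commutative. "Connected" means the degree $0$ part is $k$. $\mathcal A^*(k)$ is the category of connected commutative graded algebras of finite type, and $\mathcal H^*(k)$ is the category of connected commutative graded Hopf algebras of finite type. $J^{\vee}:\mathcal A^*(k)\to\mathcal H^*(k)$ is the right adjoint of the forgetful functor. Explicitly, $J^{\vee}(A)=\bigoplus_{r\ge 0}\bar A^{\otimes r}$, with coproduct given by deconcatenation of tensors and with the quasi-shuffle product: the component $\bar A^{\otimes l}\otimes\bar A^{\otimes m}\to\bar A^{\otimes n}$ of the product is the sum, over all pairs of order preserving injections $\alpha:\{1,\dots,l\}\to\{1,\dots,n\}$, $\beta:\{1,\dots,m\}\to\{1,\dots,n\}$ whose images together cover $\{1,\dots,n\}$, of the map sending $a_1\otimes\cdots\otimes a_{l+m}$ to $\bigotimes_{i=1}^n\prod_{j\in\gamma^{-1}(i)}a_j$ (with Koszul signs), where $\gamma:\{1,\dots,l+m\}\to\{1,\dots,n\}$ is $\alpha$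 on the first $l$ elements and $\beta$ on the last $m$. *)

theory Defs
  imports Complex_Main "HOL-Library.Poly_Mapping" "HOL-Library.FuncSet"
begin

section \<open>Graded algebras\<close>

locale graded_algebra = vector_space scale
  for scale :: "'k::field \<Rightarrow> 'a::ring_1 \<Rightarrow> 'a" (infixr \<open>*s\<close> 75) +
  fixes A :: "nat \<Rightarrow> 'a set"
  assumes scale_mult_left: "(c *s x) * y = c *s (x * y)"
    and scale_mult_right: "x * (c *s y) = c *s (x * y)"
    and subspace_part: "subspace (A n)"
    and direct_sum: "\<exists>!f. (\<forall>n. f n \<in> A n) \<and> finite {n. f n \<noteq> 0} \<and> x = (\<Sum>n | f n \<noteq> 0. f n)"
    and one_part: "1 \<in> A 0"
    and mult_part: "x \<in> A m \<Longrightarrow> y \<in> A n \<Longrightarrow> x * y \<in> A (m + n)"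

locale connected_commutative_graded_algebra = graded_algebra +
  assumes graded_commutative: "x \<in> A m \<Longrightarrow> y \<in> A n \<Longrightarrow> y * x = (-1) ^ (m * n) * (x * y)"
    and connected: "A 0 = range (\<lambda>c. c *s 1)"
    and finite_type: "\<exists>S. finite S \<and> A n = span S"


section \<open>Free vector spaces\<close>

definition fscale :: "'k::field \<Rightarrow> ('x \<Rightarrow>\<^sub>0 'k) \<Rightarrow> ('x \<Rightarrow>\<^sub>0 'k)" where
  "fscale c p = Poly_Mapping.map ((*) c) p"

lemma lookup_fscale [simp]: "Poly_Mapping.lookup (fscale c p) x = c * Poly_Mapping.lookup p x"
  by (simp add: fscale_def Poly_Mapping.map.rep_eq when_def)

global_interpretation free: vector_space fscale
  by unfold_locales (auto intro!: poly_mapping_eqI simp: lookup_add algebra_simps)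

abbreviation gen :: "'x \<Rightarrow> ('x \<Rightarrow>\<^sub>0 'k::field)" where
  "gen x \<equiv> Poly_Mapping.single x 1"

definition lin_extend :: "('x \<Rightarrow> ('y \<Rightarrow>\<^sub>0 'k::field)) \<Rightarrow> ('x \<Rightarrow>\<^sub>0 'k) \<Rightarrow> ('y \<Rightarrow>\<^sub>0 'k)" where
  "lin_extend f p = (\<Sum>x\<in>Poly_Mapping.keys p. fscale (Poly_Mapping.lookup p x) (f x))"

definition bilin_extend ::
  "('x \<Rightarrow> 'y \<Rightarrow> ('z \<Rightarrow>\<^sub>0 'k::field)) \<Rightarrow> ('x \<Rightarrow>\<^sub>0 'k) \<Rightarrow> ('y \<Rightarrow>\<^sub>0 'k) \<Rightarrow> ('z \<Rightarrow>\<^sub>0 'k)" where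
  "bilin_extend f p q = lin_extend (\<lambda>x. lin_extend (\<lambda>y. f x y) q) p"


section \<open>Graded structures given by a family of components\<close>

text \<open>
  A graded vector space is a family \<open>part V n\<close> of vector spaces, all with the operations
  \<open>vadd\<close> and \<open>vscale\<close>. A letter \<open>(n, v)\<close> stands for the homogeneous element \<open>v \<in> part V n\<close> of
  degree \<open>n\<close>, and a word \<open>[(n\<^sub>1, v\<^sub>1), \<dots>, (n\<^sub>r, v\<^sub>r)]\<close> for the pure tensor
  \<open>v\<^sub>1 \<otimes> \<dots> \<otimes> v\<^sub>r\<close>. A tensor is a coset in the free vector space on words modulo the
  subspace of multilinearity relations.
\<close>

type_synonym 'v word = "(nat \<times> 'v) list"
type_synonym ('k, 'v) tensor = "('v word \<Rightarrow>\<^sub>0 'k) set"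

record ('k, 'v) graded_space =
  part :: "nat \<Rightarrow> 'v set"
  vadd :: "'v \<Rightarrow> 'v \<Rightarrow> 'v"
  vscale :: "'k \<Rightarrow> 'v \<Rightarrow> 'v"

record ('k, 'v) graded_alg = "('k, 'v) graded_space" +
  gmult :: "'v \<Rightarrow> 'v \<Rightarrow> 'v"
  gone :: 'v

text \<open>
  The coproduct takes values in the second tensor power. No antipode is recorded: on a connected
  graded bialgebra it exists, is unique and is preserved by every bialgebra map.
\<close>

record (overloaded) ('k::zero, 'v) graded_hopf = "('k, 'v) graded_alg" +
  comult :: "'v \<Rightarrow> ('k, 'v) tensor"
  counit :: "'v \<Rightarrow> 'k"


section \<open>Tensor powers\<close>

definition words :: "('k, 'v, 'e) graded_space_scheme \<Rightarrow> 'v word set" where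
  "words V = {w. \<forall>(n, v) \<in> set w. v \<in> part V n}"

definition wdeg :: "'v word \<Rightarrow> nat" where
  "wdeg w = sum_list (map fst w)"

definition relations :: "('k::field, 'v, 'e) graded_space_scheme \<Rightarrow> ('v word \<Rightarrow>\<^sub>0 'k) set" where
  "relations V = free.span
     ({gen (us @ (n, vadd V x y) # ws) - gen (us @ (n, x) # ws) - gen (us @ (n, y) # ws)
         | us n x y ws. us \<in> words V \<and> ws \<in> words V \<and> x \<in> part V n \<and> y \<in> part V n} \<union>
      {gen (us @ (n, vscale V c x) # ws) - fscale c (gen (us @ (n, x) # ws))
         | us n c x ws. us \<in> words V \<and> ws \<in> words V \<and> x \<in> part V n})"

definition coset :: "('k::field, 'v, 'e) graded_space_scheme \<Rightarrow> ('v word \<Rightarrow>\<^sub>0 'k) \<Rightarrow> ('k, 'v) tensor"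
  where "coset V p = {q. q - p \<in> relations V}"

definition rep :: "('k::field, 'v) tensor \<Rightarrow> ('v word \<Rightarrow>\<^sub>0 'k)" where
  "rep X = (SOME p. p \<in> X)"

definition pure :: "('k::field, 'v, 'e) graded_space_scheme \<Rightarrow> 'v word \<Rightarrow> ('k, 'v) tensor" where
  "pure V w = coset V (gen w)"

text \<open>The map of tensors induced by a degree-preserving family \<open>\<phi> n : part V n \<rightarrow> part W n\<close>.\<close>

definition tensor_map ::
  "('k::field, 'w, 'e) graded_space_scheme \<Rightarrow> (nat \<Rightarrow> 'v \<Rightarrow> 'w) \<Rightarrow> ('k, 'v) tensor \<Rightarrow> ('k, 'w) tensor"
  where "tensor_map W \<phi> X =
    coset W (lin_extend (\<lambda>w. gen (map (\<lambda>(n, v). (n, \<phi> n v)) w)) (rep X))"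


section \<open>Isomorphisms\<close>

definition graded_space_iso ::
  "('k, 'v, 'd) graded_space_scheme \<Rightarrow> ('k, 'w, 'e) graded_space_scheme \<Rightarrow> (nat \<Rightarrow> 'v \<Rightarrow> 'w) \<Rightarrow> bool"
  where "graded_space_iso V W \<phi> \<longleftrightarrow>
    (\<forall>n. bij_betw (\<phi> n) (part V n) (part W n) \<and>
      (\<forall>x\<in>part V n. \<forall>y\<in>part V n. \<phi> n (vadd V x y) = vadd W (\<phi> n x) (\<phi> n y)) \<and>
      (\<forall>c. \<forall>x\<in>part V n. \<phi> n (vscale V c x) = vscale W c (\<phi> n x)))"

definition graded_alg_iso ::
  "('k, 'v, 'd) graded_alg_scheme \<Rightarrow> ('k, 'w, 'e) graded_alg_scheme \<Rightarrow> (nat \<Rightarrow> 'v \<Rightarrow> 'w) \<Rightarrow> bool"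
  where "graded_alg_iso V W \<phi> \<longleftrightarrow>
    graded_space_iso V W \<phi> \<and>
    \<phi> 0 (gone V) = gone W \<and>
    (\<forall>m n. \<forall>x\<in>part V m. \<forall>y\<in>part V n. \<phi> (m + n) (gmult V x y) = gmult W (\<phi> m x) (\<phi> n y))"

definition graded_hopf_iso ::
  "('k::field, 'v, 'd) graded_hopf_scheme \<Rightarrow> ('k, 'w, 'e) graded_hopf_scheme
     \<Rightarrow> (nat \<Rightarrow> 'v \<Rightarrow> 'w) \<Rightarrow> bool"
  where "graded_hopf_iso V W \<phi> \<longleftrightarrow>
    graded_alg_iso V W \<phi> \<and>
    (\<forall>n. \<forall>x\<in>part V n. comult W (\<phi> n x) = tensor_map W \<phi> (comult V x)) \<and>
    (\<forall>n. \<forall>x\<in>part V n. counit W (\<phi> n x) = counit V x)"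


section \<open>The quasi-shuffle Hopf algebra\<close>

definition positive_part ::
  "('k \<Rightarrow> 'a::ring_1 \<Rightarrow> 'a) \<Rightarrow> (nat \<Rightarrow> 'a set) \<Rightarrow> ('k, 'a) graded_space" where
  "positive_part scale A =
     \<lparr>part = (\<lambda>n. if n = 0 then {0} else A n), vadd = (+), vscale = scale\<rparr>"

text \<open>Indices start from \<open>0\<close> here, and \<open>join l \<alpha> \<beta>\<close> is the map called \<open>\<gamma>\<close> below.\<close>

definition join :: "nat \<Rightarrow> (nat \<Rightarrow> nat) \<Rightarrow> (nat \<Rightarrow> nat) \<Rightarrow> nat \<Rightarrow> nat" where
  "join l \<alpha> \<beta> j = (if j < l then \<alpha> j else \<beta> (j - l))"

definition quasi_shuffles :: "nat \<Rightarrow> nat \<Rightarrow> nat \<Rightarrow> ((nat \<Rightarrow> nat) \<times> (nat \<Rightarrow> nat)) set" where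
  "quasi_shuffles l m n =
     {(\<alpha>, \<beta>). \<alpha> \<in> {..<l} \<rightarrow>\<^sub>E {..<n} \<and> \<beta> \<in> {..<m} \<rightarrow>\<^sub>E {..<n} \<and>
       strict_mono_on {..<l} \<alpha> \<and> strict_mono_on {..<m} \<beta> \<and> \<alpha> ` {..<l} \<union> \<beta> ` {..<m} = {..<n}}"

text \<open>The product of the letters \<open>w ! j\<close> with \<open>\<gamma> j = i\<close>, in increasing order of \<open>j\<close>.\<close>

definition merged_letter :: "'a::ring_1 word \<Rightarrow> (nat \<Rightarrow> nat) \<Rightarrow> nat \<Rightarrow> nat \<times> 'a" where
  "merged_letter w \<gamma> i =
     (let ls = map ((!) w) (filter (\<lambda>j. \<gamma> j = i) [0..<length w])
      in (sum_list (map fst ls), prod_list (map snd ls)))"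

text \<open>
  Moving the factors of \<open>w\<close> into the order prescribed by \<open>\<gamma>\<close> transposes exactly the pairs
  \<open>j < j'\<close> with \<open>\<gamma> j' < \<gamma> j\<close>; each contributes the sign of the braiding.
\<close>

definition koszul_sign :: "'a word \<Rightarrow> (nat \<Rightarrow> nat) \<Rightarrow> 'k::field" where
  "koszul_sign w \<gamma> =
     (\<Prod>(j, j') \<in> {(j, j'). j < j' \<and> j' < length w \<and> \<gamma> j' < \<gamma> j}.
        (-1) ^ (fst (w ! j) * fst (w ! j')))"

text \<open>There are no quasi-shuffles into \<open>n > l + m\<close> positions.\<close>

definition quasi_shuffle_product :: "'a::ring_1 word \<Rightarrow> 'a word \<Rightarrow> ('a word \<Rightarrow>\<^sub>0 'k::field)" where
  "quasi_shuffle_product u v =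
     (\<Sum>n \<le> length u + length v. \<Sum>(\<alpha>, \<beta>) \<in> quasi_shuffles (length u) (length v) n.
        let \<gamma> = join (length u) \<alpha> \<beta>
        in fscale (koszul_sign (u @ v) \<gamma>) (gen (map (merged_letter (u @ v) \<gamma>) [0..<n])))"

definition J_alg ::
  "('k::field \<Rightarrow> 'a::ring_1 \<Rightarrow> 'a) \<Rightarrow> (nat \<Rightarrow> 'a set) \<Rightarrow> ('k, ('k, 'a) tensor) graded_alg" where
  "J_alg scale A = (let V = positive_part scale A in
     \<lparr>part = (\<lambda>n. coset V ` free.span (gen ` {w \<in> words V. wdeg w = n})),
      vadd = (\<lambda>X Y. coset V (rep X + rep Y)),
      vscale = (\<lambda>c X. coset V (fscale c (rep X))),
      gmult = (\<lambda>X Y. coset V (bilin_extend quasi_shuffle_product (rep X) (rep Y))),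
      gone = pure V []\<rparr>)"

text \<open>Deconcatenation: \<open>w\<close> is sent to the sum of all \<open>u \<otimes> v\<close> with \<open>w = u @ v\<close>.\<close>

definition J_comult ::
  "('k::field \<Rightarrow> 'a::ring_1 \<Rightarrow> 'a) \<Rightarrow> (nat \<Rightarrow> 'a set) \<Rightarrow> ('k, 'a) tensor \<Rightarrow> ('k, ('k, 'a) tensor) tensor"
  where "J_comult scale A X = (let V = positive_part scale A in
    coset (J_alg scale A)
      (lin_extend (\<lambda>w. \<Sum>i \<le> length w.
          gen [(wdeg (take i w), pure V (take i w)), (wdeg (drop i w), pure V (drop i w))])
        (rep X)))"

definition J ::
  "('k::field \<Rightarrow> 'a::ring_1 \<Rightarrow> 'a) \<Rightarrow> (nat \<Rightarrow> 'a set) \<Rightarrow> ('k, ('k, 'a) tensor) graded_hopf" where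
  "J scale A = graded_alg.extend (J_alg scale A)
     \<lparr>comult = J_comult scale A, counit = (\<lambda>X. Poly_Mapping.lookup (rep X) [])\<rparr>"

end

theory Submission
  imports Defs
begin

text \<open>
  The quasi-shuffle algebra of \<open>A\<close> is isomorphic, as a Hopf algebra, to the shuffle algebra on the
  graded vector space \<open>A\<^sup>+\<close>, which does not see the product of \<open>A\<close>. The isomorphism is Hoffman's
  exponential: since the quasi-shuffle Hopf algebra is cofree on \<open>A\<^sup>+\<close>, a Hopf map into it is given by
  an algebra map to \<open>A\<close>, here \<open>a\<^sub>1 \<otimes> \<dots> \<otimes> a\<^sub>n \<mapsto> a\<^sub>1 \<dots> a\<^sub>n / n!\<close>, which is multiplicative for
  the shuffle product because \<open>A\<close> is graded commutative. It is bijective because it is the identity up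
  to shorter tensors. Conversely, a basis of the degree \<open>n\<close> part of \<open>J(A)\<close> consists of the words of
  degree \<open>n\<close> in a homogeneous basis of \<open>A\<^sup>+\<close>, and the numbers of these words determine the number of
  basis elements in each degree: words of length at least two only involve letters of smaller degree.

  All maps are constructed on the free vector space on words; only multiplicativity and the
  compatibility with multilinearity are statements modulo the relations.
\<close>

section \<open>Linear maps between free vector spaces\<close>

text \<open>The weight 1/n! comes from counting: in a graded commutative algebra all (l+m choose l)
  shuffles of words of lengths l and m have the same product up to the sign of the shuffle, and
  1/(l+m)! times this number is 1/(l! m!). Dividing by n! is what characteristic 0 provides.
  Cofreeness serves only as a guide: the Hopf map is written as a recursion that splits off the
  first block of letters, and this recursion is compared with that of the quasi-shuffle product. The
  obstacle is the encoding of tensors. A coset is entered through an arbitrary representative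
  \<open>rep\<close>, and the sign produced by graded commutativity sits inside a letter, from where
  it can be pulled out only modulo the relations. Hence each map must be shown to respect the
  relations before it says anything about cosets, whereas identities about cutting words hold
  exactly. For the converse, words can be counted only once words in a basis are known to be
  independent modulo the relations; a coordinate map that vanishes on the relations shows
  this.\<close>

abbreviation lin :: "(('x \<Rightarrow>\<^sub>0 'k::field) \<Rightarrow> ('y \<Rightarrow>\<^sub>0 'k)) \<Rightarrow> bool" where
  "lin \<equiv> Vector_Spaces.linear fscale fscale"

lemma linI:
  fixes f :: "('x \<Rightarrow>\<^sub>0 'k::field) \<Rightarrow> ('y \<Rightarrow>\<^sub>0 'k)"
  assumes "\<And>p q. f (p + q) = f p + f q" "\<And>c p. f (fscale c p) = fscale c (f p)"
  shows "lin f"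
  unfolding Vector_Spaces.linear_iff
  by (intro conjI allI free.vector_space_axioms assms)

lemma
  assumes "lin f"
  shows lin_add: "f (p + q) = f p + f q"
    and lin_scale: "f (fscale c p) = fscale c (f p)"
    and lin_zero: "f 0 = 0"
    and lin_diff: "f (p - q) = f p - f q"
    and lin_sum: "f (sum g S) = (\<Sum>s\<in>S. f (g s))"
proof -
  interpret Vector_Spaces.linear fscale fscale f by fact
  show "f (p + q) = f p + f q" "f (fscale c p) = fscale c (f p)" "f 0 = 0"
    "f (p - q) = f p - f q" "f (sum g S) = (\<Sum>s\<in>S. f (g s))"
    by (rule add scale zero diff sum)+
qed

named_theorems lin_intros

lemma lin_id [lin_intros]: "lin (\<lambda>p. p)"
  by (rule linI) auto

lemma lin_0 [lin_intros]: "lin (\<lambda>p. 0)"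
  by (rule linI) auto

lemma lin_plus [lin_intros]: "lin f \<Longrightarrow> lin g \<Longrightarrow> lin (\<lambda>p. f p + g p)"
  by (rule linI) (auto simp: lin_add lin_scale free.scale_right_distrib)

lemma lin_minus [lin_intros]: "lin f \<Longrightarrow> lin g \<Longrightarrow> lin (\<lambda>p. f p - g p)"
  by (rule linI) (auto simp: lin_add lin_scale free.scale_right_diff_distrib)

lemma lin_fscale [lin_intros]: "lin f \<Longrightarrow> lin (\<lambda>p. fscale c (f p))"
  by (rule linI) (auto simp: lin_add lin_scale free.scale_right_distrib mult.commute)

lemma lin_sums [lin_intros]: "(\<And>i. i \<in> I \<Longrightarrow> lin (f i)) \<Longrightarrow> lin (\<lambda>p. \<Sum>i\<in>I. f i p)"
  by (rule linI) (auto simp: lin_add lin_scale sum.distrib free.scale_sum_right)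

lemma lin_compose: "lin f \<Longrightarrow> lin g \<Longrightarrow> lin (\<lambda>p. f (g p))"
  by (rule linI) (auto simp: lin_add lin_scale)

text \<open>Summing over a finite set that contains the support lets \<open>p\<close>,
  \<open>q\<close> and \<open>p + q\<close> share one index set although terms may cancel in the
  sum.\<close>

lemma lin_extend_superset:
  assumes "finite S" "Poly_Mapping.keys p \<subseteq> S"
  shows "lin_extend f p = (\<Sum>x\<in>S. fscale (Poly_Mapping.lookup p x) (f x))"
  unfolding lin_extend_def
  by (rule sum.mono_neutral_left) (use assms in \<open>auto simp: in_keys_iff\<close>)

lemma lin_extend_plus [simp]: "lin_extend f (p + q) = lin_extend f p + lin_extend f q"
proof -
  have "lin_extend f r = (\<Sum>x\<in>Poly_Mapping.keys p \<union> Poly_Mapping.keys q. fscale (Poly_Mapping.lookup r x) (f x))"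
    if "r \<in> {p, q, p + q}" for r
    by (rule lin_extend_superset) (use that Poly_Mapping.keys_add[of p q] in auto)
  then show ?thesis
    by (simp add: lookup_add free.scale_left_distrib sum.distrib)
qed

lemma lin_extend_fscale [simp]: "lin_extend f (fscale c p) = fscale c (lin_extend f p)"
proof -
  have "lin_extend f r = (\<Sum>x\<in>Poly_Mapping.keys p. fscale (Poly_Mapping.lookup r x) (f x))"
    if "r \<in> {p, fscale c p}" for r
    by (rule lin_extend_superset) (use that in \<open>auto simp: in_keys_iff\<close>)
  then show ?thesis
    by (simp add: free.scale_sum_right)
qed

lemma lin_lin_extend [lin_intros]: "lin (lin_extend f)"
  by (rule linI) auto

lemma lin_lin_extend' [lin_intros]: "lin g \<Longrightarrow> lin (\<lambda>p. lin_extend f (g p))"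
  by (rule lin_compose) (rule lin_intros)

lemmas lin_extend_zero [simp] = lin_zero[OF lin_lin_extend]
lemmas lin_extend_diff [simp] = lin_diff[OF lin_lin_extend]
lemmas lin_extend_sum = lin_sum[OF lin_lin_extend]

lemma lin_extend_gen [simp]: "lin_extend f (gen x) = f x"
  by (simp add: lin_extend_def)

lemma poly_mapping_eq_lin_extend_gen: "lin_extend gen p = p"
proof (rule poly_mapping_eqI)
  fix x
  show "Poly_Mapping.lookup (lin_extend gen p) x = Poly_Mapping.lookup p x"
  proof -
    have "Poly_Mapping.lookup p y * Poly_Mapping.lookup (gen y) x = (if y = x then Poly_Mapping.lookup p x else 0)"
      for y by (simp add: lookup_single)
    then show ?thesis by (simp add: lin_extend_def lookup_sum in_keys_iff)
  qed
qed

lemma lin_eq_lin_extend: "lin f \<Longrightarrow> f p = lin_extend (\<lambda>x. f (gen x)) p"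
  by (subst poly_mapping_eq_lin_extend_gen[of p, symmetric])
    (simp add: lin_extend_def lin_sum lin_scale)

lemma keys_plus_subset:
  "Poly_Mapping.keys p \<subseteq> S \<Longrightarrow> Poly_Mapping.keys q \<subseteq> S \<Longrightarrow> Poly_Mapping.keys (p + q) \<subseteq> S"
  using Poly_Mapping.keys_add[of p q] by blast

lemma keys_fscale_subset: "Poly_Mapping.keys p \<subseteq> S \<Longrightarrow> Poly_Mapping.keys (fscale c p) \<subseteq> S"
  by (auto simp: in_keys_iff)

lemma in_span_gen_iff: "p \<in> free.span (gen ` S) \<longleftrightarrow> Poly_Mapping.keys p \<subseteq> S"
proof
  show "p \<in> free.span (gen ` S) \<Longrightarrow> Poly_Mapping.keys p \<subseteq> S"
  proof (induction rule: free.span_induct_alt)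
    case (step c x y)
    then have "Poly_Mapping.keys x \<subseteq> S" by auto
    with step show ?case by (intro keys_plus_subset keys_fscale_subset)
  qed auto
  show "Poly_Mapping.keys p \<subseteq> S \<Longrightarrow> p \<in> free.span (gen ` S)"
    by (subst poly_mapping_eq_lin_extend_gen[of p, symmetric], unfold lin_extend_def)
      (intro free.span_sum free.span_scale free.span_base, blast)
qed

text \<open>With \<open>K = relations V\<close> this checks congruences word by word, and with
  \<open>K\<close> the span of a set of words it bounds supports. Restricting \<open>x\<close> to
  the support of \<open>p\<close> matters, since most statements hold only for words with letters in
  the right \<open>part\<close>.\<close>

lemma lin_in_subspace:
  assumes "lin f" "free.subspace K" "\<And>x. x \<in> Poly_Mapping.keys p \<Longrightarrow> f (gen x) \<in> K"
  shows "f p \<in> K"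
  by (subst lin_eq_lin_extend[OF assms(1)], unfold lin_extend_def)
    (use assms in \<open>auto intro!: free.subspace_sum free.subspace_scale\<close>)

lemma lin_eqI:
  assumes "lin f" "lin g" "\<And>x. x \<in> Poly_Mapping.keys p \<Longrightarrow> f (gen x) = g (gen x)"
  shows "f p = g p"
  by (subst (1 2) lin_eq_lin_extend) (use assms in \<open>auto simp: lin_extend_def\<close>)

lemma keys_lin_subset:
  assumes "lin f" "\<And>x. x \<in> Poly_Mapping.keys p \<Longrightarrow> Poly_Mapping.keys (f (gen x)) \<subseteq> S"
  shows "Poly_Mapping.keys (f p) \<subseteq> S"
  using lin_in_subspace[OF assms(1) free.subspace_span, of p "gen ` S"] assms(2)
  by (auto simp: in_span_gen_iff)

lemma keys_sum_subset:
  "(\<And>i. i \<in> I \<Longrightarrow> Poly_Mapping.keys (f i) \<subseteq> S) \<Longrightarrow> Poly_Mapping.keys (sum f I) \<subseteq> S"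
  by (induction I rule: infinite_finite_induct) (simp_all add: keys_plus_subset)

lemma lin_bilin_extend_left [lin_intros]: "lin g \<Longrightarrow> lin (\<lambda>p. bilin_extend f (g p) q)"
  unfolding bilin_extend_def by (rule lin_intros)

lemma lin_bilin_extend_right [lin_intros]:
  assumes "lin g" shows "lin (\<lambda>q. bilin_extend f p (g q))"
proof -
  have "lin (\<lambda>q. bilin_extend f p q)"
    unfolding bilin_extend_def lin_extend_def[of _ p] by (rule lin_intros)+
  from lin_compose[OF this assms] show ?thesis .
qed

lemma bilin_extend_gen [simp]: "bilin_extend f (gen x) (gen y) = f x y"
  by (simp add: bilin_extend_def)

definition prep :: "'x \<Rightarrow> ('x list \<Rightarrow>\<^sub>0 'k::field) \<Rightarrow> ('x list \<Rightarrow>\<^sub>0 'k)" where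
  "prep x = lin_extend (\<lambda>w. gen (x # w))"

lemma prep_gen [simp]: "prep x (gen w) = gen (x # w)"
  by (simp add: prep_def)

lemma lin_prep [lin_intros]: "lin g \<Longrightarrow> lin (\<lambda>p. prep x (g p))"
  unfolding prep_def by (rule lin_intros)

lemmas lin_prep' = lin_prep[OF lin_id]
lemmas prep_simps [simp] = lin_add[OF lin_prep'] lin_diff[OF lin_prep'] lin_scale[OF lin_prep']
  lin_zero[OF lin_prep']
lemmas prep_sum = lin_sum[OF lin_prep']

lemma keys_prep: "Poly_Mapping.keys (prep x p) \<subseteq> (#) x ` Poly_Mapping.keys p"
  by (rule keys_lin_subset[OF lin_prep']) auto


section \<open>Congruence modulo the multilinearity relations\<close>

lemma words_Nil [simp]: "[] \<in> words V"
  and words_Cons [simp]: "x # w \<in> words V \<longleftrightarrow> snd x \<in> part V (fst x) \<and> w \<in> words V"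
  and words_append [simp]: "u @ w \<in> words V \<longleftrightarrow> u \<in> words V \<and> w \<in> words V"
  by (auto simp: words_def)

lemma wdeg_Nil [simp]: "wdeg [] = 0"
  and wdeg_Cons [simp]: "wdeg (x # w) = fst x + wdeg w"
  and wdeg_append [simp]: "wdeg (u @ w) = wdeg u + wdeg w"
  by (auto simp: wdeg_def)

lemma words_take [simp]: "w \<in> words V \<Longrightarrow> take i w \<in> words V"
  and words_drop [simp]: "w \<in> words V \<Longrightarrow> drop i w \<in> words V"
  by (auto simp: words_def dest: in_set_takeD in_set_dropD)

lemma wdeg_take_drop [simp]: "wdeg (take i w) + wdeg (drop i w) = wdeg w"
  by (metis append_take_drop_id wdeg_append)

lemma subspace_relations: "free.subspace (relations V)"
  by (simp add: relations_def)

lemma relations_closed: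
  "0 \<in> relations V"
  "p \<in> relations V \<Longrightarrow> q \<in> relations V \<Longrightarrow> p + q \<in> relations V"
  "p \<in> relations V \<Longrightarrow> q \<in> relations V \<Longrightarrow> p - q \<in> relations V"
  "p \<in> relations V \<Longrightarrow> fscale c p \<in> relations V"
  by (simp_all add: relations_def free.span_zero free.span_add free.span_diff free.span_scale)

definition eqv :: "('k::field, 'v, 'e) graded_space_scheme \<Rightarrow> ('v word \<Rightarrow>\<^sub>0 'k) \<Rightarrow> ('v word \<Rightarrow>\<^sub>0 'k) \<Rightarrow> bool"
  where "eqv V p q \<longleftrightarrow> p - q \<in> relations V"

lemma eqv_refl [simp]: "eqv V p p"
  by (simp add: eqv_def relations_closed)

lemma eqv_sym: "eqv V p q \<Longrightarrow> eqv V q p"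
  unfolding eqv_def using relations_closed(3)[OF relations_closed(1), of "p - q"] by simp

lemma eqv_trans [trans]: "eqv V p q \<Longrightarrow> eqv V q r \<Longrightarrow> eqv V p r"
  unfolding eqv_def using relations_closed(2)[of "p - q" V "q - r"] by simp

lemma eqv_add: "eqv V p q \<Longrightarrow> eqv V p' q' \<Longrightarrow> eqv V (p + p') (q + q')"
  unfolding eqv_def using relations_closed(2)[of "p - q" V "p' - q'"] by (simp add: algebra_simps)

lemma eqv_fscale: "eqv V p q \<Longrightarrow> eqv V (fscale c p) (fscale c q)"
  unfolding eqv_def using relations_closed(4)[of "p - q"] by (simp add: free.scale_right_diff_distrib)

lemma eqv_sum: "(\<And>i. i \<in> I \<Longrightarrow> eqv V (f i) (g i)) \<Longrightarrow> eqv V (sum f I) (sum g I)"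
  by (induction I rule: infinite_finite_induct) (auto intro!: eqv_add)

lemma lin_eqvI:
  assumes "lin f" "lin g" "\<And>x. x \<in> Poly_Mapping.keys p \<Longrightarrow> eqv V (f (gen x)) (g (gen x))"
  shows "eqv V (f p) (g p)"
  using assms(3) unfolding eqv_def
  by (rule lin_in_subspace[OF lin_minus[OF assms(1,2)] subspace_relations])

lemma coset_eq_iff: "coset V p = coset V q \<longleftrightarrow> eqv V p q"
  unfolding coset_def eqv_def[symmetric]
  by (auto intro: eqv_sym eqv_trans)

lemma rep_coset: "eqv V (rep (coset V p)) p"
proof -
  have "p \<in> coset V p" by (simp add: coset_def relations_closed)
  then have "rep (coset V p) \<in> coset V p" unfolding rep_def by (rule someI)
  then show ?thesis by (simp add: coset_def eqv_def)
qed

text \<open>Two choices of \<open>K\<close> occur: \<open>relations W\<close>, when \<open>f\<close>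
  is to descend to a map between tensor powers, and \<open>{0}\<close>, when its values themselves
  must not depend on the representative, as for coordinates in a basis.\<close>

definition multilinear_mod ::
  "('k::field, 'v, 'e) graded_space_scheme \<Rightarrow> ('y \<Rightarrow>\<^sub>0 'k) set \<Rightarrow> ('v word \<Rightarrow> ('y \<Rightarrow>\<^sub>0 'k)) \<Rightarrow> bool" where
  "multilinear_mod V K f \<longleftrightarrow> (\<forall>us\<in>words V. \<forall>ws\<in>words V. \<forall>n. \<forall>x\<in>part V n.
     (\<forall>y\<in>part V n. f (us @ (n, vadd V x y) # ws) - f (us @ (n, x) # ws) - f (us @ (n, y) # ws) \<in> K) \<and>
     (\<forall>c. f (us @ (n, vscale V c x) # ws) - fscale c (f (us @ (n, x) # ws)) \<in> K))"

text \<open>The universal property of the tensor power: the preimage of \<open>K\<close> is a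
  subspace, so it is enough that it contains the generators of \<open>relations V\<close>.\<close>

lemma lin_relations_subspace:
  assumes "lin f" "free.subspace K" "multilinear_mod V K (\<lambda>w. f (gen w))" "p \<in> relations V"
  shows "f p \<in> K"
proof -
  have sub: "free.subspace {p. f p \<in> K}"
    using assms(1,2) by (auto simp: free.subspace_def lin_add lin_scale lin_zero)
  show ?thesis
    using assms(4) unfolding relations_def
    by (rule free.span_induct[OF _ sub])
      (use assms(3) in \<open>auto simp: multilinear_mod_def lin_diff[OF assms(1)] lin_scale[OF assms(1)]\<close>)
qed

lemma lin_relations_eqv:
  assumes "lin f" "multilinear_mod V (relations W) (\<lambda>w. f (gen w))" "eqv V p q"
  shows "eqv W (f p) (f q)"
  using lin_relations_subspace[OF assms(1) subspace_relations assms(2), of "p - q"] assms(3)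
  by (simp add: eqv_def lin_diff[OF assms(1)])

lemma multilinear_mod_gen: "multilinear_mod V (relations V) gen"
  unfolding multilinear_mod_def
proof (intro ballI allI conjI)
  fix us ws n x c assume *: "us \<in> words V" "ws \<in> words V" "x \<in> part V n"
  show "gen (us @ (n, vadd V x y) # ws) - gen (us @ (n, x) # ws) - gen (us @ (n, y) # ws) \<in> relations V"
    if "y \<in> part V n" for y
    unfolding relations_def using * that by (intro free.span_base UnI1) blast
  show "gen (us @ (n, vscale V c x) # ws) - fscale c (gen (us @ (n, x) # ws)) \<in> relations V"
    unfolding relations_def using * by (intro free.span_base UnI2) blast
qed

text \<open>The relations are stable under putting a letter in front, because \<open>x\<close> can
  be absorbed into the left context \<open>us\<close>.\<close>

lemma multilinear_mod_gen_Cons: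
  assumes "snd x \<in> part V (fst x)"
  shows "multilinear_mod V (relations V) (\<lambda>w. gen (x # w))"
  unfolding multilinear_mod_def
proof (intro ballI allI)
  fix us ws n y assume "us \<in> words V" "ws \<in> words V" "y \<in> part V n"
  moreover from this assms have "x # us \<in> words V" by simp
  ultimately show "(\<forall>z\<in>part V n. gen (x # us @ (n, vadd V y z) # ws) - gen (x # us @ (n, y) # ws) - gen (x # us @ (n, z) # ws) \<in> relations V) \<and>
     (\<forall>c. gen (x # us @ (n, vscale V c y) # ws) - fscale c (gen (x # us @ (n, y) # ws)) \<in> relations V)"
    using multilinear_mod_gen[of V, unfolded multilinear_mod_def, rule_format, of "x # us" ws] by auto
qed

lemma eqv_prep:
  assumes "snd x \<in> part V (fst x)" "eqv V p q"
  shows "eqv V (prep x p) (prep x q)"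
  by (rule lin_relations_eqv[OF lin_prep' _ assms(2)])
    (simp add: multilinear_mod_gen_Cons assms(1))

section \<open>The recursion of the quasi-shuffle product\<close>

text \<open>Hoffman's recursion for the quasi-shuffle product: the result starts with
  \<open>x\<close>, with \<open>y\<close> or with the merged letter. The exponents record what
  \<open>y\<close> jumps over, namely all of \<open>x # u\<close> when it comes first, but only
  \<open>u\<close> when it is merged to the right of \<open>x\<close>.\<close>

fun qsh :: "'a::ring_1 word \<Rightarrow> 'a word \<Rightarrow> ('a word \<Rightarrow>\<^sub>0 'k::field)" where
  "qsh [] v = gen v"
| "qsh (x # u) [] = gen (x # u)"
| "qsh (x # u) (y # v) =
     prep x (qsh u (y # v)) +
     fscale ((-1) ^ (fst y * wdeg (x # u))) (prep y (qsh (x # u) v)) +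
     fscale ((-1) ^ (fst y * wdeg u)) (prep (fst x + fst y, snd x * snd y) (qsh u v))"

lemma qsh_Nil_right [simp]: "qsh u [] = gen u"
  by (cases u) auto

section \<open>Quasi-shuffles sorted by what reaches the first position\<close>

definition increasing :: "nat \<Rightarrow> nat \<Rightarrow> (nat \<Rightarrow> nat) set" where
  "increasing l n = {\<alpha> \<in> {..<l} \<rightarrow>\<^sub>E {..<n}. strict_mono_on {..<l} \<alpha>}"

lemma quasi_shuffles_eq:
  "quasi_shuffles l m n = {(\<alpha>, \<beta>). \<alpha> \<in> increasing l n \<and> \<beta> \<in> increasing m n \<and> \<alpha> ` {..<l} \<union> \<beta> ` {..<m} = {..<n}}"
  by (auto simp: quasi_shuffles_def increasing_def)

lemma finite_quasi_shuffles [simp]: "finite (quasi_shuffles l m n)"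
proof (rule finite_subset)
  show "quasi_shuffles l m n \<subseteq> ({..<l} \<rightarrow>\<^sub>E {..<n}) \<times> ({..<m} \<rightarrow>\<^sub>E {..<n})"
    by (auto simp: quasi_shuffles_def)
qed (auto intro!: finite_PiE)

text \<open>An increasing map into \<open>Suc n\<close> positions either hits position
  \<open>0\<close>, necessarily with its first argument, or misses it. \<open>cons_map\<close> and
  \<open>lift_map\<close> build these two shapes from a map into \<open>n\<close> positions;
  \<open>restrict\<close> keeps them extensional, as the function spaces in
  \<open>quasi_shuffles\<close> demand.\<close>

definition cons_map :: "nat \<Rightarrow> (nat \<Rightarrow> nat) \<Rightarrow> nat \<Rightarrow> nat" where
  "cons_map l \<alpha> = restrict (case_nat 0 (\<lambda>j. Suc (\<alpha> j))) {..<Suc l}"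

definition lift_map :: "nat \<Rightarrow> (nat \<Rightarrow> nat) \<Rightarrow> nat \<Rightarrow> nat" where
  "lift_map l \<alpha> = restrict (\<lambda>j. Suc (\<alpha> j)) {..<l}"

lemma cons_map_0 [simp]: "cons_map l \<alpha> 0 = 0"
  and cons_map_Suc [simp]: "j < l \<Longrightarrow> cons_map l \<alpha> (Suc j) = Suc (\<alpha> j)"
  and lift_map_app [simp]: "j < l \<Longrightarrow> lift_map l \<alpha> j = Suc (\<alpha> j)"
  by (auto simp: cons_map_def lift_map_def)

lemma cons_map_image: "cons_map l \<alpha> ` {..<Suc l} = insert 0 (Suc ` \<alpha> ` {..<l})"
  by (force simp: lessThan_Suc_eq_insert_0)

lemma lift_map_image: "lift_map l \<alpha> ` {..<l} = Suc ` \<alpha> ` {..<l}"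
  by force

lemma cons_map_increasing:
  assumes "\<alpha> \<in> increasing l n" shows "cons_map l \<alpha> \<in> increasing (Suc l) (Suc n)"
proof -
  have "cons_map l \<alpha> i < cons_map l \<alpha> j" if "i < j" "j < Suc l" for i j
    using that assms by (cases i; cases j) (auto simp: increasing_def strict_mono_on_def)
  moreover have "cons_map l \<alpha> i < Suc n" if "i < Suc l" for i
    using that assms by (cases i) (auto simp: increasing_def)
  ultimately show ?thesis
    by (auto simp: increasing_def strict_mono_on_def) (auto simp: cons_map_def split: if_splits)
qed

lemma lift_map_increasing:
  assumes "\<alpha> \<in> increasing l n" shows "lift_map l \<alpha> \<in> increasing l (Suc n)"
  using assms by (auto simp: increasing_def strict_mono_on_def) (auto simp: lift_map_def split: if_splits)

lemma increasing_consE: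
  assumes "\<alpha> \<in> increasing (Suc l) (Suc n)" "0 \<in> \<alpha> ` {..<Suc l}"
  obtains \<alpha>' where "\<alpha>' \<in> increasing l n" "\<alpha> = cons_map l \<alpha>'"
proof
  have mono: "\<alpha> i < \<alpha> j" if "i < j" "j < Suc l" for i j
    using that assms(1) by (auto simp: increasing_def strict_mono_on_def)
  \<comment> \<open>Some argument is sent to \<open>0\<close>; if it were not the first one, the
    first one would have a value below \<open>0\<close>.\<close>
  have zero: "\<alpha> 0 = 0"
    using assms(2) mono by (metis gr_zeroI imageE lessThan_iff less_nat_zero_code)
  have pos: "0 < \<alpha> (Suc j)" if "j < l" for j
    using mono[of 0 "Suc j"] that by simp
  let ?\<alpha>' = "restrict (\<lambda>j. \<alpha> (Suc j) - 1) {..<l}"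
  have "\<alpha> j < Suc n" if "j < Suc l" for j
    using assms(1) that by (auto simp: increasing_def)
  then have "\<alpha> (Suc j) - 1 < n" if "j < l" for j
    using that pos[OF that] by fastforce
  moreover have "\<alpha> (Suc i) - 1 < \<alpha> (Suc j) - 1" if "i < j" "j < l" for i j
    using mono[of "Suc i" "Suc j"] pos[of i] that by simp
  ultimately show "?\<alpha>' \<in> increasing l n"
    by (auto simp: increasing_def strict_mono_on_def)
  show "\<alpha> = cons_map l ?\<alpha>'"
  proof
    fix j show "\<alpha> j = cons_map l ?\<alpha>' j"
      using assms(1) zero pos
      by (cases j) (auto simp: cons_map_def increasing_def PiE_def extensional_def)
  qed
qed

lemma increasing_liftE:
  assumes "\<alpha> \<in> increasing l (Suc n)" "0 \<notin> \<alpha> ` {..<l}"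
  obtains \<alpha>' where "\<alpha>' \<in> increasing l n" "\<alpha> = lift_map l \<alpha>'"
proof
  have mono: "\<alpha> i < \<alpha> j" if "i < j" "j < l" for i j
    using that assms(1) by (auto simp: increasing_def strict_mono_on_def)
  have pos: "0 < \<alpha> j" if "j < l" for j
    using assms(2) that by (metis gr_zeroI imageI lessThan_iff)
  let ?\<alpha>' = "restrict (\<lambda>j. \<alpha> j - 1) {..<l}"
  have "\<alpha> j < Suc n" if "j < l" for j
    using assms(1) that by (auto simp: increasing_def)
  then have "\<alpha> j - 1 < n" if "j < l" for j
    using that pos[OF that] by fastforce
  moreover have "\<alpha> i - 1 < \<alpha> j - 1" if "i < j" "j < l" for i j
    using mono[of i j] pos[of i] that by simp
  ultimately show "?\<alpha>' \<in> increasing l n"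
    by (auto simp: increasing_def strict_mono_on_def)
  show "\<alpha> = lift_map l ?\<alpha>'"
  proof
    fix j show "\<alpha> j = lift_map l ?\<alpha>' j"
      using assms(1) pos
      by (cases "j < l") (auto simp: lift_map_def increasing_def PiE_def extensional_def)
  qed
qed

lemma cons_map_inj:
  assumes "\<alpha> \<in> increasing l n" "\<beta> \<in> increasing l n" "cons_map l \<alpha> = cons_map l \<beta>"
  shows "\<alpha> = \<beta>"
proof (rule PiE_ext)
  show "\<alpha> \<in> {..<l} \<rightarrow>\<^sub>E {..<n}" "\<beta> \<in> {..<l} \<rightarrow>\<^sub>E {..<n}"
    using assms(1,2) unfolding increasing_def by blast+
  show "\<alpha> j = \<beta> j" if "j \<in> {..<l}" for j
    using fun_cong[OF assms(3), of "Suc j"] that by simp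
qed

lemma lift_map_inj:
  assumes "\<alpha> \<in> increasing l n" "\<beta> \<in> increasing l n" "lift_map l \<alpha> = lift_map l \<beta>"
  shows "\<alpha> = \<beta>"
proof (rule PiE_ext)
  show "\<alpha> \<in> {..<l} \<rightarrow>\<^sub>E {..<n}" "\<beta> \<in> {..<l} \<rightarrow>\<^sub>E {..<n}"
    using assms(1,2) unfolding increasing_def by blast+
  show "\<alpha> j = \<beta> j" if "j \<in> {..<l}" for j
    using fun_cong[OF assms(3), of j] that by simp
qed

lemma insert_0_Suc_image_eq:
  "insert 0 (Suc ` X) = {..<Suc n} \<longleftrightarrow> X = {..<n}"
  unfolding lessThan_Suc_eq_insert_0 by auto

text \<open>Joint surjectivity leaves three cases: the first position is reached by
  \<open>\<alpha>\<close> only, by \<open>\<beta>\<close> only, or by both. They become the three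
  summands of \<open>qsh\<close>.\<close>

lemma quasi_shuffles_Suc:
  "quasi_shuffles (Suc l) (Suc m) (Suc n) =
     map_prod (cons_map l) (lift_map (Suc m)) ` quasi_shuffles l (Suc m) n \<union>
     map_prod (lift_map (Suc l)) (cons_map m) ` quasi_shuffles (Suc l) m n \<union>
     map_prod (cons_map l) (cons_map m) ` quasi_shuffles l m n"
  (is "?L = ?A \<union> ?B \<union> ?C")
proof
  have "?A \<subseteq> ?L" "?B \<subseteq> ?L" "?C \<subseteq> ?L"
    by (clarsimp simp: quasi_shuffles_eq cons_map_increasing lift_map_increasing cong del: image_cong_simp,
        simp add: cons_map_image lift_map_image insert_0_Suc_image_eq image_Un[symmetric]
          del: image_Un cong del: image_cong_simp)+
  then show "?A \<union> ?B \<union> ?C \<subseteq> ?L" by blast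
  show "?L \<subseteq> ?A \<union> ?B \<union> ?C"
  proof clarify
    fix \<alpha> \<beta> assume *: "(\<alpha>, \<beta>) \<in> ?L" "(\<alpha>, \<beta>) \<notin> ?C" "(\<alpha>, \<beta>) \<notin> ?B"
    then have mem: "\<alpha> \<in> increasing (Suc l) (Suc n)" "\<beta> \<in> increasing (Suc m) (Suc n)"
      and im: "\<alpha> ` {..<Suc l} \<union> \<beta> ` {..<Suc m} = {..<Suc n}"
      by (auto simp: quasi_shuffles_eq)
    show "(\<alpha>, \<beta>) \<in> ?A"
    proof (cases "0 \<in> \<alpha> ` {..<Suc l}"; cases "0 \<in> \<beta> ` {..<Suc m}")
      assume "0 \<in> \<alpha> ` {..<Suc l}" "0 \<notin> \<beta> ` {..<Suc m}"
      then obtain \<alpha>' \<beta>' where 1: "\<alpha>' \<in> increasing l n" "\<alpha> = cons_map l \<alpha>'"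
        "\<beta>' \<in> increasing (Suc m) n" "\<beta> = lift_map (Suc m) \<beta>'"
        using mem by (metis increasing_consE increasing_liftE)
      then have "(\<alpha>', \<beta>') \<in> quasi_shuffles l (Suc m) n"
        using im by (simp add: quasi_shuffles_eq cons_map_image lift_map_image
            insert_0_Suc_image_eq image_Un[symmetric] del: image_Un cong del: image_cong_simp)
      with 1 show ?thesis by force
    next
      assume "0 \<notin> \<alpha> ` {..<Suc l}" "0 \<in> \<beta> ` {..<Suc m}"
      then obtain \<alpha>' \<beta>' where 1: "\<alpha>' \<in> increasing (Suc l) n" "\<alpha> = lift_map (Suc l) \<alpha>'"
        "\<beta>' \<in> increasing m n" "\<beta> = cons_map m \<beta>'"
        using mem by (metis increasing_consE increasing_liftE)
      then have "(\<alpha>', \<beta>') \<in> quasi_shuffles (Suc l) m n"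
        using im by (simp add: quasi_shuffles_eq cons_map_image lift_map_image
            insert_0_Suc_image_eq image_Un[symmetric] del: image_Un cong del: image_cong_simp)
      with 1 *(3) show ?thesis by force
    next
      assume "0 \<in> \<alpha> ` {..<Suc l}" "0 \<in> \<beta> ` {..<Suc m}"
      then obtain \<alpha>' \<beta>' where 1: "\<alpha>' \<in> increasing l n" "\<alpha> = cons_map l \<alpha>'"
        "\<beta>' \<in> increasing m n" "\<beta> = cons_map m \<beta>'"
        using mem by (metis increasing_consE)
      then have "(\<alpha>', \<beta>') \<in> quasi_shuffles l m n"
        using im by (simp add: quasi_shuffles_eq cons_map_image lift_map_image
            insert_0_Suc_image_eq image_Un[symmetric] del: image_Un cong del: image_cong_simp)
      with 1 *(2) show ?thesis by force
    next
      assume "0 \<notin> \<alpha> ` {..<Suc l}" "0 \<notin> \<beta> ` {..<Suc m}"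
      then show ?thesis using im by blast
    qed
  qed
qed

lemma increasing_0 [simp]: "increasing 0 n = {\<lambda>_. undefined}"
  by (auto simp: increasing_def)

lemma lift_map_0 [simp]: "lift_map 0 \<alpha> = (\<lambda>_. undefined)"
  by (auto simp: lift_map_def)

lemma quasi_shuffles_0_left_Suc:
  "quasi_shuffles 0 (Suc m) (Suc n) = map_prod (lift_map 0) (cons_map m) ` quasi_shuffles 0 m n"
  (is "?L = ?B")
proof
  show "?B \<subseteq> ?L"
    by (clarsimp simp: quasi_shuffles_eq cons_map_increasing)
      (simp add: cons_map_image insert_0_Suc_image_eq cong del: image_cong_simp)
  show "?L \<subseteq> ?B"
  proof clarify
    fix \<alpha> \<beta> assume "(\<alpha>, \<beta>) \<in> ?L"
    then have mem: "\<alpha> = (\<lambda>_. undefined)" "\<beta> \<in> increasing (Suc m) (Suc n)"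
      and im: "\<beta> ` {..<Suc m} = {..<Suc n}"
      by (auto simp: quasi_shuffles_eq)
    then obtain \<beta>' where 1: "\<beta>' \<in> increasing m n" "\<beta> = cons_map m \<beta>'"
      by (metis lessThan_iff increasing_consE zero_less_Suc)
    then have "(\<alpha>, \<beta>') \<in> quasi_shuffles 0 m n"
      using im mem by (simp add: quasi_shuffles_eq cons_map_image insert_0_Suc_image_eq)
    with 1 mem(1) show "(\<alpha>, \<beta>) \<in> ?B" by force
  qed
qed

lemma quasi_shuffles_0_right_Suc:
  "quasi_shuffles (Suc l) 0 (Suc n) = map_prod (cons_map l) (lift_map 0) ` quasi_shuffles l 0 n"
  (is "?L = ?B")
proof
  show "?B \<subseteq> ?L"
    by (clarsimp simp: quasi_shuffles_eq cons_map_increasing)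
      (simp add: cons_map_image insert_0_Suc_image_eq cong del: image_cong_simp)
  show "?L \<subseteq> ?B"
  proof clarify
    fix \<alpha> \<beta> assume "(\<alpha>, \<beta>) \<in> ?L"
    then have mem: "\<beta> = (\<lambda>_. undefined)" "\<alpha> \<in> increasing (Suc l) (Suc n)"
      and im: "\<alpha> ` {..<Suc l} = {..<Suc n}"
      by (auto simp: quasi_shuffles_eq)
    then obtain \<alpha>' where 1: "\<alpha>' \<in> increasing l n" "\<alpha> = cons_map l \<alpha>'"
      by (metis lessThan_iff increasing_consE zero_less_Suc)
    then have "(\<alpha>', \<beta>) \<in> quasi_shuffles l 0 n"
      using im mem by (simp add: quasi_shuffles_eq cons_map_image insert_0_Suc_image_eq)
    with 1 mem(1) show "(\<alpha>, \<beta>) \<in> ?B" by force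
  qed
qed

lemma quasi_shuffles_to_0: "l > 0 \<or> m > 0 \<Longrightarrow> quasi_shuffles l m 0 = {}"
  by (auto simp: quasi_shuffles_eq)

lemma quasi_shuffles_0_0: "quasi_shuffles 0 0 n = (if n = 0 then {(\<lambda>_. undefined, \<lambda>_. undefined)} else {})"
  by (auto simp: quasi_shuffles_eq)

section \<open>Letters and signs of a single quasi-shuffle\<close>

definition combine :: "'a::ring_1 word \<Rightarrow> nat \<times> 'a" where
  "combine ls = (sum_list (map fst ls), prod_list (map snd ls))"

lemma combine_single [simp]: "combine [x] = x"
  and combine_pair [simp]: "combine [x, y] = (fst x + fst y, snd x * snd y)"
  by (simp_all add: combine_def)

definition pick :: "'a word \<Rightarrow> (nat \<Rightarrow> nat) \<Rightarrow> nat \<Rightarrow> 'a word" where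
  "pick u \<alpha> i = map ((!) u) (filter (\<lambda>j. \<alpha> j = i) [0..<length u])"

text \<open>The Koszul sign restricted to pairs with one letter in each word. A pair sent to the
  same position is not counted, since the letter of \<open>u\<close> already stands to the left of
  the letter of \<open>v\<close> in the merged product.\<close>

definition cross_sign :: "'a word \<Rightarrow> 'a word \<Rightarrow> (nat \<Rightarrow> nat) \<Rightarrow> (nat \<Rightarrow> nat) \<Rightarrow> 'k::field" where
  "cross_sign u v \<alpha> \<beta> = (\<Prod>j<length u. \<Prod>j'<length v.
     if \<beta> j' < \<alpha> j then (-1) ^ (fst (u ! j) * fst (v ! j')) else 1)"

definition qs_term :: "'a::ring_1 word \<Rightarrow> 'a word \<Rightarrow> nat \<Rightarrow> (nat \<Rightarrow> nat) \<Rightarrow> (nat \<Rightarrow> nat) \<Rightarrow> ('a word \<Rightarrow>\<^sub>0 'k::field)" where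
  "qs_term u v n \<alpha> \<beta> = fscale (cross_sign u v \<alpha> \<beta>)
     (gen (map (\<lambda>i. combine (pick u \<alpha> i @ pick v \<beta> i)) [0..<n]))"

lemma merged_letter_join:
  "merged_letter (u @ v) (join (length u) \<alpha> \<beta>) i = combine (pick u \<alpha> i @ pick v \<beta> i)"
proof -
  let ?l = "length u"
  have "[0..<length (u @ v)] = [0..<?l] @ map (\<lambda>j. j + ?l) [0..<length v]"
    by (simp add: map_add_upt upt_add_eq_append[of 0] add.commute)
  then have "map ((!) (u @ v)) (filter (\<lambda>j. join ?l \<alpha> \<beta> j = i) [0..<length (u @ v)]) = pick u \<alpha> i @ pick v \<beta> i"
    by (simp add: pick_def filter_map o_def)
      (auto simp: join_def nth_append intro!: map_cong filter_cong)
  then show ?thesis by (simp add: merged_letter_def combine_def Let_def)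
qed

text \<open>Since \<open>\<alpha>\<close> and \<open>\<beta>\<close> are increasing, no inversion
  lies inside \<open>u\<close> or inside \<open>v\<close>; shifting the second index by
  \<open>length u\<close> matches the remaining pairs.\<close>

lemma koszul_sign_join:
  assumes "(\<alpha>, \<beta>) \<in> quasi_shuffles (length u) (length v) n"
  shows "koszul_sign (u @ v) (join (length u) \<alpha> \<beta>) = (cross_sign u v \<alpha> \<beta> :: 'k::field)"
proof -
  let ?l = "length u" and ?m = "length v"
  have mono: "\<alpha> i < \<alpha> j" if "i < j" "j < ?l" for i j
    using that assms by (auto simp: quasi_shuffles_def strict_mono_on_def)
  have mono': "\<beta> i < \<beta> j" if "i < j" "j < ?m" for i j
    using that assms by (auto simp: quasi_shuffles_def strict_mono_on_def)
  let ?S = "{(j, j'). j < ?l \<and> j' < ?m \<and> \<beta> j' < \<alpha> j}"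
  have "koszul_sign (u @ v) (join ?l \<alpha> \<beta>) = (\<Prod>(j, j')\<in>?S. (-1 :: 'k) ^ (fst (u ! j) * fst (v ! j')))"
    unfolding koszul_sign_def
  proof (rule prod.reindex_bij_witness[of _ "\<lambda>(j, j'). (j, j' + ?l)" "\<lambda>(j, j'). (j, j' - ?l)"])
    fix a assume "a \<in> {(j, j'). j < j' \<and> j' < length (u @ v) \<and> join ?l \<alpha> \<beta> j' < join ?l \<alpha> \<beta> j}"
    then obtain j j' where a: "a = (j, j')" "j < j'" "j' < ?l + ?m" "join ?l \<alpha> \<beta> j' < join ?l \<alpha> \<beta> j"
      by auto
    have "j' \<ge> ?l" using a mono[of j j'] by (auto simp: join_def split: if_splits)
    moreover have "j < ?l"
    proof (rule ccontr)
      assume "\<not> j < ?l"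
      then have "j - ?l < j' - ?l" "j' - ?l < ?m" using a by auto
      from mono'[OF this] \<open>\<not> j < ?l\<close> a(4) \<open>j' \<ge> ?l\<close> show False by (simp add: join_def)
    qed
    ultimately show "(case case a of (j, j') \<Rightarrow> (j, j' - ?l) of (j, j') \<Rightarrow> (j, j' + ?l)) = a"
      "(case a of (j, j') \<Rightarrow> (j, j' - ?l)) \<in> ?S"
      "(case case a of (j, j') \<Rightarrow> (j, j' - ?l) of (j, j') \<Rightarrow> (-1) ^ (fst (u ! j) * fst (v ! j'))) =
         (case a of (j, j') \<Rightarrow> (-1 :: 'k) ^ (fst ((u @ v) ! j) * fst ((u @ v) ! j')))"
      using a by (auto simp: join_def nth_append)
  qed (auto simp: join_def)
  also have "\<dots> = (\<Prod>(j, j')\<in>{..<?l} \<times> {..<?m}. if \<beta> j' < \<alpha> j then (-1) ^ (fst (u ! j) * fst (v ! j')) else 1)"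
    by (rule prod.mono_neutral_cong_left) (auto split: if_splits)
  also have "\<dots> = cross_sign u v \<alpha> \<beta>"
    by (simp add: cross_sign_def prod.cartesian_product)
  finally show ?thesis .
qed

lemma filter_upt_Suc: "filter P [0..<Suc n] = (if P 0 then [0] else []) @ map Suc (filter (\<lambda>j. P (Suc j)) [0..<n])"
  by (simp only: upt_conv_Cons[OF zero_less_Suc] map_Suc_upt[symmetric])
    (simp add: filter_map o_def)

lemma pick_cons_map_0 [simp]: "pick (x # u) (cons_map (length u) \<alpha>) 0 = [x]"
  by (simp add: pick_def filter_upt_Suc del: upt_Suc cong: filter_cong)

lemma pick_cons_map_Suc [simp]: "pick (x # u) (cons_map (length u) \<alpha>) (Suc i) = pick u \<alpha> i"
  by (auto simp: pick_def filter_upt_Suc o_def simp del: upt_Suc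
      intro!: arg_cong[where f = "map _"] filter_cong)

lemma pick_lift_map_0 [simp]: "l = length u \<Longrightarrow> pick u (lift_map l \<alpha>) 0 = []"
  by (simp add: pick_def cong: filter_cong)

lemma pick_lift_map_Suc [simp]: "l = length u \<Longrightarrow> pick u (lift_map l \<alpha>) (Suc i) = pick u \<alpha> i"
  by (auto simp: pick_def intro!: arg_cong[where f = "map _"] filter_cong)

lemma map_upt_Suc_Cons: "map f [0..<Suc n] = f 0 # map (\<lambda>i. f (Suc i)) [0..<n]"
  by (simp only: upt_conv_Cons[OF zero_less_Suc] map_Suc_upt[symmetric]) simp

lemma prod_sign_wdeg: "(\<Prod>j<length u. (-1) ^ (fst (u ! j) * d)) = ((-1) ^ (d * wdeg u) :: 'k::field)"
  by (induction u) (simp_all del: prod.lessThan_Suc add: prod.lessThan_Suc_shift power_add algebra_simps)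

lemma cross_sign_cons_lift:
  "l = length v \<Longrightarrow> cross_sign (x # u) v (cons_map (length u) \<alpha>) (lift_map l \<beta>) = cross_sign u v \<alpha> \<beta>"
  by (simp add: cross_sign_def prod.lessThan_Suc_shift del: prod.lessThan_Suc cong: if_cong)

lemma cross_sign_lift_cons:
  "l = length u \<Longrightarrow> cross_sign u (y # v) (lift_map l \<alpha>) (cons_map (length v) \<beta>) =
     (-1) ^ (fst y * wdeg u) * cross_sign u v \<alpha> \<beta>"
  by (simp add: cross_sign_def prod.lessThan_Suc_shift prod.distrib prod_sign_wdeg del: prod.lessThan_Suc cong: if_cong)

text \<open>The two leading letters meet at position \<open>0\<close> and form no inversion, so the
  new sign comes only from \<open>y\<close> passing the letters of \<open>u\<close>.\<close>

lemma cross_sign_cons_cons: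
  "cross_sign (x # u) (y # v) (cons_map (length u) \<alpha>) (cons_map (length v) \<beta>) =
     (-1) ^ (fst y * wdeg u) * cross_sign u v \<alpha> \<beta>"
  by (simp add: cross_sign_def prod.lessThan_Suc_shift prod.distrib prod_sign_wdeg del: prod.lessThan_Suc cong: if_cong)

lemma qs_term_cons_lift:
  "l = length v \<Longrightarrow> qs_term (x # u) v (Suc n) (cons_map (length u) \<alpha>) (lift_map l \<beta>) =
     prep x (qs_term u v n \<alpha> \<beta>)"
  by (simp add: qs_term_def cross_sign_cons_lift map_upt_Suc_Cons del: upt_Suc)

lemma qs_term_lift_cons:
  "l = length u \<Longrightarrow> qs_term u (y # v) (Suc n) (lift_map l \<alpha>) (cons_map (length v) \<beta>) =
     fscale ((-1) ^ (fst y * wdeg u)) (prep y (qs_term u v n \<alpha> \<beta>))"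
  by (simp add: qs_term_def cross_sign_lift_cons map_upt_Suc_Cons del: upt_Suc)

lemma qs_term_cons_cons:
  "qs_term (x # u) (y # v) (Suc n) (cons_map (length u) \<alpha>) (cons_map (length v) \<beta>) =
     fscale ((-1) ^ (fst y * wdeg u)) (prep (fst x + fst y, snd x * snd y) (qs_term u v n \<alpha> \<beta>))"
  by (simp add: qs_term_def cross_sign_cons_cons map_upt_Suc_Cons del: upt_Suc)

definition qs_part :: "'a::ring_1 word \<Rightarrow> 'a word \<Rightarrow> nat \<Rightarrow> ('a word \<Rightarrow>\<^sub>0 'k::field)" where
  "qs_part u v n = (\<Sum>(\<alpha>, \<beta>)\<in>quasi_shuffles (length u) (length v) n. qs_term u v n \<alpha> \<beta>)"

lemma inj_on_quasi_shuffles: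
  "inj_on (map_prod (cons_map l) (lift_map m)) (quasi_shuffles l m n)"
  "inj_on (map_prod (lift_map l) (cons_map m)) (quasi_shuffles l m n)"
  "inj_on (map_prod (cons_map l) (cons_map m)) (quasi_shuffles l m n)"
  by (auto simp: inj_on_def quasi_shuffles_eq dest: cons_map_inj lift_map_inj)

lemma qs_part_Suc:
  "qs_part (x # u) (y # v) (Suc n) =
     prep x (qs_part u (y # v) n) +
     fscale ((-1) ^ (fst y * wdeg (x # u))) (prep y (qs_part (x # u) v n)) +
     fscale ((-1) ^ (fst y * wdeg u)) (prep (fst x + fst y, snd x * snd y) (qs_part u v n))"
proof -
  let ?l = "length u" and ?m = "length v"
  let ?A = "map_prod (cons_map ?l) (lift_map (Suc ?m)) ` quasi_shuffles ?l (Suc ?m) n"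
  let ?B = "map_prod (lift_map (Suc ?l)) (cons_map ?m) ` quasi_shuffles (Suc ?l) ?m n"
  let ?C = "map_prod (cons_map ?l) (cons_map ?m) ` quasi_shuffles ?l ?m n"
  \<comment> \<open>The value at \<open>0\<close> tells the two shapes apart, so the three families
    are disjoint.\<close>
  have ne: "cons_map l \<alpha> \<noteq> lift_map (Suc l) \<beta>" "lift_map (Suc l) \<beta> \<noteq> cons_map l \<alpha>" for l \<alpha> \<beta>
    by (metis cons_map_0 lift_map_app nat.distinct(1) zero_less_Suc)+
  have disj: "?A \<inter> ?B = {}" "(?A \<union> ?B) \<inter> ?C = {}"
    using ne by (auto simp: map_prod_def)
  have "qs_part (x # u) (y # v) (Suc n) =
      (\<Sum>(\<alpha>, \<beta>)\<in>?A. qs_term (x # u) (y # v) (Suc n) \<alpha> \<beta>) +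
      (\<Sum>(\<alpha>, \<beta>)\<in>?B. qs_term (x # u) (y # v) (Suc n) \<alpha> \<beta>) +
      (\<Sum>(\<alpha>, \<beta>)\<in>?C. qs_term (x # u) (y # v) (Suc n) \<alpha> \<beta>)"
    by (simp add: qs_part_def quasi_shuffles_Suc sum.union_disjoint disj)
  then show ?thesis
    by (simp add: qs_term_cons_lift qs_term_lift_cons qs_term_cons_cons sum.reindex inj_on_quasi_shuffles qs_part_def case_prod_unfold prep_sum free.scale_sum_right)
qed

lemma qs_part_Nil_left_Suc: "qs_part [] (y # v) (Suc n) = prep y (qs_part [] v n)"
  by (simp add: qs_term_lift_cons qs_part_def quasi_shuffles_0_left_Suc sum.reindex inj_on_quasi_shuffles case_prod_unfold
      prep_sum del: lift_map_0)

lemma qs_part_Nil_right_Suc: "qs_part (x # u) [] (Suc n) = prep x (qs_part u [] n)"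
  by (simp add: qs_term_cons_lift qs_part_def quasi_shuffles_0_right_Suc sum.reindex inj_on_quasi_shuffles case_prod_unfold
      prep_sum del: lift_map_0)

lemma qs_part_0: "u \<noteq> [] \<or> v \<noteq> [] \<Longrightarrow> qs_part u v 0 = 0"
  by (auto simp: qs_part_def quasi_shuffles_to_0)

lemma qs_part_Nil_Nil: "qs_part [] [] n = (if n = 0 then gen [] else 0)"
  by (simp add: qs_part_def quasi_shuffles_0_0 qs_term_def cross_sign_def)

text \<open>The bound \<open>N\<close> is left free because merging uses up two letters at once: the
  three recursive calls have different total lengths but must share the bound
  \<open>N - 1\<close>.\<close>

lemma sum_qs_part: "length u + length v \<le> N \<Longrightarrow> (\<Sum>n\<le>N. qs_part u v n) = qsh u v"
proof (induction u v arbitrary: N rule: qsh.induct)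
  case (1 v)
  then show ?case
  proof (induction v arbitrary: N)
    case Nil
    then show ?case by (simp add: qs_part_Nil_Nil)
  next
    case (Cons y v)
    then obtain M where "N = Suc M" "length v \<le> M" by (cases N) auto
    with Cons show ?case
      by (simp add: sum.atMost_Suc_shift qs_part_0 qs_part_Nil_left_Suc prep_sum[symmetric] del: sum.atMost_Suc)
  qed
next
  case (2 x u)
  then show ?case
  proof (induction u arbitrary: x N)
    case Nil
    then obtain M where "N = Suc M" by (cases N) auto
    then show ?case
      by (simp add: sum.atMost_Suc_shift qs_part_0 qs_part_Nil_right_Suc prep_sum[symmetric] qs_part_Nil_Nil del: sum.atMost_Suc)
  next
    case (Cons y u)
    then obtain M where "N = Suc M" "Suc (length u) \<le> M" by (cases N) auto
    with Cons show ?case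
      by (simp add: sum.atMost_Suc_shift qs_part_0 qs_part_Nil_right_Suc prep_sum[symmetric] del: sum.atMost_Suc)
  qed
next
  case (3 x u y v)
  then obtain M where "N = Suc M" "Suc (length u + length v) \<le> M" by (cases N) auto
  with 3 show ?case
    by (simp add: sum.atMost_Suc_shift qs_part_0 qs_part_Suc sum.distrib prep_sum[symmetric]
        free.scale_sum_right[symmetric] del: sum.atMost_Suc)
qed

theorem quasi_shuffle_product_eq_qsh: "quasi_shuffle_product u v = qsh u v"
proof -
  have "quasi_shuffle_product u v = (\<Sum>n\<le>length u + length v. qs_part u v n)"
    unfolding quasi_shuffle_product_def qs_part_def
    by (intro sum.cong refl)
      (auto simp: qs_term_def koszul_sign_join merged_letter_join[abs_def])
  then show ?thesis by (simp add: sum_qs_part)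
qed

section \<open>Degrees and multilinearity of the quasi-shuffle product\<close>

definition homs :: "('k, 'v, 'e) graded_space_scheme \<Rightarrow> nat \<Rightarrow> 'v word set" where
  "homs V d = {w \<in> words V. wdeg w = d}"

lemma homs_words: "w \<in> homs V d \<Longrightarrow> w \<in> words V"
  by (simp add: homs_def)

lemma keys_prep_homs:
  assumes "Poly_Mapping.keys p \<subseteq> homs V d" "snd x \<in> part V (fst x)" "n = fst x + d"
  shows "Poly_Mapping.keys (prep x p) \<subseteq> homs V n"
  using keys_prep[of x p] assms by (force simp: homs_def)

text \<open>Additivity and homogeneity in one letter as a single relation between the values at
  \<open>c *s x + y\<close>, \<open>x\<close> and \<open>y\<close>; it is preserved by all constructions that fix the other letters.\<close>

definition lcomb :: "('k::field, 'v, 'e) graded_space_scheme \<Rightarrow> 'k \<Rightarrow>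
    ('v word \<Rightarrow>\<^sub>0 'k) \<Rightarrow> ('v word \<Rightarrow>\<^sub>0 'k) \<Rightarrow> ('v word \<Rightarrow>\<^sub>0 'k) \<Rightarrow> bool" where
  "lcomb W c P Q R \<longleftrightarrow> eqv W P (fscale c Q + R)"

lemma lcomb_add:
  assumes "lcomb W c P Q R" "lcomb W c P' Q' R'"
  shows "lcomb W c (P + P') (Q + Q') (R + R')"
  using eqv_add[OF assms[unfolded lcomb_def]]
  by (simp add: lcomb_def free.scale_right_distrib algebra_simps)

lemma lcomb_fscale: "lcomb W c P Q R \<Longrightarrow> lcomb W c (fscale s P) (fscale s Q) (fscale s R)"
  unfolding lcomb_def by (drule eqv_fscale[where c = s])
    (simp only: free.scale_right_distrib free.scale_left_commute[of s c])

lemma lcomb_sum: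
  "(\<And>i. i \<in> I \<Longrightarrow> lcomb W c (f i) (g i) (h i)) \<Longrightarrow> lcomb W c (sum f I) (sum g I) (sum h I)"
  by (induction I rule: infinite_finite_induct) (simp_all add: lcomb_add, simp_all add: lcomb_def)

lemma lcomb_prep:
  "snd x \<in> part W (fst x) \<Longrightarrow> lcomb W c P Q R \<Longrightarrow> lcomb W c (prep x P) (prep x Q) (prep x R)"
  unfolding lcomb_def by (drule (1) eqv_prep) simp

abbreviation qmul where "qmul \<equiv> bilin_extend qsh"

context connected_commutative_graded_algebra
begin

abbreviation V where "V \<equiv> positive_part scale A"

lemma part_V: "part V n = (if n = 0 then {0} else A n)"
  and vadd_V [simp]: "vadd V = (+)"
  and vscale_V [simp]: "vscale V = scale"
  by (simp_all add: positive_part_def)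

lemma subspace_V: "subspace (part V n)"
  by (simp add: part_V subspace_part)

lemmas V_closed = subspace_0[OF subspace_V] subspace_add[OF subspace_V] subspace_scale[OF subspace_V]

lemma part_V_subset: "x \<in> part V n \<Longrightarrow> x \<in> A n"
  using subspace_0[OF subspace_part[of n]] by (auto simp: part_V split: if_splits)

lemma V_mult: "x \<in> part V m \<Longrightarrow> y \<in> part V n \<Longrightarrow> x * y \<in> part V (m + n)"
  using mult_part[of x m y n] subspace_0[OF subspace_part] by (auto simp: part_V split: if_splits)

lemma minus_one_power_mult: "(-1) ^ n * x = scale ((-1) ^ n) x"
  by (cases "even n") auto

lemma V_comm: "x \<in> part V m \<Longrightarrow> y \<in> part V n \<Longrightarrow> y * x = scale ((-1) ^ (m * n)) (x * y)"
  by (subst graded_commutative[of x m y n]) (simp_all only: part_V_subset minus_one_power_mult)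

text \<open>A single relation at \<open>c x + y\<close> yields additivity for \<open>c = 1\<close>
  and homogeneity for \<open>y = 0\<close>, once words with a zero letter are known to be sent into
  \<open>K\<close>.\<close>

lemma multilinear_modI:
  assumes "free.subspace K"
    and "\<And>us n c x y ws. us \<in> words V \<Longrightarrow> ws \<in> words V \<Longrightarrow> x \<in> part V n \<Longrightarrow> y \<in> part V n \<Longrightarrow>
      f (us @ (n, scale c x + y) # ws) - (fscale c (f (us @ (n, x) # ws)) + f (us @ (n, y) # ws)) \<in> K"
  shows "multilinear_mod V K f"
  unfolding multilinear_mod_def
proof (intro ballI allI conjI)
  fix us ws n x assume *: "us \<in> words V" "ws \<in> words V" "x \<in> part V n"
  have neg: "- q \<in> K" if "q \<in> K" for q
    using assms(1) that by (rule free.subspace_neg)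
  \<comment> \<open>With \<open>c = -1\<close> and \<open>y = x\<close> the distinguished letter
    becomes \<open>0\<close> and the two other terms cancel.\<close>
  from assms(2)[OF * *(3), of "-1"] have 0: "f (us @ (n, 0) # ws) \<in> K"
    by simp
  show "f (us @ (n, vadd V x y) # ws) - f (us @ (n, x) # ws) - f (us @ (n, y) # ws) \<in> K"
    if "y \<in> part V n" for y
    using assms(2)[OF * that, of 1] by (simp add: algebra_simps)
  fix c
  have "f (us @ (n, scale c x) # ws) - (fscale c (f (us @ (n, x) # ws)) + f (us @ (n, 0) # ws)) \<in> K"
    using assms(2)[OF * V_closed(1), of c] by simp
  from free.subspace_add[OF assms(1) this 0]
  show "f (us @ (n, vscale V c x) # ws) - fscale c (f (us @ (n, x) # ws)) \<in> K" by simp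
qed

lemma multilinear_mod_lcombI:
  assumes "\<And>us n c x y ws. us \<in> words V \<Longrightarrow> ws \<in> words V \<Longrightarrow> x \<in> part V n \<Longrightarrow> y \<in> part V n \<Longrightarrow>
      lcomb W c (f (us @ (n, scale c x + y) # ws)) (f (us @ (n, x) # ws)) (f (us @ (n, y) # ws))"
  shows "multilinear_mod V (relations W) f"
  by (rule multilinear_modI[OF subspace_relations]) (use assms in \<open>simp add: lcomb_def eqv_def\<close>)

lemma lcomb_of_multilinear_mod:
  assumes "multilinear_mod V (relations W) f"
    and *: "us \<in> words V" "ws \<in> words V" "x \<in> part V n" "y \<in> part V n"
  shows "lcomb W c (f (us @ (n, scale c x + y) # ws)) (f (us @ (n, x) # ws)) (f (us @ (n, y) # ws))"
proof -
  have add: "eqv W (f (us @ (n, z + y) # ws)) (f (us @ (n, z) # ws) + f (us @ (n, y) # ws))"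
    if "z \<in> part V n" for z
    using assms(1) * that unfolding multilinear_mod_def eqv_def by (simp add: algebra_simps)
  have 1: "eqv W (f (us @ (n, scale c x) # ws)) (fscale c (f (us @ (n, x) # ws)))"
    using assms(1) * unfolding multilinear_mod_def eqv_def by simp
  have "eqv W (f (us @ (n, scale c x + y) # ws)) (f (us @ (n, scale c x) # ws) + f (us @ (n, y) # ws))"
    by (rule add) (rule V_closed *)+
  also have "eqv W \<dots> (fscale c (f (us @ (n, x) # ws)) + f (us @ (n, y) # ws))"
    by (rule eqv_add[OF 1 eqv_refl])
  finally show ?thesis unfolding lcomb_def .
qed

lemmas lcomb_gen = lcomb_of_multilinear_mod[OF multilinear_mod_gen]

lemma lcomb_letter:
  assumes "x \<in> part V n" "y \<in> part V n" "Poly_Mapping.keys q \<subseteq> words V"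
  shows "lcomb V c (prep (n, scale c x + y) q) (prep (n, x) q) (prep (n, y) q)"
  unfolding lcomb_def
proof (rule lin_eqvI[where f = "prep (n, scale c x + y)" and g = "\<lambda>q. fscale c (prep (n, x) q) + prep (n, y) q"])
  fix w assume "w \<in> Poly_Mapping.keys q"
  with assms lcomb_gen[of "[]" w x n y c]
  show "eqv V (prep (n, scale c x + y) (gen w)) (fscale c (prep (n, x) (gen w)) + prep (n, y) (gen w))"
    by (auto simp: lcomb_def)
qed (intro lin_intros)+

lemma eqv_letter_scale:
  assumes "x \<in> part V n" "Poly_Mapping.keys q \<subseteq> words V"
  shows "eqv V (prep (n, scale c x) q) (fscale c (prep (n, x) q))"
proof -
  have 0: "eqv V (prep (n, 0) q) 0"
    using lcomb_letter[OF assms(1,1,2), of "-1"] by (simp add: lcomb_def)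
  have "eqv V (prep (n, scale c x) q) (fscale c (prep (n, x) q) + prep (n, 0) q)"
    using lcomb_letter[OF assms(1) V_closed(1) assms(2), of c] by (simp add: lcomb_def)
  also have "eqv V \<dots> (fscale c (prep (n, x) q))"
    using eqv_add[OF eqv_refl 0] by simp
  finally show ?thesis .
qed

text \<open>Needed because \<open>rep\<close> is arbitrary: if one element of a coset is supported
  on words over \<open>V\<close>, then so are all others, in particular the chosen one.\<close>

lemma keys_relations: "p \<in> relations V \<Longrightarrow> Poly_Mapping.keys p \<subseteq> words V"
proof -
  have gens: "gen w \<in> free.span (gen ` words V)" if "w \<in> words V" for w
    using that by (intro free.span_base imageI)
  assume "p \<in> relations V"
  moreover have "relations V \<subseteq> free.span (gen ` words V)"
    unfolding relations_def
  proof (rule free.span_minimal[OF _ free.subspace_span], safe)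
    fix us n x y ws c assume *: "us \<in> words V" "ws \<in> words V" "x \<in> part V n"
    show "gen (us @ (n, vadd V x y) # ws) - gen (us @ (n, x) # ws) - gen (us @ (n, y) # ws)
        \<in> free.span (gen ` words V)" if "y \<in> part V n"
      using * that by (intro free.span_diff gens) (simp_all add: V_closed)
    show "gen (us @ (n, vscale V c x) # ws) - fscale c (gen (us @ (n, x) # ws)) \<in> free.span (gen ` words V)"
      using * by (intro free.span_diff free.span_scale gens) (simp_all add: V_closed)
  qed
  ultimately have "p \<in> free.span (gen ` words V)" by (rule rev_subsetD)
  then show ?thesis by (simp only: in_span_gen_iff)
qed

lemma keys_eqv: "eqv V p q \<Longrightarrow> Poly_Mapping.keys q \<subseteq> words V \<Longrightarrow> Poly_Mapping.keys p \<subseteq> words V"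
  using keys_plus_subset[of "p - q" "words V" q] keys_relations[of "p - q"] by (simp add: eqv_def)

lemma keys_qsh:
  "u \<in> words V \<Longrightarrow> v \<in> words V \<Longrightarrow> Poly_Mapping.keys (qsh u v) \<subseteq> homs V (wdeg u + wdeg v)"
proof (induction u v rule: qsh.induct)
  case (3 x u y v)
  from "3.prems" have w: "u \<in> words V" "v \<in> words V" "x # u \<in> words V" "y # v \<in> words V" by auto
  note k = "3.IH"(1)[OF w(1,4)] "3.IH"(2)[OF w(3,2)] "3.IH"(3)[OF w(1,2)]
  show ?case
    unfolding qsh.simps using "3.prems"
    by (intro keys_plus_subset keys_fscale_subset k[THEN keys_prep_homs]) (auto simp: V_mult)
qed (auto simp: homs_def)

lemma keys_qsh_words:
  "u \<in> words V \<Longrightarrow> v \<in> words V \<Longrightarrow> Poly_Mapping.keys (qsh u v) \<subseteq> words V"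
  using keys_qsh homs_words by blast

text \<open>If the distinguished letter is not in front, all three recursive calls contain it and
  the induction on the total length applies. If it is in front, the same holds for the term starting
  with \<open>b\<close>; in the two others it becomes a letter of the result, alone or multiplied by
  \<open>snd b\<close>, and \<open>lcomb_letter\<close> and distributivity give linearity.\<close>

lemma lcomb_qsh_left:
  assumes "us \<in> words V" "ws \<in> words V" "v \<in> words V" "x \<in> part V n" "y \<in> part V n"
  shows "lcomb V c (qsh (us @ (n, scale c x + y) # ws) v) (qsh (us @ (n, x) # ws) v) (qsh (us @ (n, y) # ws) v)"
  using assms
proof (induction "length us + length v" arbitrary: us v rule: less_induct)
  case less
  show ?case
  proof (cases v)
    case Nil
    with less.prems show ?thesis using lcomb_gen by simp
  next
    case (Cons b v')
    have IH: "lcomb V c (qsh (us' @ (n, scale c x + y) # ws) v'') (qsh (us' @ (n, x) # ws) v'') (qsh (us' @ (n, y) # ws) v'')"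
      if "length us' + length v'' < length us + length v" "us' \<in> words V" "v'' \<in> words V" for us' v''
      using less that by blast
    show ?thesis
    proof (cases us)
      case Nil
      have "lcomb V c (prep (n + fst b, scale c (x * snd b) + y * snd b) (qsh ws v'))
          (prep (n + fst b, x * snd b) (qsh ws v')) (prep (n + fst b, y * snd b) (qsh ws v'))"
        using less.prems Cons by (intro lcomb_letter V_mult keys_qsh_words) auto
      moreover have "lcomb V c (prep (n, scale c x + y) (qsh ws (b # v'))) (prep (n, x) (qsh ws (b # v')))
          (prep (n, y) (qsh ws (b # v')))"
        using less.prems Cons by (intro lcomb_letter keys_qsh_words) auto
      moreover have "lcomb V c (prep b (qsh ((n, scale c x + y) # ws) v')) (prep b (qsh ((n, x) # ws) v'))
          (prep b (qsh ((n, y) # ws) v'))"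
        using IH[of us v'] less.prems Cons Nil by (intro lcomb_prep) auto
      ultimately show ?thesis
        unfolding Cons Nil
        unfolding append_Nil qsh.simps fst_conv snd_conv distrib_right scale_mult_left wdeg_Cons
        by (intro lcomb_add lcomb_fscale)
    next
      fix a us' assume us: "us = a # us'"
      show ?thesis
        unfolding Cons us append_Cons qsh.simps wdeg_append wdeg_Cons fst_conv
        using less.prems IH[of us' v'] IH[of us' v] IH[of us v'] Cons us
        by (intro lcomb_add lcomb_fscale lcomb_prep V_mult) (auto intro: V_mult)
    qed
  qed
qed

lemma lcomb_qsh_right:
  assumes "us \<in> words V" "ws \<in> words V" "v \<in> words V" "x \<in> part V n" "y \<in> part V n"
  shows "lcomb V c (qsh v (us @ (n, scale c x + y) # ws)) (qsh v (us @ (n, x) # ws)) (qsh v (us @ (n, y) # ws))"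
  using assms
proof (induction "length us + length v" arbitrary: us v rule: less_induct)
  case less
  show ?case
  proof (cases v)
    case Nil
    with less.prems show ?thesis using lcomb_gen by simp
  next
    case (Cons b v')
    have IH: "lcomb V c (qsh v'' (us' @ (n, scale c x + y) # ws)) (qsh v'' (us' @ (n, x) # ws)) (qsh v'' (us' @ (n, y) # ws))"
      if "length us' + length v'' < length us + length v" "us' \<in> words V" "v'' \<in> words V" for us' v''
      using less that by blast
    show ?thesis
    proof (cases us)
      case Nil
      have "lcomb V c (prep (fst b + n, scale c (snd b * x) + snd b * y) (qsh v' ws))
          (prep (fst b + n, snd b * x) (qsh v' ws)) (prep (fst b + n, snd b * y) (qsh v' ws))"
        using less.prems Cons by (intro lcomb_letter V_mult keys_qsh_words) auto
      moreover have "lcomb V c (prep (n, scale c x + y) (qsh (b # v') ws)) (prep (n, x) (qsh (b # v') ws))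
          (prep (n, y) (qsh (b # v') ws))"
        using less.prems Cons by (intro lcomb_letter keys_qsh_words) auto
      moreover have "lcomb V c (prep b (qsh v' ((n, scale c x + y) # ws))) (prep b (qsh v' ((n, x) # ws)))
          (prep b (qsh v' ((n, y) # ws)))"
        using IH[of us v'] less.prems Cons Nil by (intro lcomb_prep) auto
      ultimately show ?thesis
        unfolding Cons Nil append_Nil qsh.simps fst_conv snd_conv distrib_left scale_mult_right
        by (intro lcomb_add lcomb_fscale)
    next
      fix a us' assume us: "us = a # us'"
      show ?thesis
        unfolding Cons us append_Cons qsh.simps wdeg_append wdeg_Cons fst_conv
        using less.prems IH[of us' v'] IH[of us' v] IH[of us v'] Cons us
        by (intro lcomb_add lcomb_fscale lcomb_prep V_mult) (auto intro: V_mult)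
    qed
  qed
qed

text \<open>One factor is replaced at a time. Linearity in one factor is known only when the other
  is a word over \<open>V\<close>, so the support of \<open>q\<close> is first recovered from that
  of \<open>q'\<close>.\<close>

lemma eqv_qmul:
  assumes "eqv V p p'" "eqv V q q'" "Poly_Mapping.keys p' \<subseteq> words V" "Poly_Mapping.keys q' \<subseteq> words V"
  shows "eqv V (qmul p q) (qmul p' q')"
proof -
  have "eqv V (qmul p q) (qmul p' q)"
  proof (rule lin_eqvI[where f = "qmul p" and g = "qmul p'"])
    fix v assume "v \<in> Poly_Mapping.keys q"
    then have v: "v \<in> words V" using keys_eqv[OF assms(2,4)] by blast
    show "eqv V (qmul p (gen v)) (qmul p' (gen v))"
      by (rule lin_relations_eqv[where f = "\<lambda>p. qmul p (gen v)", OF _ multilinear_mod_lcombI assms(1)])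
        (auto intro!: lin_intros lcomb_qsh_left v)
  qed (intro lin_intros)+
  also have "eqv V \<dots> (qmul p' q')"
  proof (rule lin_eqvI[where f = "\<lambda>p. qmul p q" and g = "\<lambda>p. qmul p q'"])
    fix u assume "u \<in> Poly_Mapping.keys p'"
    then have u: "u \<in> words V" using assms(3) by blast
    show "eqv V (qmul (gen u) q) (qmul (gen u) q')"
      by (rule lin_relations_eqv[where f = "qmul (gen u)", OF _ multilinear_mod_lcombI assms(2)])
        (auto intro!: lin_intros lcomb_qsh_right u)
  qed (intro lin_intros)+
  finally show ?thesis .
qed

end

section \<open>Inverting unitriangular maps\<close>

text \<open>A map that is the identity up to shorter words is inverted by a geometric series, which is
  finite on every word.\<close>

locale unitriangular =
  fixes f :: "'v list \<Rightarrow> ('v list \<Rightarrow>\<^sub>0 'k::field)"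
  assumes shorter: "Poly_Mapping.keys (f w - gen w) \<subseteq> {t. length t < length w}"
begin

definition defect :: "('v list \<Rightarrow>\<^sub>0 'k) \<Rightarrow> ('v list \<Rightarrow>\<^sub>0 'k)" where
  "defect p = p - lin_extend f p"

definition inv_word :: "'v list \<Rightarrow> ('v list \<Rightarrow>\<^sub>0 'k)" where
  "inv_word w = (\<Sum>k\<le>length w. (defect ^^ k) (gen w))"

lemma lin_defect: "lin defect"
  unfolding defect_def by (intro lin_intros)

lemma lin_defect_pow: "lin (defect ^^ k)"
proof (induction k)
  case 0
  then show ?case by (auto intro: linI)
next
  case (Suc k)
  then show ?case by (auto intro!: linI simp: lin_add lin_scale lin_defect)
qed

lemma keys_defect_pow:
  "Poly_Mapping.keys p \<subseteq> {t. length t < n} \<Longrightarrow> Poly_Mapping.keys ((defect ^^ k) p) \<subseteq> {t. length t + k < n}"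
proof (induction k)
  case (Suc k)
  show ?case
    unfolding funpow.simps comp_def
  proof (rule keys_lin_subset[OF lin_defect])
    fix w assume "w \<in> Poly_Mapping.keys ((defect ^^ k) p)"
    then have w: "length w + k < n" using Suc by blast
    have "Poly_Mapping.keys (defect (gen w)) = Poly_Mapping.keys (f w - gen w)"
      unfolding defect_def by (auto simp: in_keys_iff lookup_minus)
    then show "Poly_Mapping.keys (defect (gen w)) \<subseteq> {t. length t + Suc k < n}"
      using shorter[of w] w by fastforce
  qed
qed simp

lemma defect_pow_eq_0:
  assumes "Poly_Mapping.keys p \<subseteq> {t. length t < n}" "n \<le> k"
  shows "(defect ^^ k) p = 0"
proof -
  have "Poly_Mapping.keys ((defect ^^ k) p) = {}"
    using keys_defect_pow[OF assms(1), of k] assms(2) by auto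
  then show ?thesis by (metis in_keys_iff empty_iff lookup_zero poly_mapping_eqI)
qed

text \<open>Any common bound for the word lengths in \<open>p\<close> may serve as cut-off, since
  further powers of \<open>defect\<close> vanish. With one bound for all words the sums telescope in
  the inversion proofs.\<close>

lemma lin_extend_inv_word:
  assumes "Poly_Mapping.keys p \<subseteq> {t. length t < n}"
  shows "lin_extend inv_word p = (\<Sum>k<n. (defect ^^ k) p)"
proof (rule lin_eqI[where f = "lin_extend inv_word" and g = "\<lambda>p. \<Sum>k<n. (defect ^^ k) p"])
  fix w assume "w \<in> Poly_Mapping.keys p"
  then have w: "length w < n" using assms by blast
  have "(\<Sum>k<n. (defect ^^ k) (gen w)) = inv_word w"
    unfolding inv_word_def
    by (rule sum.mono_neutral_right) (use w in \<open>auto intro!: defect_pow_eq_0[where n = "Suc (length w)"]\<close>)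
  then show "lin_extend inv_word (gen w) = (\<Sum>k<n. (defect ^^ k) (gen w))" by simp
qed (intro lin_intros lin_defect_pow)+

lemma keys_bounded: "\<exists>n. Poly_Mapping.keys p \<subseteq> {t. length t < n}"
proof -
  have "length t < Suc (Max (length ` Poly_Mapping.keys p))" if "t \<in> Poly_Mapping.keys p" for t
    using that by (auto simp: less_Suc_eq_le)
  then show ?thesis by blast
qed

lemma f_inverse: "lin_extend f (lin_extend inv_word p) = p"
proof -
  obtain n where n: "Poly_Mapping.keys p \<subseteq> {t. length t < n}" using keys_bounded by blast
  have "lin_extend f q = q - defect q" for q by (simp add: defect_def)
  then have "lin_extend f (lin_extend inv_word p) = (\<Sum>k<n. (defect ^^ k) p - (defect ^^ Suc k) p)"
    by (simp add: lin_extend_inv_word[OF n] lin_extend_sum lin_sum[OF lin_defect])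
  also have "\<dots> = p"
    using defect_pow_eq_0[OF n] by (simp add: sum_lessThan_telescope'[of "\<lambda>k. (defect ^^ k) p" n] del: funpow.simps(2))
  finally show ?thesis .
qed

lemma f_inverse': "lin_extend inv_word (lin_extend f p) = p"
proof -
  obtain n where n: "Poly_Mapping.keys p \<subseteq> {t. length t < n}" using keys_bounded by blast
  obtain m where m: "Poly_Mapping.keys (lin_extend f p) \<subseteq> {t. length t < m}" using keys_bounded by blast
  have n': "Poly_Mapping.keys p \<subseteq> {t. length t < max m n}" using n by auto
  have m': "Poly_Mapping.keys (lin_extend f p) \<subseteq> {t. length t < max m n}" using m by auto
  have "lin_extend inv_word (lin_extend f p) = (\<Sum>k<max m n. (defect ^^ k) (p - defect p))"
    unfolding lin_extend_inv_word[OF m'] by (simp add: defect_def)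
  also have "\<dots> = (\<Sum>k<max m n. (defect ^^ k) p - (defect ^^ Suc k) p)"
    by (simp add: lin_diff[OF lin_defect_pow] funpow_swap1)
  also have "\<dots> = p"
    using defect_pow_eq_0[OF n'] by (simp add: sum_lessThan_telescope'[of "\<lambda>k. (defect ^^ k) p"] del: funpow.simps(2))
  finally show ?thesis .
qed

text \<open>On \<open>p\<close> the inverse is a finite sum of powers of \<open>defect\<close>, so
  it preserves every subspace that the map itself preserves. Applied to the relations and to the
  words of a fixed degree, this spares a separate analysis of the inverse.\<close>

lemma inverse_in_subspace:
  assumes "free.subspace K" "\<And>q. q \<in> K \<Longrightarrow> lin_extend f q \<in> K" "p \<in> K"
  shows "lin_extend inv_word p \<in> K"
proof -
  obtain n where n: "Poly_Mapping.keys p \<subseteq> {t. length t < n}" using keys_bounded by blast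
  have "(defect ^^ k) p \<in> K" for k
    by (induction k) (auto simp: assms defect_def intro: free.subspace_diff[OF assms(1)])
  then show ?thesis
    unfolding lin_extend_inv_word[OF n] by (intro free.subspace_sum assms(1))
qed

end


section \<open>The exponential map\<close>

lemma combine_append: "combine (u @ v) = (fst (combine u) + fst (combine v), snd (combine u) * snd (combine v))"
  by (simp add: combine_def)

lemma fst_combine [simp]: "fst (combine u) = wdeg u"
  by (simp add: combine_def wdeg_def)

lemma snd_combine_Nil [simp]: "snd (combine []) = 1"
  and snd_combine_Cons [simp]: "snd (combine (x # u)) = snd x * snd (combine u)"
  and snd_combine_append [simp]: "snd (combine (u @ v)) = snd (combine u) * snd (combine v)"
  by (simp_all add: combine_def)

lemma combine_eq: "combine u = (wdeg u, snd (combine u))"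
  by (metis fst_combine prod.collapse)

text \<open>The sum over all ways of cutting \<open>w\<close> into consecutive nonempty blocks,
  where each block is multiplied out in the algebra and weighted by 1/(block length)!. The recursion
  splits off the first block, of length \<open>Suc i\<close>.\<close>

function hexp :: "'a::ring_1 word \<Rightarrow> ('a word \<Rightarrow>\<^sub>0 'k::field_char_0)" where
  "hexp w = (if w = [] then gen [] else
     (\<Sum>i<length w. fscale (1 / fact (Suc i)) (prep (combine (take (Suc i) w)) (hexp (drop (Suc i) w)))))"
  by auto
termination by (relation "Wellfounded.measure length") auto

declare hexp.simps [simp del]

lemma hexp_Nil [simp]: "hexp [] = gen []"
  by (simp add: hexp.simps)

lemma hexp_nonempty:
  "w \<noteq> [] \<Longrightarrow> hexp w =
     (\<Sum>i<length w. fscale (1 / fact (Suc i)) (prep (combine (take (Suc i) w)) (hexp (drop (Suc i) w))))"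
  by (subst hexp.simps) simp

lemma keys_prep_length:
  "Poly_Mapping.keys p \<subseteq> {t. length t < n} \<Longrightarrow> Poly_Mapping.keys (prep x p) \<subseteq> {t. length t < Suc n}"
  using keys_prep[of x p] by fastforce

lemma keys_hexp_length: "Poly_Mapping.keys (hexp w :: 'a::ring_1 word \<Rightarrow>\<^sub>0 'k::field_char_0) \<subseteq> {t. length t < Suc (length w)}"
proof (induction w rule: length_induct)
  case (1 w)
  show ?case
  proof (cases "w = []")
    case False
    have "Poly_Mapping.keys (prep (combine (take (Suc i) w)) (hexp (drop (Suc i) w) :: 'a word \<Rightarrow>\<^sub>0 'k))
        \<subseteq> {t. length t < Suc (length w)}"
      if "i < length w" for i
    proof (rule keys_prep_length)
      show "Poly_Mapping.keys (hexp (drop (Suc i) w) :: 'a word \<Rightarrow>\<^sub>0 'k) \<subseteq> {t. length t < length w}"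
        using 1[rule_format, of "drop (Suc i) w"] that by fastforce
    qed
    then show ?thesis
      unfolding hexp_nonempty[OF False] by (intro keys_sum_subset keys_fscale_subset) auto
  qed simp
qed

text \<open>Only the cut into single letters keeps the length, and it has coefficient 1. In the
  recursion it is contained in the summand \<open>i = 0\<close>; the other summands merge at least
  two letters.\<close>

lemma hexp_shorter: "Poly_Mapping.keys (hexp w - gen w :: 'a::ring_1 word \<Rightarrow>\<^sub>0 'k::field_char_0) \<subseteq> {t. length t < length w}"
proof (induction w)
  case (Cons x w)
  let ?g = "\<lambda>i. fscale (1 / fact (Suc i)) (prep (combine (take (Suc i) (x # w))) (hexp (drop (Suc i) (x # w)))) :: 'a word \<Rightarrow>\<^sub>0 'k"
  have eq: "hexp (x # w) - gen (x # w) = prep x (hexp w - gen w) + (\<Sum>i<length w. ?g (Suc i))"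
    by (simp add: hexp_nonempty sum.lessThan_Suc_shift del: sum.lessThan_Suc fact_Suc)
  have "Poly_Mapping.keys (?g (Suc i)) \<subseteq> {t. length t < length (x # w)}" if "i < length w" for i
    using keys_prep_length[OF keys_hexp_length, of "combine (take (Suc (Suc i)) (x # w))" "drop (Suc i) w"] that
    by (intro keys_fscale_subset) fastforce
  moreover have "Poly_Mapping.keys (prep x (hexp w - gen w :: 'a word \<Rightarrow>\<^sub>0 'k)) \<subseteq> {t. length t < length (x # w)}"
    using keys_prep_length[OF Cons.IH, of x] by simp
  ultimately show ?case
    unfolding eq by (intro keys_plus_subset keys_sum_subset) auto
qed simp

interpretation hexp: unitriangular hexp
  by unfold_locales (rule hexp_shorter)

text \<open>Hoffman's logarithm, obtained by inversion instead of from its explicit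
  coefficients.\<close>

abbreviation hlog :: "'a::ring_1 word \<Rightarrow> ('a word \<Rightarrow>\<^sub>0 'k::field_char_0)" where
  "hlog \<equiv> hexp.inv_word"

locale char_0_algebra = connected_commutative_graded_algebra scale A
  for scale :: "'k::field_char_0 \<Rightarrow> 'a::ring_1 \<Rightarrow> 'a" (infixr \<open>*s\<close> 75) and A
begin

lemma combine_V: "w \<in> words V \<Longrightarrow> w \<noteq> [] \<Longrightarrow> snd (combine w) \<in> part V (wdeg w)"
proof (induction w)
  case (Cons x w)
  then show ?case by (cases "w = []") (auto intro: V_mult)
qed simp

lemma keys_hexp: "w \<in> words V \<Longrightarrow> Poly_Mapping.keys (hexp w :: 'a word \<Rightarrow>\<^sub>0 'k) \<subseteq> homs V (wdeg w)"
proof (induction w rule: length_induct)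
  case (1 w)
  show ?case
  proof (cases "w = []")
    case False
    have "Poly_Mapping.keys (prep (combine (take (Suc i) w)) (hexp (drop (Suc i) w) :: 'a word \<Rightarrow>\<^sub>0 'k)) \<subseteq> homs V (wdeg w)"
      if "i < length w" for i
    proof (rule keys_prep_homs)
      show "Poly_Mapping.keys (hexp (drop (Suc i) w) :: 'a word \<Rightarrow>\<^sub>0 'k) \<subseteq> homs V (wdeg (drop (Suc i) w))"
        using 1 that by auto
    qed (use 1 that False in \<open>auto intro!: combine_V\<close>)
    then show ?thesis
      unfolding hexp_nonempty[OF False] by (intro keys_sum_subset keys_fscale_subset) auto
  qed (simp add: homs_def)
qed

text \<open>A distinguished letter beyond the first block is handled by induction. Inside the first
  block the output letter is a product \<open>a * (z * b)\<close> with fixed \<open>a\<close> and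
  \<open>b\<close>, hence linear in \<open>z\<close>.\<close>

lemma lcomb_hexp:
  assumes "us \<in> words V" "ws \<in> words V" "x \<in> part V n" "y \<in> part V n"
  shows "lcomb V c (hexp (us @ (n, scale c x + y) # ws)) (hexp (us @ (n, x) # ws)) (hexp (us @ (n, y) # ws))"
  using assms
proof (induction "length us" arbitrary: us rule: less_induct)
  case less
  let ?w = "\<lambda>z. us @ (n, z) # ws"
  have len: "length (?w z) = length us + Suc (length ws)" for z by simp
  have ne: "?w z \<noteq> []" for z by simp
  show ?case
    unfolding hexp_nonempty[OF ne] len
  proof (intro lcomb_sum lcomb_fscale)
    fix i assume i: "i \<in> {..<length us + Suc (length ws)}"
    show "lcomb V c (prep (combine (take (Suc i) (?w (scale c x + y)))) (hexp (drop (Suc i) (?w (scale c x + y)))))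
      (prep (combine (take (Suc i) (?w x))) (hexp (drop (Suc i) (?w x))))
      (prep (combine (take (Suc i) (?w y))) (hexp (drop (Suc i) (?w y))))"
    proof (cases "i < length us")
      case True
      then have "take (Suc i) us \<noteq> []" by auto
      with True less show ?thesis
        by (auto intro!: lcomb_prep combine_V simp: Suc_le_eq[symmetric])
    next
      case False
      then obtain j where j: "i = length us + j" using le_Suc_ex by fastforce
      have take: "take (Suc i) (?w z) = us @ (n, z) # take j ws" and drop: "drop (Suc i) (?w z) = drop j ws" for z
        by (simp_all add: j)
      define a b where "a = snd (combine us)" and "b = snd (combine (take j ws))"
      define m where "m = wdeg us + (n + wdeg (take j ws))"
      have c: "combine (us @ (n, z) # take j ws) = (m, a * (z * b))" for z
        by (subst combine_eq) (simp add: a_def b_def m_def)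
      have in_V: "a * (z * b) \<in> part V m" if "z \<in> part V n" for z
        using combine_V[of "us @ (n, z) # take j ws"] less.prems that c by (simp add: m_def)
      have "a * ((scale c x + y) * b) = scale c (a * (x * b)) + a * (y * b)"
        by (simp add: distrib_left distrib_right scale_mult_left scale_mult_right)
      then show ?thesis
        unfolding take drop c using less.prems keys_hexp[of "drop j ws"] homs_words
        by (auto intro!: lcomb_letter in_V)
    qed
  qed
qed

lemma eqv_hexp: "eqv V p q \<Longrightarrow> eqv V (lin_extend hexp p) (lin_extend hexp q)"
  by (rule lin_relations_eqv[OF lin_lin_extend multilinear_mod_lcombI])
    (auto intro: lcomb_hexp)

text \<open>The relations are stable under \<open>hexp\<close>, hence under its inverse.\<close>

lemma eqv_hlog: "eqv V p q \<Longrightarrow> eqv V (lin_extend hlog p) (lin_extend hlog q)"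
proof -
  assume "eqv V p q"
  have "lin_extend hexp r \<in> relations V" if "r \<in> relations V" for r :: "'a word \<Rightarrow>\<^sub>0 'k"
    using eqv_hexp[of r 0] that by (simp add: eqv_def)
  from hexp.inverse_in_subspace[OF subspace_relations this, of "p - q"] \<open>eqv V p q\<close>
  show ?thesis by (simp add: eqv_def)
qed

lemma keys_hlog:
  assumes "w \<in> words V" shows "Poly_Mapping.keys (hlog w :: 'a word \<Rightarrow>\<^sub>0 'k) \<subseteq> homs V (wdeg w)"
proof -
  let ?K = "free.span (gen ` homs V (wdeg w)) :: ('a word \<Rightarrow>\<^sub>0 'k) set"
  have "lin_extend hlog (gen w) \<in> ?K"
  proof (rule hexp.inverse_in_subspace)
    fix q assume "q \<in> ?K"
    then have "Poly_Mapping.keys q \<subseteq> homs V (wdeg w)" by (simp add: in_span_gen_iff)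
    have "Poly_Mapping.keys (lin_extend hexp q) \<subseteq> homs V (wdeg w)"
    proof (rule keys_lin_subset[OF lin_lin_extend])
      fix t assume "t \<in> Poly_Mapping.keys q"
      then have "t \<in> words V" "wdeg t = wdeg w"
        using \<open>Poly_Mapping.keys q \<subseteq> _\<close> by (auto simp: homs_def)
      then show "Poly_Mapping.keys (lin_extend hexp (gen t) :: 'a word \<Rightarrow>\<^sub>0 'k) \<subseteq> homs V (wdeg w)"
        using keys_hexp[of t] by simp
    qed
    then show "lin_extend hexp q \<in> ?K" by (simp add: in_span_gen_iff)
  qed (use assms in \<open>auto simp: homs_def intro!: free.span_base\<close>)
  then show ?thesis by (simp add: in_span_gen_iff)
qed

end

lemma bilin_eqI:
  assumes "\<And>q. lin (\<lambda>p. f p q)" "\<And>p. lin (f p)" "\<And>q. lin (\<lambda>p. g p q)" "\<And>p. lin (g p)"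
    and "\<And>u v. u \<in> Poly_Mapping.keys p \<Longrightarrow> v \<in> Poly_Mapping.keys q \<Longrightarrow> f (gen u) (gen v) = g (gen u) (gen v)"
  shows "f p q = g p q"
proof (rule lin_eqI[where f = "\<lambda>p. f p q" and g = "\<lambda>p. g p q"])
  fix u assume u: "u \<in> Poly_Mapping.keys p"
  show "f (gen u) q = g (gen u) q"
    by (rule lin_eqI[where f = "f (gen u)" and g = "g (gen u)"]) (use assms u in auto)
qed (rule assms)+


section \<open>Deconcatenation and shuffles\<close>

text \<open>Pairs of words model the tensor square before passing to cosets. Identities about
  deconcatenation are proved here, and \<open>coset_pair\<close> later carries them to the second
  tensor power of the quasi-shuffle algebra.\<close>

definition tens :: "('x \<Rightarrow>\<^sub>0 'k::field) \<Rightarrow> ('y \<Rightarrow>\<^sub>0 'k) \<Rightarrow> ('x \<times> 'y \<Rightarrow>\<^sub>0 'k)" where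
  "tens = bilin_extend (\<lambda>u v. gen (u, v))"

lemma tens_gen [simp]: "tens (gen u) (gen v) = gen (u, v)"
  by (simp add: tens_def)

lemma lin_tens_left [lin_intros]: "lin g \<Longrightarrow> lin (\<lambda>p. tens (g p) q)"
  and lin_tens_right [lin_intros]: "lin g \<Longrightarrow> lin (\<lambda>q. tens p (g q))"
  unfolding tens_def by (intro lin_intros; assumption)+

lemmas lin_tens_left' = lin_tens_left[OF lin_id]
lemmas lin_tens_right' = lin_tens_right[OF lin_id]

lemmas tens_simps = lin_add[OF lin_tens_left'] lin_add[OF lin_tens_right']
  lin_scale[OF lin_tens_left'] lin_scale[OF lin_tens_right']
  lin_sum[OF lin_tens_left'] lin_sum[OF lin_tens_right']

text \<open>No Koszul sign appears, because the maps to which this is applied preserve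
  degrees.\<close>

definition tens_map :: "('x \<Rightarrow> ('y \<Rightarrow>\<^sub>0 'k::field)) \<Rightarrow> ('x \<times> 'x \<Rightarrow>\<^sub>0 'k) \<Rightarrow> ('y \<times> 'y \<Rightarrow>\<^sub>0 'k)" where
  "tens_map f = lin_extend (\<lambda>(u, v). tens (f u) (f v))"

lemma lin_tens_map [lin_intros]: "lin g \<Longrightarrow> lin (\<lambda>p. tens_map f (g p))"
  unfolding tens_map_def by (intro lin_intros)

lemmas lin_tens_map' = lin_tens_map[OF lin_id]

lemma tens_map_gen [simp]: "tens_map f (gen (u, v)) = tens (f u) (f v)"
  by (simp add: tens_map_def)

lemma tens_map_tens: "tens_map f (tens p q) = tens (lin_extend f p) (lin_extend f q)"
  by (rule bilin_eqI[where f = "\<lambda>p q. tens_map f (tens p q)" and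
        g = "\<lambda>p q. tens (lin_extend f p) (lin_extend f q)"]) (intro lin_intros | simp)+

lemma tens_map_compose: "tens_map f (tens_map g r) = tens_map (\<lambda>u. lin_extend f (g u)) r"
  by (rule lin_eqI[where f = "\<lambda>r. tens_map f (tens_map g r)"])
    (auto intro!: lin_intros simp: tens_map_tens)

lemma tens_map_id: "(\<And>u. f u = gen u) \<Longrightarrow> tens_map f r = r"
  by (rule lin_eqI[where f = "tens_map f" and g = "\<lambda>r. r"]) (auto intro!: lin_tens_map' lin_intros)

definition prep1 :: "'x \<Rightarrow> ('x list \<times> 'x list \<Rightarrow>\<^sub>0 'k::field) \<Rightarrow> ('x list \<times> 'x list \<Rightarrow>\<^sub>0 'k)" where
  "prep1 x = lin_extend (\<lambda>(u, v). gen (x # u, v))"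

lemma lin_prep1 [lin_intros]: "lin g \<Longrightarrow> lin (\<lambda>p. prep1 x (g p))"
  unfolding prep1_def by (intro lin_intros)

lemmas lin_prep1' = lin_prep1[OF lin_id]

lemma prep1_gen [simp]: "prep1 x (gen (u, v)) = gen (x # u, v)"
  by (simp add: prep1_def)

lemma prep1_tens: "prep1 x (tens p q) = tens (prep x p) q"
  by (rule bilin_eqI[where f = "\<lambda>p q. prep1 x (tens p q)" and g = "\<lambda>p q. tens (prep x p) q"])
    (intro lin_intros | simp)+

definition deconc :: "'x list \<Rightarrow> ('x list \<times> 'x list \<Rightarrow>\<^sub>0 'k::field)" where
  "deconc w = (\<Sum>i\<le>length w. gen (take i w, drop i w))"

lemma deconc_Nil [simp]: "deconc [] = gen ([], [])"
  by (simp add: deconc_def)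

lemma deconc_Cons: "deconc (x # w) = gen ([], x # w) + prep1 x (deconc w)"
  by (simp add: deconc_def sum.atMost_Suc_shift lin_sum[OF lin_prep1'] del: sum.atMost_Suc)

lemma deconc_prep: "lin_extend deconc (prep x p) = tens (gen []) (prep x p) + prep1 x (lin_extend deconc p)"
  by (rule lin_eqI[where f = "\<lambda>p. lin_extend deconc (prep x p)"]) (auto intro!: lin_intros simp: deconc_Cons)

fun sh :: "'v word \<Rightarrow> 'v word \<Rightarrow> ('v word \<Rightarrow>\<^sub>0 'k::field)" where
  "sh [] v = gen v"
| "sh (x # u) [] = gen (x # u)"
| "sh (x # u) (y # v) =
     prep x (sh u (y # v)) + fscale ((-1) ^ (fst y * wdeg (x # u))) (prep y (sh (x # u) v))"

lemma sh_Nil_right [simp]: "sh u [] = gen u"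
  by (cases u) auto

text \<open>Shuffling loses no letters, in contrast to \<open>qsh\<close>. Hence a first block that
  is a shuffle carries one and the same factorial in all of its terms.\<close>

lemma keys_sh_length: "Poly_Mapping.keys (sh u v :: 'v word \<Rightarrow>\<^sub>0 'k::field) \<subseteq> {t. length t = length u + length v}"
proof (induction u v rule: sh.induct)
  case (3 x u y v)
  have "Poly_Mapping.keys (prep z (p :: 'v word \<Rightarrow>\<^sub>0 'k)) \<subseteq> {t. length t = Suc n}"
    if "Poly_Mapping.keys p \<subseteq> {t. length t = n}" for p z n
    using keys_prep[of z p] that by fastforce
  note * = this[OF "3.IH"(1)] this[OF "3.IH"(2)]
  show ?case
    unfolding sh.simps by (intro keys_plus_subset keys_fscale_subset) (use * in auto)
qed auto

text \<open>The summation pattern behind a recursion in two words: an inner cell splits into a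
  contribution shifted in \<open>i\<close> and one shifted in \<open>j\<close>, a border cell
  receives only one of them, and the corner neither.\<close>

lemma sum_grid:
  fixes T X Y :: "nat \<Rightarrow> nat \<Rightarrow> 'z::comm_monoid_add"
  assumes "\<And>i. T (Suc i) 0 = X i 0" "\<And>j. T 0 (Suc j) = Y 0 j"
    "\<And>i j. T (Suc i) (Suc j) = X i (Suc j) + Y (Suc i) j"
  shows "(\<Sum>i\<le>Suc l. \<Sum>j\<le>Suc m. T i j) = T 0 0 + (\<Sum>i\<le>l. \<Sum>j\<le>Suc m. X i j) + (\<Sum>i\<le>Suc l. \<Sum>j\<le>m. Y i j)"
  by (simp add: sum.atMost_Suc_shift assms sum.distrib ac_simps del: sum.atMost_Suc)

text \<open>Shuffle product and deconcatenation form a bialgebra: a cut of a shuffle cuts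
  \<open>u\<close> and \<open>v\<close>, and the sign moves \<open>take j v\<close> to the left past
  \<open>drop i u\<close>. Equality is exact, because no letter is altered.\<close>

lemma deconc_sh:
  "lin_extend deconc (sh u v :: 'v word \<Rightarrow>\<^sub>0 'k::field) = (\<Sum>i\<le>length u. \<Sum>j\<le>length v.
     fscale ((-1) ^ (wdeg (drop i u) * wdeg (take j v)))
       (tens (sh (take i u) (take j v)) (sh (drop i u) (drop j v))))"
proof (induction u v rule: sh.induct)
  case (1 v)
  then show ?case by (simp add: deconc_def)
next
  case (2 x u)
  then show ?case by (simp add: deconc_def)
next
  case (3 x u y v)
  define T where "T u v i j = fscale ((-1) ^ (wdeg (drop i u) * wdeg (take j v)))
       (tens (sh (take i u) (take j v)) (sh (drop i u) (drop j v)) :: 'v word \<times> 'v word \<Rightarrow>\<^sub>0 'k)" for u v :: "'v word" and i j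
  let ?s = "(-1) ^ (fst y * wdeg (x # u)) :: 'k"
  have sign: "fscale ((-1) ^ a) p = fscale ((-1) ^ b) (fscale ((-1) ^ c) p)" if "a = b + c"
    for a b c and p :: "'v word \<times> 'v word \<Rightarrow>\<^sub>0 'k"
    by (simp add: that power_add)
  \<comment> \<open>The corner is the cut in front of everything; in all other terms the left part
    starts with \<open>x\<close> or with \<open>y\<close>.\<close>
  have "(\<Sum>i\<le>Suc (length u). \<Sum>j\<le>Suc (length v). T (x # u) (y # v) i j) = T (x # u) (y # v) 0 0 +
      (\<Sum>i\<le>length u. \<Sum>j\<le>Suc (length v). prep1 x (T u (y # v) i j)) +
      (\<Sum>i\<le>Suc (length u). \<Sum>j\<le>length v. fscale ?s (prep1 y (T (x # u) v i j)))"
  proof (rule sum_grid)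
    fix i j
    show "T (x # u) (y # v) (Suc i) 0 = prep1 x (T u (y # v) i 0)"
      by (simp add: T_def prep1_tens lin_scale[OF lin_prep1'])
    show "T (x # u) (y # v) 0 (Suc j) = fscale ?s (prep1 y (T (x # u) v 0 j))"
      by (simp add: T_def prep1_tens lin_scale[OF lin_prep1'] power_add algebra_simps)
    have wu: "wdeg u = wdeg (take i u) + wdeg (drop i u)" by simp
    show "T (x # u) (y # v) (Suc i) (Suc j) =
        prep1 x (T u (y # v) i (Suc j)) + fscale ?s (prep1 y (T (x # u) v (Suc i) j))"
      unfolding T_def
      by (simp add: prep1_tens lin_scale[OF lin_prep1'] tens_simps free.scale_right_distrib wu
          power_add algebra_simps del: wdeg_take_drop)
  qed
  moreover have "T (x # u) (y # v) 0 0 = tens (gen []) (sh (x # u) (y # v))"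
    by (simp add: T_def)
  moreover have "lin_extend deconc (sh (x # u) (y # v) :: 'v word \<Rightarrow>\<^sub>0 'k) = tens (gen []) (sh (x # u) (y # v)) +
      prep1 x (lin_extend deconc (sh u (y # v))) + fscale ?s (prep1 y (lin_extend deconc (sh (x # u) v)))"
    by (simp add: deconc_prep tens_simps free.scale_right_distrib)
  ultimately show ?case
    by (simp add: 3 T_def[symmetric] lin_sum[OF lin_prep1'] free.scale_sum_right del: sum.atMost_Suc sh.simps)
qed

definition map_word :: "(nat \<Rightarrow> 'v \<Rightarrow> 'w) \<Rightarrow> 'v word \<Rightarrow> 'w word" where
  "map_word \<phi> = map (\<lambda>(n, v). (n, \<phi> n v))"

lemma map_word_simps [simp]:
  "map_word \<phi> [] = []" "map_word \<phi> (x # w) = (fst x, \<phi> (fst x) (snd x)) # map_word \<phi> w"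
  "length (map_word \<phi> w) = length w" "wdeg (map_word \<phi> w) = wdeg w"
  by (induction w) (auto simp: map_word_def wdeg_def split: prod.splits)

lemma map_word_append [simp]: "map_word \<phi> (u @ v) = map_word \<phi> u @ map_word \<phi> v"
  by (simp add: map_word_def)

lemma map_word_take_drop: "map_word \<phi> (take i w) = take i (map_word \<phi> w)"
    "map_word \<phi> (drop i w) = drop i (map_word \<phi> w)"
  by (simp_all add: map_word_def take_map drop_map)

abbreviation word_map :: "(nat \<Rightarrow> 'v \<Rightarrow> 'w) \<Rightarrow> 'v word \<Rightarrow> ('w word \<Rightarrow>\<^sub>0 'k::field)" where
  "word_map \<phi> w \<equiv> gen (map_word \<phi> w)"

lemma word_map_prep:
  "lin_extend (word_map \<phi>) (prep x p) = prep (fst x, \<phi> (fst x) (snd x)) (lin_extend (word_map \<phi>) p)"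
  by (rule lin_eqI[where f = "\<lambda>p. lin_extend (word_map \<phi>) (prep x p)"]) (auto intro!: lin_intros)

lemma word_map_sh: "lin_extend (word_map \<phi>) (sh u v) = sh (map_word \<phi> u) (map_word \<phi> v)"
  by (induction u v rule: sh.induct) (simp_all add: word_map_prep)

lemma word_map_deconc: "deconc (map_word \<phi> w) = tens_map (word_map \<phi>) (deconc w)"
  by (simp add: deconc_def lin_sum[OF lin_tens_map'] map_word_take_drop)


section \<open>The exponential as a coalgebra map\<close>

lemma sum_triangle_swap:
  fixes G :: "nat \<Rightarrow> nat \<Rightarrow> 'z::comm_monoid_add"
  shows "(\<Sum>k<n. \<Sum>i\<le>k. G i (k - i)) = (\<Sum>i<n. \<Sum>k<n - i. G i k)"
proof -
  have "(\<Sum>k<n. \<Sum>i\<le>k. G i (k - i)) = (\<Sum>(i, j)\<in>{(i, j). i + j < n}. G i j)"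
    by (rule sum.triangle_reindex[symmetric])
  also have "{(i, j). i + j < n} = (SIGMA i:{..<n}. {..<n - i})" by auto
  also have "(\<Sum>(i, j)\<in>\<dots>. G i j) = (\<Sum>i<n. \<Sum>k<n - i. G i k)"
    by (rule sum.Sigma[symmetric]) auto
  finally show ?thesis .
qed

text \<open>A cut of a word of blocks falls between two blocks, so it amounts to a cut of
  \<open>w\<close> together with block decompositions of both pieces. Merging happens only inside
  blocks, which makes the identity exact.\<close>

lemma deconc_hexp:
  fixes w :: "'a::ring_1 word"
  shows "lin_extend deconc (hexp w) = (tens_map hexp (deconc w) :: 'a word \<times> 'a word \<Rightarrow>\<^sub>0 'k::field_char_0)"
proof (induction w rule: length_induct)
  case (1 w)
  show ?case
  proof (cases "w = []")
    case False
    let ?n = "length w"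
    let ?x = "\<lambda>i. combine (take (Suc i) w)"
    let ?u = "\<lambda>i. drop (Suc i) w"
    let ?c = "\<lambda>i. 1 / fact (Suc i)"
    define G where "G i k = fscale (?c i) (tens (prep (?x i) (hexp (take k (?u i)))) (hexp (drop k (?u i))) :: 'a word \<times> 'a word \<Rightarrow>\<^sub>0 'k)" for i k
    have IH: "lin_extend deconc (hexp (?u i)) = (\<Sum>k<?n - i. tens (hexp (take k (?u i))) (hexp (drop k (?u i))) :: 'a word \<times> 'a word \<Rightarrow>\<^sub>0 'k)"
      if "i < ?n" for i
    proof -
      have "length (?u i) < ?n" using that by simp
      then have "lin_extend deconc (hexp (?u i)) = (tens_map hexp (deconc (?u i)) :: 'a word \<times> 'a word \<Rightarrow>\<^sub>0 'k)"
        using 1 by blast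
      also have "\<dots> = (\<Sum>k\<le>length (?u i). tens (hexp (take k (?u i))) (hexp (drop k (?u i))))"
        by (simp add: deconc_def lin_sum[OF lin_tens_map'] del: drop_drop)
      also have "{..length (?u i)} = {..<?n - i}" using that by auto
      finally show ?thesis .
    qed
    have "lin_extend deconc (hexp w :: 'a word \<Rightarrow>\<^sub>0 'k) = (\<Sum>i<?n. fscale (?c i) (tens (gen []) (prep (?x i) (hexp (?u i))))) +
        (\<Sum>i<?n. fscale (?c i) (prep1 (?x i) (lin_extend deconc (hexp (?u i)))))"
      unfolding hexp_nonempty[OF False]
      by (simp add: lin_extend_sum deconc_prep free.scale_right_distrib sum.distrib del: fact_Suc)
    also have "(\<Sum>i<?n. fscale (?c i) (tens (gen []) (prep (?x i) (hexp (?u i))))) = tens (gen []) (hexp w)"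
      unfolding hexp_nonempty[OF False] by (simp add: tens_simps del: fact_Suc)
    also have "(\<Sum>i<?n. fscale (?c i) (prep1 (?x i) (lin_extend deconc (hexp (?u i))))) = (\<Sum>i<?n. \<Sum>k<?n - i. G i k)"
      by (intro sum.cong refl) (simp add: IH G_def lin_sum[OF lin_prep1'] prep1_tens free.scale_sum_right
          del: drop_drop fact_Suc)
    \<comment> \<open>So far \<open>k\<close> counts the letters between the first block and the
      cut; from now on the cut is located by its absolute position, \<open>Suc k\<close> letters
      from the left.\<close>
    also have "\<dots> = (\<Sum>k<?n. \<Sum>i\<le>k. G i (k - i))"
      by (rule sum_triangle_swap[symmetric])
    also have "\<dots> = (\<Sum>k<?n. tens (hexp (take (Suc k) w)) (hexp (drop (Suc k) w)))"
    proof (intro sum.cong refl)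
      fix k assume "k \<in> {..<?n}"
      then have k: "take (Suc k) w \<noteq> []" "length (take (Suc k) w) = Suc k" by auto
      have eq: "take (k - i) (?u i) = drop (Suc i) (take (Suc k) w)" "drop (k - i) (?u i) = drop (Suc k) w"
        "take (Suc i) (take (Suc k) w) = take (Suc i) w" if "i \<le> k" for i
        using that by (simp_all add: drop_take min_def)
      show "(\<Sum>i\<le>k. G i (k - i)) = tens (hexp (take (Suc k) w)) (hexp (drop (Suc k) w))"
        unfolding hexp_nonempty[OF k(1)] k(2) G_def lessThan_Suc_atMost tens_simps
        by (intro sum.cong refl) (simp add: eq del: take_take drop_drop)
    qed
    also have "tens (gen []) (hexp w) + \<dots> = (\<Sum>k\<le>?n. tens (hexp (take k w)) (hexp (drop k w)))"
      by (simp add: sum.atMost_shift)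
    also have "\<dots> = tens_map hexp (deconc w)"
      by (simp add: deconc_def lin_sum[OF lin_tens_map'])
    finally show ?thesis .
  qed simp
qed

lemma deconc_lin_hexp: "lin_extend deconc (lin_extend hexp p) = tens_map hexp (lin_extend deconc p)"
  by (rule lin_eqI[where f = "\<lambda>p. lin_extend deconc (lin_extend hexp p)"])
    (auto intro!: lin_intros simp: deconc_hexp)

text \<open>The identity for \<open>hexp\<close> at \<open>hlog p\<close>, with
  \<open>tens_map hlog\<close> applied to both sides.\<close>

lemma deconc_lin_hlog:
  fixes p :: "'a::ring_1 word \<Rightarrow>\<^sub>0 'k::field_char_0"
  shows "lin_extend deconc (lin_extend hlog p) = tens_map hlog (lin_extend deconc p)"
proof -
  have "lin_extend hlog (hexp u) = (gen u :: 'a word \<Rightarrow>\<^sub>0 'k)" for u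
    using hexp.f_inverse'[of "gen u"] by simp
  then have "tens_map hlog (tens_map hexp r) = r" for r :: "'a word \<times> 'a word \<Rightarrow>\<^sub>0 'k"
    by (simp add: tens_map_compose tens_map_id)
  then show ?thesis
    using deconc_lin_hexp[of "lin_extend hlog p"] by (simp add: hexp.f_inverse)
qed

section \<open>The exponential as an algebra map\<close>

text \<open>Chosen so that \<open>hexp\<close> is \<open>exp_pair\<close> after deconcatenation: the
  left part is the first block and the right part is still to be exponentiated. The value
  \<open>0\<close> excludes an empty first block.\<close>

definition exp_pair :: "'a::ring_1 word \<times> 'a word \<Rightarrow> ('a word \<Rightarrow>\<^sub>0 'k::field_char_0)" where
  "exp_pair = (\<lambda>(u, v). if u = [] then 0 else fscale (1 / fact (length u)) (prep (combine u) (hexp v)))"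

lemma hexp_eq_exp_pair: "w \<noteq> [] \<Longrightarrow> hexp w = lin_extend exp_pair (deconc w)"
  unfolding deconc_def
  by (auto simp: lin_extend_sum sum.atMost_shift exp_pair_def hexp_nonempty simp del: fact_Suc intro!: sum.cong)

lemma exp_pair_tens:
  assumes "Poly_Mapping.keys p \<subseteq> {t. length t = n}" "n > 0"
  shows "lin_extend exp_pair (tens p q) =
    fscale (1 / fact n) (lin_extend (\<lambda>t. prep (combine t) (lin_extend hexp q)) p)"
proof (rule bilin_eqI[where f = "\<lambda>p q. lin_extend exp_pair (tens p q)"])
  show "lin (\<lambda>q. fscale (1 / fact n) (lin_extend (\<lambda>t. prep (combine t) (lin_extend hexp q)) p))" for p
    unfolding lin_extend_def[of _ p] by (intro lin_intros)
  fix u v assume "u \<in> Poly_Mapping.keys p"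
  then have "length u = n" "u \<noteq> []" using assms by auto
  then show "lin_extend exp_pair (tens (gen u) (gen v)) =
      fscale (1 / fact n) (lin_extend (\<lambda>t. prep (combine t) (lin_extend hexp (gen v))) (gen u))"
    by (simp add: exp_pair_def)
qed (intro lin_intros)+

lemma qmul_Nil_left [simp]: "qmul (gen []) q = q"
  by (rule lin_eqI[where f = "qmul (gen [])" and g = "\<lambda>q. q"]) (auto intro!: lin_bilin_extend_right lin_id)

lemma qmul_Nil_right [simp]: "qmul p (gen []) = p"
  by (rule lin_eqI[where f = "\<lambda>p. qmul p (gen [])" and g = "\<lambda>p. p"]) (auto intro!: lin_bilin_extend_left lin_id)

text \<open>The signs depend on the degree of the word behind \<open>x\<close>, so the recursion
  extends to linear combinations only if \<open>p\<close> is homogeneous.\<close>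

lemma qmul_prep_prep:
  assumes "\<And>t. t \<in> Poly_Mapping.keys p \<Longrightarrow> wdeg t = d"
  shows "qmul (prep x p) (prep y q) =
    prep x (qmul p (prep y q)) +
    fscale ((-1) ^ (fst y * (fst x + d))) (prep y (qmul (prep x p) q)) +
    fscale ((-1) ^ (fst y * d)) (prep (fst x + fst y, snd x * snd y) (qmul p q))"
  by (rule bilin_eqI[where f = "\<lambda>p q. qmul (prep x p) (prep y q)"])
    (intro lin_intros | simp add: assms)+

lemmas lin_qmul_left' = lin_bilin_extend_left[OF lin_id]
lemmas lin_qmul_right' = lin_bilin_extend_right[OF lin_id]

text \<open>Passes \<open>x\<close> from the argument to the prefix \<open>a\<close>, which collects
  the letters already placed in an induction over shuffles.\<close>

lemma combine_prep:
  "lin_extend (\<lambda>t. prep (combine (a @ t)) q) (prep x p) = lin_extend (\<lambda>t. prep (combine ((a @ [x]) @ t)) q) p"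
  by (rule lin_eqI[where f = "\<lambda>p. lin_extend (\<lambda>t. prep (combine (a @ t)) q) (prep x p)"])
    (auto intro!: lin_intros)

context char_0_algebra
begin

text \<open>Graded commutativity moves \<open>y\<close> behind \<open>u\<close>; the resulting
  scalar sits inside the merged letter and leaves it only modulo the relations. For empty
  \<open>u\<close> the product of its letters would be \<open>1\<close>, outside the positive
  part.\<close>

lemma combine_move:
  assumes "a \<in> words V" "u \<in> words V" "v \<in> words V" "snd y \<in> part V (fst y)" "u \<noteq> []"
    and q: "Poly_Mapping.keys q \<subseteq> words V"
  shows "eqv V (prep (combine (a @ y # u @ v)) q)
    (fscale ((-1) ^ (fst y * wdeg u)) (prep (combine (a @ u @ y # v)) q))"
proof -
  let ?A = "snd (combine a)" and ?U = "snd (combine u)" and ?W = "snd (combine v)"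
  have U: "?U \<in> part V (wdeg u)" using assms by (intro combine_V)
  have "snd y * ?U = (-1) ^ (wdeg u * fst y) *s (?U * snd y)"
    by (rule V_comm[OF U assms(4)])
  then have "(snd y * ?U) * ?W = (-1) ^ (wdeg u * fst y) *s ((?U * snd y) * ?W)"
    by (simp only: scale_mult_left)
  then have "snd y * (?U * ?W) = (-1) ^ (fst y * wdeg u) *s (?U * (snd y * ?W))"
    by (simp only: mult.assoc mult.commute[of "wdeg u"])
  then have "combine (a @ y # u @ v) =
      (wdeg (a @ u @ y # v), (-1) ^ (fst y * wdeg u) *s snd (combine (a @ u @ y # v)))"
    by (subst combine_eq) (simp add: scale_mult_right)
  moreover have "eqv V (prep (wdeg (a @ u @ y # v), (-1) ^ (fst y * wdeg u) *s snd (combine (a @ u @ y # v))) q)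
      (fscale ((-1) ^ (fst y * wdeg u)) (prep (wdeg (a @ u @ y # v), snd (combine (a @ u @ y # v))) q))"
    using assms by (intro eqv_letter_scale combine_V) auto
  ultimately show ?thesis by (simp only: combine_eq[of "a @ u @ y # v", symmetric])
qed

text \<open>All shuffles of \<open>u\<close> and \<open>v\<close> give the same merged letter up to
  a sign, which the sign of the shuffle undoes, and the binomial coefficient counts them. The prefix
  \<open>a\<close> makes the induction possible.\<close>

lemma combine_sh:
  assumes "a \<in> words V" "u \<in> words V" "v \<in> words V" "Poly_Mapping.keys q \<subseteq> words V"
  shows "eqv V (lin_extend (\<lambda>t. prep (combine (a @ t)) q) (sh u v))
    (fscale (of_nat ((length u + length v) choose length u)) (prep (combine (a @ u @ v)) q))"
  using assms(1-3)
proof (induction u v arbitrary: a rule: sh.induct)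
  case (3 x u y v)
  let ?s = "(-1) ^ (fst y * wdeg (x # u)) :: 'k"
  let ?l = "length u" and ?m = "length v"
  let ?P = "prep (combine (a @ (x # u) @ (y # v))) q"
  let ?b = "of_nat ((?l + Suc ?m) choose ?l) :: 'k" and ?b' = "of_nat ((Suc ?l + ?m) choose Suc ?l) :: 'k"
  have 1: "eqv V (lin_extend (\<lambda>t. prep (combine ((a @ [x]) @ t)) q) (sh u (y # v))) (fscale ?b ?P)"
    using "3.IH"(1)[of "a @ [x]"] "3.prems" by simp
  have "eqv V (lin_extend (\<lambda>t. prep (combine ((a @ [y]) @ t)) q) (sh (x # u) v))
      (fscale ?b' (prep (combine (a @ y # (x # u) @ v)) q))"
    using "3.IH"(2)[of "a @ [y]"] "3.prems" by simp
  also have "eqv V \<dots> (fscale ?b' (fscale ?s ?P))"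
    using "3.prems" assms(4) by (intro eqv_fscale combine_move) auto
  finally have 2: "eqv V (fscale ?s (lin_extend (\<lambda>t. prep (combine ((a @ [y]) @ t)) q) (sh (x # u) v)))
      (fscale ?s (fscale ?b' (fscale ?s ?P)))"
    by (rule eqv_fscale)
  \<comment> \<open>One sign comes from the shuffle recursion, the other from moving
    \<open>y\<close> back behind \<open>x # u\<close>.\<close>
  have "?s * ?s = 1" by (simp add: power_add[symmetric])
  then have "fscale ?s (fscale ?b' (fscale ?s ?P)) = fscale ?b' ?P"
    by (simp add: mult.assoc mult.left_commute)
  with eqv_add[OF 1 2] have "eqv V (lin_extend (\<lambda>t. prep (combine (a @ t)) q) (sh (x # u) (y # v)))
      (fscale ?b ?P + fscale ?b' ?P)"
    by (simp only: sh.simps lin_extend_plus lin_extend_fscale combine_prep)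
  \<comment> \<open>The two coefficients add up by Pascal's rule.\<close>
  also have "fscale ?b ?P + fscale ?b' ?P = fscale (of_nat ((length (x # u) + length (y # v)) choose length (x # u))) ?P"
    by (simp add: free.scale_left_distrib[symmetric] add.commute)
  finally show ?case .
qed simp_all

text \<open>After the binomial coefficient has cancelled, the weight of the first block is a product
  of one factor for \<open>u\<close> and one for \<open>v\<close>, as in a product of two
  exponentials.\<close>

lemma exp_pair_sh:
  assumes "u \<in> words V" "v \<in> words V" "u \<noteq> [] \<or> v \<noteq> []" "Poly_Mapping.keys (lin_extend hexp q) \<subseteq> words V"
  shows "eqv V (lin_extend exp_pair (tens (sh u v) q))
    (fscale (1 / (fact (length u) * fact (length v))) (prep (combine (u @ v)) (lin_extend hexp q)))"
proof -
  let ?l = "length u" and ?m = "length v"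
  have "(of_nat ((?l + ?m) choose ?l) :: 'k) = fact (?l + ?m) / (fact ?l * fact ?m)"
    by (simp add: binomial_fact)
  then have c: "1 / fact (?l + ?m) * (of_nat ((?l + ?m) choose ?l) :: 'k) = 1 / (fact ?l * fact ?m)"
    by simp
  have "lin_extend exp_pair (tens (sh u v) q) =
      fscale (1 / fact (?l + ?m)) (lin_extend (\<lambda>t. prep (combine ([] @ t)) (lin_extend hexp q)) (sh u v))"
    using assms(3) by (subst exp_pair_tens[OF keys_sh_length]) auto
  also have "eqv V \<dots> (fscale (1 / fact (?l + ?m)) (fscale (of_nat ((?l + ?m) choose ?l))
      (prep (combine ([] @ u @ v)) (lin_extend hexp q))))"
    using assms by (intro eqv_fscale combine_sh) auto
  finally show ?thesis by (simp only: free.scale_scale c append_Nil)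
qed

lemma keys_sh: "u \<in> words V \<Longrightarrow> v \<in> words V \<Longrightarrow> Poly_Mapping.keys (sh u v :: 'a word \<Rightarrow>\<^sub>0 'k) \<subseteq> homs V (wdeg u + wdeg v)"
proof (induction u v rule: sh.induct)
  case (3 x u y v)
  from "3.prems" have w: "u \<in> words V" "v \<in> words V" "x # u \<in> words V" "y # v \<in> words V" by auto
  note k = "3.IH"(1)[OF w(1,4)] "3.IH"(2)[OF w(3,2)]
  show ?case
    unfolding sh.simps using "3.prems"
    by (intro keys_plus_subset keys_fscale_subset k[THEN keys_prep_homs]) auto
qed (auto simp: homs_def)

lemma keys_lin_hexp_words:
  assumes "Poly_Mapping.keys p \<subseteq> words V"
  shows "Poly_Mapping.keys (lin_extend hexp p :: 'a word \<Rightarrow>\<^sub>0 'k) \<subseteq> words V"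
proof (rule keys_lin_subset[OF lin_lin_extend])
  fix w assume "w \<in> Poly_Mapping.keys p"
  then show "Poly_Mapping.keys (lin_extend hexp (gen w) :: 'a word \<Rightarrow>\<^sub>0 'k) \<subseteq> words V"
    using assms keys_hexp[of w] homs_words by fastforce
qed

text \<open>Here \<open>i\<close> and \<open>j\<close> count the letters of \<open>u\<close> and
  \<open>v\<close> consumed by the first letter of a term. The cases \<open>j = 0\<close>,
  \<open>i = 0\<close> and both positive are the three summands of the quasi-shuffle recursion; some
  letter is always consumed, so the corner is \<open>0\<close>.\<close>

lemma qmul_hexp_expand:
  assumes u: "u \<in> words V" "u \<noteq> []" and v: "v \<in> words V" "v \<noteq> []"
  defines "Z \<equiv> \<lambda>i j. if i = 0 \<and> j = 0 then 0 else
    fscale ((-1) ^ (wdeg (drop i u) * wdeg (take j v)))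
      (fscale (1 / (fact i * fact j)) (prep (combine (take i u @ take j v))
        (qmul (hexp (drop i u)) (hexp (drop j v)) :: 'a word \<Rightarrow>\<^sub>0 'k)))"
  shows "qmul (hexp u) (hexp v) = (\<Sum>i\<le>length u. \<Sum>j\<le>length v. Z i j)"
proof -
  let ?l = "length u" and ?m = "length v"
  define c where "c i = (1 / fact (Suc i) :: 'k)" for i
  define x where "x i = combine (take (Suc i) u)" for i
  define y where "y j = combine (take (Suc j) v)" for j
  define p where "p i = (hexp (drop (Suc i) u) :: 'a word \<Rightarrow>\<^sub>0 'k)" for i
  define q where "q j = (hexp (drop (Suc j) v) :: 'a word \<Rightarrow>\<^sub>0 'k)" for j
  have hu: "hexp u = (\<Sum>i<?l. fscale (c i) (prep (x i) (p i)))"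
    unfolding c_def x_def p_def by (rule hexp_nonempty[OF u(2)])
  have hv: "hexp v = (\<Sum>j<?m. fscale (c j) (prep (y j) (q j)))"
    unfolding c_def y_def q_def by (rule hexp_nonempty[OF v(2)])
  have deg: "fst (x i) + wdeg (drop (Suc i) u) = wdeg u" for i
    by (simp add: x_def)
  have mul: "qmul (prep (x i) (p i)) (prep (y j) (q j)) =
      prep (x i) (qmul (p i) (prep (y j) (q j))) +
      fscale ((-1) ^ (fst (y j) * wdeg u)) (prep (y j) (qmul (prep (x i) (p i)) (q j))) +
      fscale ((-1) ^ (fst (y j) * wdeg (drop (Suc i) u))) (prep (fst (x i) + fst (y j), snd (x i) * snd (y j)) (qmul (p i) (q j)))"
    for i j
    using keys_hexp[of "drop (Suc i) u"] u
    by (subst qmul_prep_prep[of _ "wdeg (drop (Suc i) u)"]) (auto simp: deg p_def homs_def)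
  have "qmul (hexp u) (hexp v) = (\<Sum>i<?l. \<Sum>j<?m. fscale (c i) (fscale (c j) (qmul (prep (x i) (p i)) (prep (y j) (q j)))))"
  proof -
    have 1: "qmul (hexp u) r = (\<Sum>i<?l. fscale (c i) (qmul (prep (x i) (p i)) r))" for r
      unfolding hu by (simp add: lin_sum[OF lin_qmul_left'] lin_scale[OF lin_qmul_left'])
    have 2: "qmul r (hexp v) = (\<Sum>j<?m. fscale (c j) (qmul r (prep (y j) (q j))))" for r
      unfolding hv by (simp add: lin_sum[OF lin_qmul_right'] lin_scale[OF lin_qmul_right'])
    show ?thesis unfolding 1 unfolding 2 free.scale_sum_right by (rule refl)
  qed
  also have "\<dots> = (\<Sum>i<?l. \<Sum>j<?m. fscale (c i) (fscale (c j) (prep (x i) (qmul (p i) (prep (y j) (q j)))))) +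
      (\<Sum>i<?l. \<Sum>j<?m. fscale (c i) (fscale (c j) (fscale ((-1) ^ (fst (y j) * wdeg u)) (prep (y j) (qmul (prep (x i) (p i)) (q j)))))) +
      (\<Sum>i<?l. \<Sum>j<?m. fscale (c i) (fscale (c j) (fscale ((-1) ^ (fst (y j) * wdeg (drop (Suc i) u)))
        (prep (fst (x i) + fst (y j), snd (x i) * snd (y j)) (qmul (p i) (q j))))))"
    by (simp only: mul free.scale_right_distrib sum.distrib)
  \<comment> \<open>When the first letter comes from \<open>u\<close> alone, the sum over
    \<open>j\<close> reassembles \<open>hexp v\<close>.\<close>
  also have "(\<Sum>i<?l. \<Sum>j<?m. fscale (c i) (fscale (c j) (prep (x i) (qmul (p i) (prep (y j) (q j)))))) =
      (\<Sum>i<?l. fscale (c i) (prep (x i) (qmul (p i) (hexp v))))"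
    unfolding hv
    by (simp add: lin_sum[OF lin_qmul_right'] lin_scale[OF lin_qmul_right'] prep_sum free.scale_sum_right
        del: free.scale_scale)
  also have "\<dots> = (\<Sum>i<?l. Z (Suc i) 0)"
    by (simp add: Z_def c_def x_def p_def)
  \<comment> \<open>Symmetrically the sum over \<open>i\<close> reassembles \<open>hexp u\<close>.
    The sign does not depend on \<open>i\<close>, because a first block and the rest of
    \<open>u\<close> always have total degree \<open>wdeg u\<close>.\<close>
  also have "(\<Sum>i<?l. \<Sum>j<?m. fscale (c i) (fscale (c j) (fscale ((-1) ^ (fst (y j) * wdeg u)) (prep (y j) (qmul (prep (x i) (p i)) (q j)))))) =
      (\<Sum>j<?m. fscale (c j) (fscale ((-1) ^ (fst (y j) * wdeg u)) (prep (y j) (qmul (hexp u) (q j)))))"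
    unfolding hu
    by (subst sum.swap) (simp add: lin_sum[OF lin_qmul_left'] lin_scale[OF lin_qmul_left'] prep_sum
        free.scale_sum_right ac_simps)
  also have "\<dots> = (\<Sum>j<?m. Z 0 (Suc j))"
    by (simp add: Z_def c_def y_def q_def mult.commute)
  also have "(\<Sum>i<?l. \<Sum>j<?m. fscale (c i) (fscale (c j) (fscale ((-1) ^ (fst (y j) * wdeg (drop (Suc i) u)))
        (prep (fst (x i) + fst (y j), snd (x i) * snd (y j)) (qmul (p i) (q j)))))) = (\<Sum>i<?l. \<Sum>j<?m. Z (Suc i) (Suc j))"
  proof (intro sum.cong refl)
    fix i j
    have "combine (take (Suc i) u @ take (Suc j) v) = (fst (x i) + fst (y j), snd (x i) * snd (y j))"
      by (simp add: combine_append x_def y_def)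
    then show "fscale (c i) (fscale (c j) (fscale ((-1) ^ (fst (y j) * wdeg (drop (Suc i) u)))
        (prep (fst (x i) + fst (y j), snd (x i) * snd (y j)) (qmul (p i) (q j))))) = Z (Suc i) (Suc j)"
      by (simp add: Z_def c_def p_def q_def y_def mult.commute del: fact_Suc)
  qed
  finally show ?thesis
    by (simp add: sum.atMost_shift sum.distrib Z_def[THEN meta_eq_to_obj_eq, THEN fun_cong, THEN fun_cong, of 0 0] ac_simps)
qed

text \<open>The first block is split off on both sides: \<open>deconc_sh\<close> and
  \<open>exp_pair_sh\<close> expand the exponential of a shuffle product into the terms that
  \<open>qmul_hexp_expand\<close> finds for the product of exponentials. The remainders are shorter,
  as \<open>i\<close> and \<open>j\<close> are not both \<open>0\<close>, and are compared by
  induction.\<close>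

theorem hexp_sh:
  assumes "u \<in> words V" "v \<in> words V"
  shows "eqv V (lin_extend hexp (sh u v)) (qmul (hexp u) (hexp v) :: 'a word \<Rightarrow>\<^sub>0 'k)"
  using assms
proof (induction "length u + length v" arbitrary: u v rule: less_induct)
  case less
  show ?case
  proof (cases "u = [] \<or> v = []")
    case True
    then show ?thesis by auto
  next
    case False
    then have ne: "u \<noteq> []" "v \<noteq> []" by auto
    let ?s = "\<lambda>i j. (-1) ^ (wdeg (drop i u) * wdeg (take j v)) :: 'k"
    define Z where "Z i j = (if i = 0 \<and> j = 0 then 0 else fscale (?s i j)
      (fscale (1 / (fact i * fact j)) (prep (combine (take i u @ take j v))
        (qmul (hexp (drop i u)) (hexp (drop j v)) :: 'a word \<Rightarrow>\<^sub>0 'k))))" for i j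
    have "lin_extend hexp (sh u v :: 'a word \<Rightarrow>\<^sub>0 'k) = lin_extend exp_pair (lin_extend deconc (sh u v))"
    proof (rule lin_eqI[where f = "lin_extend hexp" and g = "\<lambda>p. lin_extend exp_pair (lin_extend deconc p)"])
      fix w assume "w \<in> Poly_Mapping.keys (sh u v :: 'a word \<Rightarrow>\<^sub>0 'k)"
      then have "length w = length u + length v" using keys_sh_length by blast
      then show "lin_extend hexp (gen w) = lin_extend exp_pair (lin_extend deconc (gen w))"
        using ne by (auto intro!: hexp_eq_exp_pair)
    qed (intro lin_intros)+
    also have "\<dots> = (\<Sum>i\<le>length u. \<Sum>j\<le>length v. fscale (?s i j)
        (lin_extend exp_pair (tens (sh (take i u) (take j v)) (sh (drop i u) (drop j v)))))"
      by (simp add: deconc_sh lin_extend_sum)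
    also have "eqv V \<dots> (\<Sum>i\<le>length u. \<Sum>j\<le>length v. Z i j)"
    proof (intro eqv_sum)
      fix i j assume i: "i \<in> {..length u}" and j: "j \<in> {..length v}"
      show "eqv V (fscale (?s i j) (lin_extend exp_pair (tens (sh (take i u) (take j v)) (sh (drop i u) (drop j v))))) (Z i j)"
      proof (cases "i = 0 \<and> j = 0")
        case True
        \<comment> \<open>The vanishing of \<open>exp_pair\<close> on an empty left part matches the
          corner of \<open>Z\<close>.\<close>
        have "lin_extend exp_pair (tens (gen []) r) = 0" for r :: "'a word \<Rightarrow>\<^sub>0 'k"
          by (rule lin_eqI[where f = "\<lambda>r. lin_extend exp_pair (tens (gen []) r)" and g = "\<lambda>r. 0"])
            (auto intro!: lin_intros simp: exp_pair_def)
        with True show ?thesis by (simp add: Z_def)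
      next
        case False
        let ?q = "sh (drop i u) (drop j v) :: 'a word \<Rightarrow>\<^sub>0 'k"
        have q: "Poly_Mapping.keys ?q \<subseteq> words V"
          using keys_sh[of "drop i u" "drop j v"] less.prems homs_words by fastforce
        have hq: "eqv V (lin_extend hexp ?q) (qmul (hexp (drop i u)) (hexp (drop j v)))"
          using False i j less.prems by (intro less.hyps) auto
        have "eqv V (lin_extend exp_pair (tens (sh (take i u) (take j v)) ?q))
            (fscale (1 / (fact (length (take i u)) * fact (length (take j v)))) (prep (combine (take i u @ take j v)) (lin_extend hexp ?q)))"
          using False i j less.prems ne by (intro exp_pair_sh keys_lin_hexp_words q) auto
        also have "eqv V \<dots> (fscale (1 / (fact (length (take i u)) * fact (length (take j v)))) (prep (combine (take i u @ take j v))
            (qmul (hexp (drop i u)) (hexp (drop j v)))))"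
        proof (intro eqv_fscale eqv_prep hq)
          show "snd (combine (take i u @ take j v)) \<in> part V (fst (combine (take i u @ take j v)))"
            unfolding fst_combine using False ne less.prems by (intro combine_V) auto
        qed
        finally have "eqv V (lin_extend exp_pair (tens (sh (take i u) (take j v)) ?q))
            (fscale (1 / (fact i * fact j)) (prep (combine (take i u @ take j v)) (qmul (hexp (drop i u)) (hexp (drop j v)))))"
          using i j by simp
        from eqv_fscale[OF this, of "?s i j"] False show ?thesis
          unfolding Z_def by (simp only: if_False)
      qed
    qed
    also have "(\<Sum>i\<le>length u. \<Sum>j\<le>length v. Z i j) = qmul (hexp u) (hexp v)"
      unfolding Z_def using qmul_hexp_expand[OF less.prems(1) ne(1) less.prems(2) ne(2)] by simp
    finally show ?thesis .
  qed
qed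

end

section \<open>The structure maps on cosets\<close>

lemma J_simps [simp]:
  "part (J scale A) = part (J_alg scale A)"
  "vadd (J scale A) = vadd (J_alg scale A)"
  "vscale (J scale A) = vscale (J_alg scale A)"
  "gmult (J scale A) = gmult (J_alg scale A)"
  "gone (J scale A) = gone (J_alg scale A)"
  "comult (J scale A) = J_comult scale A"
  "counit (J scale A) X = Poly_Mapping.lookup (rep X) []"
  by (simp_all add: J_def graded_alg.extend_def)

lemma words_J [simp]: "words (J scale A) = words (J_alg scale A)"
  by (simp add: words_def)

lemma relations_J [simp]: "relations (J scale A) = relations (J_alg scale A)"
  by (simp add: relations_def)

lemma coset_J [simp]: "coset (J scale A) = coset (J_alg scale A)"
  by (simp add: coset_def fun_eq_iff)

text \<open>The generators of the relations consist of nonempty words, so the counit does not depend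
  on the representative.\<close>

lemma lookup_Nil_eqv:
  assumes "eqv V p q" shows "Poly_Mapping.lookup p [] = Poly_Mapping.lookup q []"
proof -
  have "free.subspace {p :: 'b word \<Rightarrow>\<^sub>0 'a. Poly_Mapping.lookup p [] = 0}"
    by (auto simp: free.subspace_def lookup_add)
  then have "relations V \<subseteq> {p. Poly_Mapping.lookup p [] = 0}"
    unfolding relations_def
    by (intro free.span_minimal) (auto simp: lookup_minus lookup_single)
  then show ?thesis using assms by (auto simp: eqv_def lookup_minus)
qed

text \<open>Stated for arbitrary graded spaces because it is applied twice: to the given map of
  positive parts and to the induced map of quasi-shuffle algebras, in whose tensor square the
  coproduct takes its values.\<close>

lemma word_map_multilinear:
  assumes "graded_space_iso V W \<phi>"
  shows "multilinear_mod V (relations W) (word_map \<phi> :: _ \<Rightarrow> _ \<Rightarrow>\<^sub>0 'k::field)"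
proof -
  have part: "x \<in> part V n \<Longrightarrow> \<phi> n x \<in> part W n" for x n
    using assms unfolding graded_space_iso_def bij_betw_def by blast
  have words: "w \<in> words V \<Longrightarrow> map_word \<phi> w \<in> words W" for w
    by (induction w) (auto intro: part)
  have "\<phi> n (vadd V x y) = vadd W (\<phi> n x) (\<phi> n y)" "\<phi> n (vscale V c x) = vscale W c (\<phi> n x)"
    if "x \<in> part V n" "y \<in> part V n" for n x y c
    using assms that unfolding graded_space_iso_def by blast+
  then show ?thesis
    using multilinear_mod_gen[of W, unfolded multilinear_mod_def] part words
    unfolding multilinear_mod_def by simp
qed

lemma graded_space_iso_inverse:
  assumes iso: "graded_space_iso V W \<phi>"
    and closed: "\<And>n x y. x \<in> part V n \<Longrightarrow> y \<in> part V n \<Longrightarrow> vadd V x y \<in> part V n"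
      "\<And>n c x. x \<in> part V n \<Longrightarrow> vscale V c x \<in> part V n"
  shows "graded_space_iso W V (\<lambda>n. inv_into (part V n) (\<phi> n))"
  unfolding graded_space_iso_def
proof (intro allI conjI ballI)
  fix n
  have bij: "bij_betw (\<phi> n) (part V n) (part W n)"
    using iso by (simp add: graded_space_iso_def)
  show "bij_betw (inv_into (part V n) (\<phi> n)) (part W n) (part V n)"
    by (rule bij_betw_inv_into[OF bij])
  fix x c assume "x \<in> part W n"
  then obtain x' where x: "x' \<in> part V n" "x = \<phi> n x'" using bij by (auto simp: bij_betw_def)
  have inv: "inv_into (part V n) (\<phi> n) (\<phi> n z) = z" if "z \<in> part V n" for z
    using bij that by (simp add: bij_betw_def)
  have "vscale W c x = \<phi> n (vscale V c x')"
    using iso x by (simp add: graded_space_iso_def)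
  then show "inv_into (part V n) (\<phi> n) (vscale W c x) = vscale V c (inv_into (part V n) (\<phi> n) x)"
    using x by (simp add: inv closed)
  fix y assume "y \<in> part W n"
  then obtain y' where y: "y' \<in> part V n" "y = \<phi> n y'" using bij by (auto simp: bij_betw_def)
  have "vadd W x y = \<phi> n (vadd V x' y')"
    using iso x y by (simp add: graded_space_iso_def)
  then show "inv_into (part V n) (\<phi> n) (vadd W x y) =
      vadd V (inv_into (part V n) (\<phi> n) x) (inv_into (part V n) (\<phi> n) y)"
    using x y by (simp add: inv closed)
qed

text \<open>The bridge between the two levels of tensors: classes of words over the positive part
  serve as letters of words over the quasi-shuffle algebra.\<close>

definition coset_pair :: "('k::field, 'v, 'e) graded_space_scheme \<Rightarrow> 'v word \<times> 'v word \<Rightarrow> (('k, 'v) tensor word \<Rightarrow>\<^sub>0 'k)"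
  where "coset_pair V = (\<lambda>(u, v). gen [(wdeg u, coset V (gen u)), (wdeg v, coset V (gen v))])"

context connected_commutative_graded_algebra
begin

abbreviation JA where "JA \<equiv> J_alg scale A"

lemma part_J: "part JA n = coset V ` {p. Poly_Mapping.keys p \<subseteq> homs V n}"
proof -
  have "free.span (gen ` {w \<in> words V. wdeg w = n}) = {p :: 'b word \<Rightarrow>\<^sub>0 'a. Poly_Mapping.keys p \<subseteq> homs V n}"
    by (rule set_eqI) (simp add: in_span_gen_iff homs_def)
  then show ?thesis by (simp add: J_alg_def Let_def)
qed

lemma vadd_J: "vadd JA (coset V p) (coset V q) = coset V (p + q)"
  by (simp add: J_alg_def Let_def coset_eq_iff eqv_add rep_coset)

lemma vscale_J: "vscale JA c (coset V p) = coset V (fscale c p)"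
  by (simp add: J_alg_def Let_def coset_eq_iff eqv_fscale rep_coset)

lemma gone_J: "gone JA = coset V (gen [])"
  by (simp add: J_alg_def Let_def pure_def)

lemma gmult_J:
  assumes "Poly_Mapping.keys p \<subseteq> words V" "Poly_Mapping.keys q \<subseteq> words V"
  shows "gmult JA (coset V p) (coset V q) = coset V (qmul p q)"
  using eqv_qmul[OF rep_coset rep_coset assms]
  by (simp add: J_alg_def Let_def coset_eq_iff quasi_shuffle_product_eq_qsh[abs_def])

lemma J_closed:
  "X \<in> part JA n \<Longrightarrow> Y \<in> part JA n \<Longrightarrow> vadd JA X Y \<in> part JA n"
  "X \<in> part JA n \<Longrightarrow> vscale JA c X \<in> part JA n"
  unfolding part_J
  by (clarsimp simp: vadd_J vscale_J; rule imageI, rule CollectI,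
      intro keys_plus_subset keys_fscale_subset; assumption)+

lemma coset_gen_part_J: "w \<in> words V \<Longrightarrow> coset V (gen w) \<in> part JA (wdeg w)"
  unfolding part_J by (auto simp: homs_def)

text \<open>The relations over the quasi-shuffle algebra spread a letter that is the class of a
  combination of words over the classes of these words. Homogeneity of \<open>p\<close> puts all of
  them into the same \<open>part\<close>.\<close>

lemma J_letter_expand:
  assumes "us \<in> words JA" "ws \<in> words JA" "Poly_Mapping.keys p \<subseteq> homs V m"
  shows "eqv JA (gen (us @ (m, coset V p) # ws)) (lin_extend (\<lambda>w. gen (us @ (m, coset V (gen w)) # ws)) p)"
proof -
  note M = multilinear_mod_gen[of JA, unfolded multilinear_mod_def, rule_format, OF assms(1,2)]
  have add: "eqv JA (gen (us @ (m, coset V (p + q)) # ws)) (gen (us @ (m, coset V p) # ws) + gen (us @ (m, coset V q) # ws))"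
    if "Poly_Mapping.keys p \<subseteq> homs V m" "Poly_Mapping.keys q \<subseteq> homs V m" for p q
    using M[of "coset V p" m] that unfolding eqv_def vadd_J[symmetric] by (auto simp: part_J algebra_simps)
  have scale: "eqv JA (gen (us @ (m, coset V (fscale c p)) # ws)) (fscale c (gen (us @ (m, coset V p) # ws)))"
    if "Poly_Mapping.keys p \<subseteq> homs V m" for p c
    using M[of "coset V p" m] that unfolding eqv_def vscale_J[symmetric] by (auto simp: part_J)
  have "p \<in> free.span (gen ` homs V m)" using assms(3) by (simp only: in_span_gen_iff)
  then have "Poly_Mapping.keys p \<subseteq> homs V m \<and>
    eqv JA (gen (us @ (m, coset V p) # ws)) (lin_extend (\<lambda>w. gen (us @ (m, coset V (gen w)) # ws)) p)"
  proof (induction rule: free.span_induct_alt)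
    case base
    show ?case using scale[of 0 0] by simp
  next
    case (step c x y)
    then obtain w where w: "x = gen w" "w \<in> homs V m" by blast
    have 1: "Poly_Mapping.keys (fscale c x) \<subseteq> homs V m"
      by (rule keys_fscale_subset) (use w in simp)
    have 2: "Poly_Mapping.keys y \<subseteq> homs V m"
      using step.IH by blast
    have 3: "Poly_Mapping.keys x \<subseteq> homs V m" using w by simp
    have "eqv JA (gen (us @ (m, coset V (fscale c x + y)) # ws))
        (gen (us @ (m, coset V (fscale c x)) # ws) + gen (us @ (m, coset V y) # ws))"
      by (rule add[OF 1 2])
    also have "eqv JA \<dots> (fscale c (gen (us @ (m, coset V x) # ws)) + lin_extend (\<lambda>w. gen (us @ (m, coset V (gen w)) # ws)) y)"
      by (rule eqv_add[OF scale[OF 3] conjunct2[OF step.IH]])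
    finally show ?case using keys_plus_subset[OF 1 2] by (simp add: w)
  qed
  then show ?thesis by blast
qed

lemma J_pair_expand:
  assumes p: "Poly_Mapping.keys p \<subseteq> homs V m" and q: "Poly_Mapping.keys q \<subseteq> homs V n"
  shows "eqv JA (gen [(m, coset V p), (n, coset V q)]) (lin_extend (coset_pair V) (tens p q))"
proof -
  have "eqv JA (gen ([] @ (m, coset V p) # [(n, coset V q)]))
      (lin_extend (\<lambda>u. gen ([] @ (m, coset V (gen u)) # [(n, coset V q)])) p)"
    by (rule J_letter_expand) (use q p in \<open>auto simp: part_J\<close>)
  also have "eqv JA \<dots> (lin_extend (\<lambda>u. lin_extend (\<lambda>v. gen [(m, coset V (gen u)), (n, coset V (gen v))]) q) p)"
  proof (rule lin_eqvI[where f = "lin_extend (\<lambda>u. gen ([] @ (m, coset V (gen u)) # [(n, coset V q)]))"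
        and g = "lin_extend (\<lambda>u. lin_extend (\<lambda>v. gen [(m, coset V (gen u)), (n, coset V (gen v))]) q)"])
    fix u assume "u \<in> Poly_Mapping.keys p"
    then have u: "u \<in> words V" "wdeg u = m" using p by (auto simp: homs_def)
    show "eqv JA (lin_extend (\<lambda>u. gen ([] @ (m, coset V (gen u)) # [(n, coset V q)])) (gen u))
        (lin_extend (\<lambda>u. lin_extend (\<lambda>v. gen [(m, coset V (gen u)), (n, coset V (gen v))]) q) (gen u))"
      using J_letter_expand[of "[(m, coset V (gen u))]" "[]" q n] q coset_gen_part_J[OF u(1)] u by simp
  qed (intro lin_intros)+
  also have "lin_extend (\<lambda>u. lin_extend (\<lambda>v. gen [(m, coset V (gen u)), (n, coset V (gen v))]) q) p = lin_extend (coset_pair V) (tens p q)"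
  proof (rule bilin_eqI[where g = "\<lambda>p q. lin_extend (coset_pair V) (tens p q)"])
    show "lin (\<lambda>q. lin_extend (\<lambda>u. lin_extend (\<lambda>v. gen [(m, coset V (gen u)), (n, coset V (gen v))]) q) p)" for p
      unfolding lin_extend_def[of _ p] by (intro lin_intros)
    fix u v assume "u \<in> Poly_Mapping.keys p" "v \<in> Poly_Mapping.keys q"
    then show "lin_extend (\<lambda>u. lin_extend (\<lambda>v. gen [(m, coset V (gen u)), (n, coset V (gen v))]) (gen v)) (gen u) =
        lin_extend (coset_pair V) (tens (gen u) (gen v))"
      using p q by (auto simp: homs_def coset_pair_def)
  qed (intro lin_intros)+
  finally show ?thesis by simp
qed

lemma J_comult_eq: "J_comult scale A X = coset JA (lin_extend (coset_pair V) (lin_extend deconc (rep X)))"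
proof -
  have "(\<Sum>i\<le>length w. gen [(wdeg (take i w), pure V (take i w)), (wdeg (drop i w), pure V (drop i w))]) =
      lin_extend (coset_pair V) (deconc w)" for w
    by (simp add: deconc_def lin_extend_sum coset_pair_def pure_def)
  moreover have "lin_extend (\<lambda>w. lin_extend (coset_pair V) (deconc w)) p = lin_extend (coset_pair V) (lin_extend deconc p)" for p
    by (rule lin_eqI[where g = "\<lambda>p. lin_extend (coset_pair V) (lin_extend deconc p)"]) (auto intro!: lin_intros)
  ultimately show ?thesis by (simp add: J_comult_def Let_def)
qed

text \<open>Two levels of relations interact. For each cut the distinguished letter lies in one of
  the two pieces. A relation over \<open>V\<close> rewrites the class of that piece as the class of
  a combination, and \<open>J_pair_expand\<close> then spreads it by the relations over the
  quasi-shuffle algebra.\<close>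

lemma comult_multilinear: "multilinear_mod V (relations JA) (\<lambda>w. lin_extend (coset_pair V) (lin_extend deconc (gen w)))"
proof (rule multilinear_mod_lcombI)
  fix us n c x y ws
  assume *: "us \<in> words V" "ws \<in> words V" "x \<in> part V n" "y \<in> part V n"
  let ?w = "\<lambda>z. us @ (n, z) # ws"
  have z: "scale c x + y \<in> part V n" by (intro V_closed *)
  have "lcomb JA c (\<Sum>i\<le>length us + Suc (length ws). coset_pair V (take i (?w (scale c x + y)), drop i (?w (scale c x + y))))
     (\<Sum>i\<le>length us + Suc (length ws). coset_pair V (take i (?w x), drop i (?w x)))
     (\<Sum>i\<le>length us + Suc (length ws). coset_pair V (take i (?w y), drop i (?w y)))"
  proof (rule lcomb_sum)
    fix i
    define a b where "a = take i us" and "b = drop i us"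
    define a' b' where "a' = take (i - Suc (length us)) ws" and "b' = drop (i - Suc (length us)) ws"
    have words: "a \<in> words V" "b \<in> words V" "a' \<in> words V" "b' \<in> words V"
      using * by (simp_all add: a_def b_def a'_def b'_def)
    show "lcomb JA c (coset_pair V (take i (?w (scale c x + y)), drop i (?w (scale c x + y))))
      (coset_pair V (take i (?w x), drop i (?w x))) (coset_pair V (take i (?w y), drop i (?w y)))"
    proof (cases "i \<le> length us")
      case True
      then have split: "take i (?w z) = a" "drop i (?w z) = b @ (n, z) # ws" for z
        by (simp_all add: a_def b_def)
      let ?d = "wdeg b + (n + wdeg ws)"
      have "eqv V (gen (b @ (n, scale c x + y) # ws)) (fscale c (gen (b @ (n, x) # ws)) + gen (b @ (n, y) # ws))"
        using lcomb_gen[of b ws x n y c] * words by (simp add: lcomb_def)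
      note this[folded coset_eq_iff]
      then have "coset_pair V (a, b @ (n, scale c x + y) # ws) =
          gen [(wdeg a, coset V (gen a)), (?d, coset V (fscale c (gen (b @ (n, x) # ws)) + gen (b @ (n, y) # ws)))]"
        by (simp add: coset_pair_def)
      also have "eqv JA \<dots> (lin_extend (coset_pair V) (tens (gen a) (fscale c (gen (b @ (n, x) # ws)) + gen (b @ (n, y) # ws))))"
      proof (rule J_pair_expand)
        show "Poly_Mapping.keys (fscale c (gen (b @ (n, x) # ws)) + gen (b @ (n, y) # ws)) \<subseteq> homs V ?d"
          by (intro keys_plus_subset keys_fscale_subset) (use * words in \<open>auto simp: homs_def\<close>)
      qed (use words in \<open>auto simp: homs_def\<close>)
      also have "\<dots> = fscale c (coset_pair V (a, b @ (n, x) # ws)) + coset_pair V (a, b @ (n, y) # ws)"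
        by (simp add: tens_simps)
      finally show ?thesis unfolding split lcomb_def .
    next
      case False
      then obtain j where "i = length us + Suc j" by (metis Suc_leI less_natE not_le_imp_less add_Suc_right)
      then have split: "take i (?w z) = us @ (n, z) # a'" "drop i (?w z) = b'" for z
        by (simp_all add: a'_def b'_def)
      let ?d = "wdeg us + (n + wdeg a')"
      have "eqv V (gen (us @ (n, scale c x + y) # a')) (fscale c (gen (us @ (n, x) # a')) + gen (us @ (n, y) # a'))"
        using lcomb_gen[of us a' x n y c] * words by (simp add: lcomb_def)
      note this[folded coset_eq_iff]
      then have "coset_pair V (us @ (n, scale c x + y) # a', b') =
          gen [(?d, coset V (fscale c (gen (us @ (n, x) # a')) + gen (us @ (n, y) # a'))), (wdeg b', coset V (gen b'))]"
        by (simp add: coset_pair_def)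
      also have "eqv JA \<dots> (lin_extend (coset_pair V) (tens (fscale c (gen (us @ (n, x) # a')) + gen (us @ (n, y) # a')) (gen b')))"
      proof (rule J_pair_expand)
        show "Poly_Mapping.keys (fscale c (gen (us @ (n, x) # a')) + gen (us @ (n, y) # a')) \<subseteq> homs V ?d"
          by (intro keys_plus_subset keys_fscale_subset) (use * words in \<open>auto simp: homs_def\<close>)
      qed (use words in \<open>auto simp: homs_def\<close>)
      also have "\<dots> = fscale c (coset_pair V (us @ (n, x) # a', b')) + coset_pair V (us @ (n, y) # a', b')"
        by (simp add: tens_simps)
      finally show ?thesis unfolding split lcomb_def .
    qed
  qed
  then show "lcomb JA c (lin_extend (coset_pair V) (lin_extend deconc (gen (?w (scale c x + y)))))
      (lin_extend (coset_pair V) (lin_extend deconc (gen (?w x)))) (lin_extend (coset_pair V) (lin_extend deconc (gen (?w y))))"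
    by (simp add: deconc_def lin_extend_sum)
qed

lemma J_comult_coset:
  "J_comult scale A (coset V p) = coset JA (lin_extend (coset_pair V) (lin_extend deconc p))"
  unfolding J_comult_eq coset_eq_iff
  by (rule lin_relations_eqv[where f = "\<lambda>p. lin_extend (coset_pair V) (lin_extend deconc p)",
        OF _ comult_multilinear rep_coset]) (intro lin_intros)

end

section \<open>Hopf isomorphisms from graded linear isomorphisms\<close>

text \<open>The composite J(A) -> shuffles on the positive part of A -> shuffles on that of B ->
  J(B). \<open>hlog\<close> multiplies in the first ring type and \<open>hexp\<close> in the
  second.\<close>

definition transport ::
  "(nat \<Rightarrow> 'a::ring_1 \<Rightarrow> 'b::ring_1) \<Rightarrow> ('a word \<Rightarrow>\<^sub>0 'k::field_char_0) \<Rightarrow> ('b word \<Rightarrow>\<^sub>0 'k)" where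
  "transport \<phi> p = lin_extend hexp (lin_extend (word_map \<phi>) (lin_extend hlog p))"

lemma lin_transport: "lin g \<Longrightarrow> lin (\<lambda>p. transport \<phi> (g p))"
  unfolding transport_def by (intro lin_intros)

lemmas lin_transport' = lin_transport[OF lin_id]

lemma deconc_transport:
  fixes p :: "'a::ring_1 word \<Rightarrow>\<^sub>0 'k::field_char_0"
  shows "lin_extend deconc (transport \<phi> p) = tens_map (\<lambda>w. transport \<phi> (gen w)) (lin_extend deconc p)"
proof -
  have "lin_extend deconc (lin_extend (word_map \<phi>) r) = tens_map (word_map \<phi>) (lin_extend deconc r)"
    for r :: "'a word \<Rightarrow>\<^sub>0 'k"
    by (rule lin_eqI[where f = "\<lambda>r. lin_extend deconc (lin_extend (word_map \<phi>) r)"])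
      (auto intro!: lin_intros simp: word_map_deconc)
  then show ?thesis
    by (simp add: transport_def deconc_lin_hexp deconc_lin_hlog tens_map_compose)
qed

context char_0_algebra
begin

abbreviation smul where "smul \<equiv> bilin_extend sh"

lemma hexp_smul:
  assumes "Poly_Mapping.keys p \<subseteq> words V" "Poly_Mapping.keys q \<subseteq> words V"
  shows "eqv V (lin_extend hexp (smul p q)) (qmul (lin_extend hexp p) (lin_extend hexp q) :: 'a word \<Rightarrow>\<^sub>0 'k)"
proof (rule lin_eqvI[where f = "\<lambda>p. lin_extend hexp (smul p q)" and g = "\<lambda>p. qmul (lin_extend hexp p) (lin_extend hexp q)"])
  fix u assume u: "u \<in> Poly_Mapping.keys p"
  show "eqv V (lin_extend hexp (smul (gen u) q)) (qmul (lin_extend hexp (gen u)) (lin_extend hexp q))"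
  proof (rule lin_eqvI[where f = "\<lambda>q. lin_extend hexp (smul (gen u) q)" and g = "\<lambda>q. qmul (lin_extend hexp (gen u)) (lin_extend hexp q)"])
    fix v assume "v \<in> Poly_Mapping.keys q"
    then show "eqv V (lin_extend hexp (smul (gen u) (gen v))) (qmul (lin_extend hexp (gen u)) (lin_extend hexp (gen v)))"
      using u assms hexp_sh[of u v] by auto
  qed (intro lin_intros)+
qed (intro lin_intros)+

lemma keys_lin_homs:
  assumes "lin f" "Poly_Mapping.keys p \<subseteq> homs V n"
    and "\<And>w. w \<in> words V \<Longrightarrow> Poly_Mapping.keys (f (gen w)) \<subseteq> homs W (wdeg w)"
  shows "Poly_Mapping.keys (f p) \<subseteq> homs W n"
proof (rule keys_lin_subset[OF assms(1)])
  fix w assume "w \<in> Poly_Mapping.keys p"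
  then have "w \<in> words V" "wdeg w = n" using assms(2) by (auto simp: homs_def)
  then show "Poly_Mapping.keys (f (gen w)) \<subseteq> homs W n" using assms(3)[of w] by simp
qed

lemma keys_words_of_homs:
  assumes "lin f" "Poly_Mapping.keys p \<subseteq> words V"
    and "\<And>w. w \<in> words V \<Longrightarrow> Poly_Mapping.keys (f (gen w)) \<subseteq> homs W (wdeg w)"
  shows "Poly_Mapping.keys (f p) \<subseteq> words W"
proof (rule keys_lin_subset[OF assms(1)])
  fix w assume "w \<in> Poly_Mapping.keys p"
  then have "w \<in> words V" using assms(2) by blast
  from assms(3)[OF this] show "Poly_Mapping.keys (f (gen w)) \<subseteq> words W"
    by (auto simp: homs_def)
qed

lemma keys_lin_hlog_homs: "w \<in> words V \<Longrightarrow> Poly_Mapping.keys (lin_extend hlog (gen w) :: 'a word \<Rightarrow>\<^sub>0 'k) \<subseteq> homs V (wdeg w)"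
  and keys_lin_hexp_homs: "w \<in> words V \<Longrightarrow> Poly_Mapping.keys (lin_extend hexp (gen w) :: 'a word \<Rightarrow>\<^sub>0 'k) \<subseteq> homs V (wdeg w)"
  by (simp_all add: keys_hlog keys_hexp)

lemmas keys_lin_hlog_words = keys_words_of_homs[OF lin_lin_extend _ keys_lin_hlog_homs]

end

lemma word_map_smul:
  "lin_extend (word_map \<phi>) (bilin_extend sh p q) =
     bilin_extend sh (lin_extend (word_map \<phi>) p) (lin_extend (word_map \<phi>) q)"
  by (rule bilin_eqI[where f = "\<lambda>p q. lin_extend (word_map \<phi>) (bilin_extend sh p q)" and
        g = "\<lambda>p q. bilin_extend sh (lin_extend (word_map \<phi>) p) (lin_extend (word_map \<phi>) q)"])
    (intro lin_intros | simp add: word_map_sh)+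

locale positive_iso = A: char_0_algebra scaleA A + B: char_0_algebra scaleB B
  for scaleA :: "'k::field_char_0 \<Rightarrow> 'a::ring_1 \<Rightarrow> 'a" and A
    and scaleB :: "'k \<Rightarrow> 'b::ring_1 \<Rightarrow> 'b" and B +
  fixes \<phi> :: "nat \<Rightarrow> 'a \<Rightarrow> 'b"
  assumes iso: "graded_space_iso A.V B.V \<phi>"
begin

lemma \<phi>_part: "x \<in> part A.V n \<Longrightarrow> \<phi> n x \<in> part B.V n"
  using iso unfolding graded_space_iso_def bij_betw_def by blast

lemma map_word_\<phi>: "w \<in> words A.V \<Longrightarrow> map_word \<phi> w \<in> words B.V"
  by (induction w) (auto intro: \<phi>_part)

lemma keys_word_map:
  "w \<in> words A.V \<Longrightarrow> Poly_Mapping.keys (lin_extend (word_map \<phi>) (gen w) :: 'b word \<Rightarrow>\<^sub>0 'k) \<subseteq> homs B.V (wdeg w)"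
  by (simp add: map_word_\<phi> homs_def)

lemma keys_transport:
  assumes "Poly_Mapping.keys p \<subseteq> homs A.V n"
  shows "Poly_Mapping.keys (transport \<phi> p :: 'b word \<Rightarrow>\<^sub>0 'k) \<subseteq> homs B.V n"
proof -
  have "Poly_Mapping.keys (lin_extend hlog p) \<subseteq> homs A.V n"
    by (rule A.keys_lin_homs[OF lin_lin_extend assms A.keys_lin_hlog_homs])
  then have "Poly_Mapping.keys (lin_extend (word_map \<phi>) (lin_extend hlog p)) \<subseteq> homs B.V n"
    by (rule A.keys_lin_homs[OF lin_lin_extend _ keys_word_map])
  then show ?thesis
    unfolding transport_def by (rule B.keys_lin_homs[OF lin_lin_extend _ B.keys_lin_hexp_homs])
qed

lemma keys_transport_words:
  assumes "Poly_Mapping.keys p \<subseteq> words A.V"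
  shows "Poly_Mapping.keys (transport \<phi> p :: 'b word \<Rightarrow>\<^sub>0 'k) \<subseteq> words B.V"
  by (rule A.keys_words_of_homs[OF lin_transport' assms]) (rule keys_transport, simp add: homs_def)

lemma eqv_transport: "eqv A.V p q \<Longrightarrow> eqv B.V (transport \<phi> p) (transport \<phi> q)"
  unfolding transport_def
  by (intro B.eqv_hexp lin_relations_eqv[where f = "lin_extend (word_map \<phi>)" and V = A.V]
      lin_lin_extend A.eqv_hlog) (simp_all add: word_map_multilinear[OF iso])

text \<open>Multiplicativity of the exponential at \<open>hlog p\<close> and \<open>hlog q\<close>,
  read backwards, turns the product into a shuffle product, which letterwise maps respect exactly.
  Read forwards over \<open>B\<close>, it turns the result back.\<close>

lemma transport_qmul:
  assumes "Poly_Mapping.keys p \<subseteq> words A.V" "Poly_Mapping.keys q \<subseteq> words A.V"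
  shows "eqv B.V (transport \<phi> (qmul p q)) (qmul (transport \<phi> p) (transport \<phi> q))"
proof -
  let ?p = "lin_extend hlog p" and ?q = "lin_extend hlog q"
  let ?M = "lin_extend (word_map \<phi>) :: _ \<Rightarrow> 'b word \<Rightarrow>\<^sub>0 'k"
  have keys: "Poly_Mapping.keys ?p \<subseteq> words A.V" "Poly_Mapping.keys ?q \<subseteq> words A.V"
    using A.keys_lin_hlog_words assms by blast+
  have keys': "Poly_Mapping.keys (?M ?p) \<subseteq> words B.V" "Poly_Mapping.keys (?M ?q) \<subseteq> words B.V"
    using A.keys_words_of_homs[OF lin_lin_extend _ keys_word_map] keys by blast+
  have "eqv A.V (qmul p q) (lin_extend hexp (bilin_extend sh ?p ?q))"
    using eqv_sym[OF A.hexp_smul[OF keys]] by (simp add: hexp.f_inverse)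
  from eqv_transport[OF this]
  have "eqv B.V (transport \<phi> (qmul p q)) (lin_extend hexp (bilin_extend sh (?M ?p) (?M ?q)))"
    by (simp add: transport_def hexp.f_inverse' word_map_smul)
  also have "eqv B.V \<dots> (qmul (lin_extend hexp (?M ?p)) (lin_extend hexp (?M ?q)))"
    by (rule B.hexp_smul[OF keys'])
  finally show ?thesis by (simp add: transport_def)
qed

lemma transport_Nil: "transport \<phi> (gen []) = gen []"
  by (simp add: transport_def hexp.inv_word_def)

lemma transport_coset:
  "coset B.V (transport \<phi> (rep (coset A.V p))) = coset B.V (transport \<phi> p)"
  unfolding coset_eq_iff by (rule eqv_transport[OF rep_coset])

abbreviation JA where "JA \<equiv> J_alg scaleA A"
abbreviation JB where "JB \<equiv> J_alg scaleB B"

definition \<Phi> :: "nat \<Rightarrow> ('k, 'a) tensor \<Rightarrow> ('k, 'b) tensor" where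
  "\<Phi> n X = coset B.V (transport \<phi> (rep X))"

lemma \<Phi>_coset: "\<Phi> n (coset A.V p) = coset B.V (transport \<phi> p)"
  by (simp add: \<Phi>_def transport_coset)

lemma \<Phi>_part: "X \<in> part JA n \<Longrightarrow> \<Phi> n X \<in> part JB n"
  unfolding A.part_J B.part_J by (auto simp: \<Phi>_coset intro!: imageI keys_transport simp del: in_keys_iff)

lemma \<Phi>_coset_pair:
  assumes "u \<in> words A.V" "v \<in> words A.V"
  shows "eqv JB (lin_extend (word_map \<Phi>) (coset_pair A.V (u, v)))
    (lin_extend (coset_pair B.V) (tens (transport \<phi> (gen u)) (transport \<phi> (gen v))))"
proof -
  have "eqv JB (gen [(wdeg u, coset B.V (transport \<phi> (gen u))), (wdeg v, coset B.V (transport \<phi> (gen v)))])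
      (lin_extend (coset_pair B.V) (tens (transport \<phi> (gen u)) (transport \<phi> (gen v))))"
    by (intro B.J_pair_expand keys_transport) (use assms in \<open>simp_all add: homs_def\<close>)
  then show ?thesis by (simp add: coset_pair_def \<Phi>_coset)
qed

end

section \<open>Preservation of the counit\<close>

lemma lookup_Nil_lin_extend:
  assumes "\<And>w. Poly_Mapping.lookup (f w) [] = Poly_Mapping.lookup (gen w :: 'x list \<Rightarrow>\<^sub>0 'k::field) []"
  shows "Poly_Mapping.lookup (lin_extend f p) [] = Poly_Mapping.lookup p []"
proof -
  have "Poly_Mapping.lookup (lin_extend f p) [] = Poly_Mapping.lookup (lin_extend gen p) []"
    unfolding lin_extend_def lookup_sum lookup_fscale assms ..
  then show ?thesis by (simp add: poly_mapping_eq_lin_extend_gen)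
qed

lemma lookup_Nil_hexp:
  fixes p :: "'a::ring_1 word \<Rightarrow>\<^sub>0 'k::field_char_0"
  shows "Poly_Mapping.lookup (lin_extend hexp p) [] = Poly_Mapping.lookup p []"
proof (rule lookup_Nil_lin_extend)
  fix w
  have "Poly_Mapping.lookup (prep x q) [] = 0" for x and q :: "'a word \<Rightarrow>\<^sub>0 'k"
    using keys_prep[of x q] by (auto simp: in_keys_iff)
  then show "Poly_Mapping.lookup (hexp w :: 'a word \<Rightarrow>\<^sub>0 'k) [] = Poly_Mapping.lookup (gen w :: 'a word \<Rightarrow>\<^sub>0 'k) []"
    by (cases "w = []") (simp_all add: hexp_nonempty lookup_sum lookup_single)
qed

lemma lookup_Nil_hlog: "Poly_Mapping.lookup (lin_extend hlog p) [] = Poly_Mapping.lookup p []"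
  using lookup_Nil_hexp[of "lin_extend hlog p"] by (simp add: hexp.f_inverse)

lemma lookup_Nil_transport:
  fixes p :: "'a::ring_1 word \<Rightarrow>\<^sub>0 'k::field_char_0"
  shows "Poly_Mapping.lookup (transport \<phi> p) [] = Poly_Mapping.lookup p []"
proof -
  have "Poly_Mapping.lookup (lin_extend (word_map \<phi>) q) [] = Poly_Mapping.lookup q []" for q :: "'a word \<Rightarrow>\<^sub>0 'k"
  proof -
    have "map_word \<phi> w = [] \<longleftrightarrow> w = []" for w by (cases w) auto
    then have "Poly_Mapping.lookup (word_map \<phi> w) [] = Poly_Mapping.lookup (gen w :: 'a word \<Rightarrow>\<^sub>0 'k) []" for w
      by (simp add: lookup_single when_def)
    then have "Poly_Mapping.lookup (lin_extend (word_map \<phi>) q) [] = Poly_Mapping.lookup (lin_extend gen q) []"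
      unfolding lin_extend_def lookup_sum lookup_fscale by simp
    then show ?thesis by (simp add: poly_mapping_eq_lin_extend_gen)
  qed
  then show ?thesis by (simp add: transport_def lookup_Nil_hexp lookup_Nil_hlog)
qed

text \<open>The inner \<open>hlog\<close> and \<open>hexp\<close> cancel. The set \<open>S\<close>
  is there because letterwise maps invert each other only on words with letters in the graded
  space.\<close>

lemma transport_inverse:
  assumes "\<And>w. w \<in> S \<Longrightarrow> map_word \<psi> (map_word \<phi> w) = w" "Poly_Mapping.keys (lin_extend hlog p) \<subseteq> S"
  shows "transport \<psi> (transport \<phi> p) = p"
proof -
  have "lin_extend (word_map \<psi>) (lin_extend (word_map \<phi>) (lin_extend hlog p)) = lin_extend hlog p"
    by (rule lin_eqI[where f = "\<lambda>r. lin_extend (word_map \<psi>) (lin_extend (word_map \<phi>) r)" and g = "\<lambda>r. r"])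
      (use assms in \<open>auto intro!: lin_intros lin_id\<close>)
  then show ?thesis
    by (simp add: transport_def hexp.f_inverse hexp.f_inverse')
qed

section \<open>The induced map is an isomorphism of Hopf algebras\<close>

context positive_iso
begin

abbreviation \<psi> where "\<psi> \<equiv> \<lambda>n. inv_into (part A.V n) (\<phi> n)"

lemma inverse_iso: "positive_iso scaleB B scaleA A \<psi>"
  by unfold_locales (rule graded_space_iso_inverse[OF iso]; simp add: A.V_closed)

lemma \<psi>_\<phi>: "x \<in> part A.V n \<Longrightarrow> \<psi> n (\<phi> n x) = x"
  using iso by (simp add: graded_space_iso_def bij_betw_def)

lemma \<phi>_\<psi>: "y \<in> part B.V n \<Longrightarrow> \<phi> n (\<psi> n y) = y"
  using iso unfolding graded_space_iso_def bij_betw_def by (metis f_inv_into_f)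

lemma map_word_\<psi>_\<phi>: "w \<in> words A.V \<Longrightarrow> map_word \<psi> (map_word \<phi> w) = w"
  by (induction w) (simp_all add: \<psi>_\<phi>)

lemma map_word_\<phi>_\<psi>: "w \<in> words B.V \<Longrightarrow> map_word \<phi> (map_word \<psi> w) = w"
  by (induction w) (simp_all add: \<phi>_\<psi>)

lemma \<Phi>_space_iso: "graded_space_iso JA JB \<Phi>"
  unfolding graded_space_iso_def
proof (intro allI conjI ballI)
  \<comment> \<open>The inverse of \<open>\<Phi>\<close> is the same construction for the inverse of
    \<open>\<phi>\<close>.\<close>
  interpret inverse: positive_iso scaleB B scaleA A \<psi> by (rule inverse_iso)
  fix n
  show "bij_betw (\<Phi> n) (part JA n) (part JB n)"
  proof (rule bij_betw_byWitness[where f' = "inverse.\<Phi> n"])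
    show "\<forall>X\<in>part JA n. inverse.\<Phi> n (\<Phi> n X) = X"
    proof
      fix X assume "X \<in> part JA n"
      then obtain p where p: "X = coset A.V p" "Poly_Mapping.keys p \<subseteq> homs A.V n"
        by (auto simp: A.part_J)
      have "Poly_Mapping.keys p \<subseteq> words A.V" using p(2) by (auto simp: homs_def)
      from transport_inverse[OF map_word_\<psi>_\<phi> A.keys_lin_hlog_words[OF this]]
      show "inverse.\<Phi> n (\<Phi> n X) = X" by (simp add: p(1) \<Phi>_coset inverse.\<Phi>_coset)
    qed
    show "\<forall>X\<in>part JB n. \<Phi> n (inverse.\<Phi> n X) = X"
    proof
      fix X assume "X \<in> part JB n"
      then obtain p where p: "X = coset B.V p" "Poly_Mapping.keys p \<subseteq> homs B.V n"
        by (auto simp: B.part_J)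
      have "Poly_Mapping.keys p \<subseteq> words B.V" using p(2) by (auto simp: homs_def)
      from transport_inverse[OF map_word_\<phi>_\<psi> B.keys_lin_hlog_words[OF this]]
      show "\<Phi> n (inverse.\<Phi> n X) = X" by (simp add: p(1) \<Phi>_coset inverse.\<Phi>_coset)
    qed
  qed (auto intro: \<Phi>_part inverse.\<Phi>_part)
  fix X c assume "X \<in> part JA n"
  then obtain p where X: "X = coset A.V p" by (auto simp: A.part_J)
  show "\<Phi> n (vscale JA c X) = vscale JB c (\<Phi> n X)"
    by (simp add: X A.vscale_J B.vscale_J \<Phi>_coset lin_scale[OF lin_transport'])
  fix Y assume "Y \<in> part JA n"
  then obtain q where Y: "Y = coset A.V q" by (auto simp: A.part_J)
  show "\<Phi> n (vadd JA X Y) = vadd JB (\<Phi> n X) (\<Phi> n Y)"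
    by (simp add: X Y A.vadd_J B.vadd_J \<Phi>_coset lin_add[OF lin_transport'])
qed

lemma keys_deconc:
  assumes "Poly_Mapping.keys p \<subseteq> words A.V"
  shows "Poly_Mapping.keys (lin_extend deconc p) \<subseteq> words A.V \<times> words A.V"
proof (rule keys_lin_subset[OF lin_lin_extend])
  fix w assume "w \<in> Poly_Mapping.keys p"
  then have "w \<in> words A.V" using assms by blast
  then show "Poly_Mapping.keys (lin_extend deconc (gen w)) \<subseteq> words A.V \<times> words A.V"
    unfolding lin_extend_gen deconc_def by (intro keys_sum_subset) simp
qed

text \<open>\<open>tensor_map\<close> evaluates an arbitrary representative over the quasi-shuffle
  algebra. To replace it by the combination at hand, \<open>\<Phi>\<close> itself must respect
  multilinearity, which is why \<open>\<Phi>_space_iso\<close> comes before this lemma.\<close>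

lemma \<Phi>_comult:
  assumes "Poly_Mapping.keys p \<subseteq> words A.V"
  shows "J_comult scaleB B (coset B.V (transport \<phi> p)) = tensor_map JB \<Phi> (J_comult scaleA A (coset A.V p))"
proof -
  let ?d = "lin_extend (coset_pair A.V) (lin_extend deconc p)"
  have "eqv JB (lin_extend (word_map \<Phi>) (rep (coset JA ?d))) (lin_extend (word_map \<Phi>) ?d)"
    by (rule lin_relations_eqv[OF lin_lin_extend _ rep_coset])
      (simp add: word_map_multilinear[OF \<Phi>_space_iso])
  also have "eqv JB (lin_extend (word_map \<Phi>) ?d)
      (lin_extend (coset_pair B.V) (tens_map (\<lambda>w. transport \<phi> (gen w)) (lin_extend deconc p)))"
  proof (rule lin_eqvI[where f = "\<lambda>r. lin_extend (word_map \<Phi>) (lin_extend (coset_pair A.V) r)" and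
        g = "\<lambda>r. lin_extend (coset_pair B.V) (tens_map (\<lambda>w. transport \<phi> (gen w)) r)"])
    fix x assume "x \<in> Poly_Mapping.keys (lin_extend deconc p)"
    then obtain u v where "x = (u, v)" "u \<in> words A.V" "v \<in> words A.V" using keys_deconc[OF assms] by blast
    then show "eqv JB (lin_extend (word_map \<Phi>) (lin_extend (coset_pair A.V) (gen x)))
        (lin_extend (coset_pair B.V) (tens_map (\<lambda>w. transport \<phi> (gen w)) (gen x)))"
      using \<Phi>_coset_pair by simp
  qed (intro lin_intros)+
  finally show ?thesis
    by (simp add: A.J_comult_coset B.J_comult_coset tensor_map_def coset_eq_iff deconc_transport
        map_word_def[symmetric] eqv_sym)
qed

theorem \<Phi>_hopf_iso: "graded_hopf_iso (J scaleA A) (J scaleB B) \<Phi>"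
  unfolding graded_hopf_iso_def graded_alg_iso_def
proof (intro conjI allI ballI)
  show "graded_space_iso (J scaleA A) (J scaleB B) \<Phi>"
    using \<Phi>_space_iso by (simp add: graded_space_iso_def)
  show "\<Phi> 0 (gone (J scaleA A)) = gone (J scaleB B)"
    by (simp add: A.gone_J B.gone_J \<Phi>_coset transport_Nil)
next
  fix m n X Y assume "X \<in> part (J scaleA A) m" "Y \<in> part (J scaleA A) n"
  then obtain p q where X: "X = coset A.V p" "Poly_Mapping.keys p \<subseteq> homs A.V m"
    and Y: "Y = coset A.V q" "Poly_Mapping.keys q \<subseteq> homs A.V n"
    by (auto simp: A.part_J)
  then have keys: "Poly_Mapping.keys p \<subseteq> words A.V" "Poly_Mapping.keys q \<subseteq> words A.V"
    by (auto simp: homs_def)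
  show "\<Phi> (m + n) (gmult (J scaleA A) X Y) = gmult (J scaleB B) (\<Phi> m X) (\<Phi> n Y)"
    using transport_qmul[OF keys]
    by (simp add: X Y \<Phi>_coset A.gmult_J[OF keys] B.gmult_J keys keys_transport_words coset_eq_iff)
next
  fix n X assume "X \<in> part (J scaleA A) n"
  then obtain p where X: "X = coset A.V p" "Poly_Mapping.keys p \<subseteq> homs A.V n"
    by (auto simp: A.part_J)
  then have "Poly_Mapping.keys p \<subseteq> words A.V" by (auto simp: homs_def)
  from \<Phi>_comult[OF this]
  show "comult (J scaleB B) (\<Phi> n X) = tensor_map (J scaleB B) \<Phi> (comult (J scaleA A) X)"
    by (simp add: X \<Phi>_coset tensor_map_def)
  show "counit (J scaleB B) (\<Phi> n X) = counit (J scaleA A) X"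
    by (simp add: \<Phi>_def lookup_Nil_eqv[OF rep_coset] lookup_Nil_transport)
qed

end

section \<open>Counting words in a graded basis\<close>

definition basis_words :: "(nat \<Rightarrow> 'v set) \<Rightarrow> nat \<Rightarrow> 'v word set" where
  "basis_words X n = {w. (\<forall>(m, b)\<in>set w. b \<in> X m) \<and> wdeg w = n}"

lemma basis_words_Nil [simp]: "[] \<in> basis_words X n \<longleftrightarrow> n = 0"
  and basis_words_Cons: "x # w \<in> basis_words X n \<longleftrightarrow> snd x \<in> X (fst x) \<and> fst x \<le> n \<and> w \<in> basis_words X (n - fst x)"
  by (auto simp: basis_words_def split: prod.splits)

text \<open>The condition \<open>length w \<noteq> 1\<close> makes these the exact complement of the
  single letters; the empty word has degree \<open>0\<close> and is absent for
  \<open>n > 0\<close>.\<close>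

definition long_words :: "(nat \<Rightarrow> 'v set) \<Rightarrow> nat \<Rightarrow> 'v word set" where
  "long_words X n = {w \<in> basis_words X n. length w \<noteq> 1}"

locale graded_set =
  fixes X :: "nat \<Rightarrow> 'v set"
  assumes finite_X: "finite (X n)" and X_0: "X 0 = {}"
begin

text \<open>No letter has degree \<open>0\<close>. This bounds the lengths of words of a given
  degree and makes their number finite.\<close>

lemma length_le_wdeg: "\<forall>(m, b)\<in>set w. b \<in> X m \<Longrightarrow> length w \<le> wdeg w"
proof (induction w)
  case (Cons x w)
  have "fst x \<noteq> 0"
  proof
    assume "fst x = 0"
    with Cons.prems X_0 show False by (cases x) auto
  qed
  with Cons show ?case by auto
qed simp

lemma finite_basis_words: "finite (basis_words X n)"
proof (rule finite_subset)
  show "basis_words X n \<subseteq> {w. set w \<subseteq> (SIGMA m:{..n}. X m) \<and> length w \<le> n}"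
  proof clarify
    fix w assume w: "w \<in> basis_words X n"
    have "m \<le> n" if "(m, b) \<in> set w" for m b
      using member_le_sum_list[of m "map fst w"] that w by (force simp: basis_words_def wdeg_def)
    then show "set w \<subseteq> (SIGMA m:{..n}. X m) \<and> length w \<le> n"
      using w length_le_wdeg[of w] by (auto simp: basis_words_def)
  qed
  show "finite {w. set w \<subseteq> (SIGMA m:{..n}. X m) \<and> length w \<le> n}"
    by (intro finite_lists_length_le finite_SigmaI finite_X) auto
qed

lemma finite_long_words: "finite (long_words X n)"
  by (rule finite_subset[OF _ finite_basis_words[of n]]) (auto simp: long_words_def)

lemma card_basis_words:
  assumes "n > 0" shows "card (basis_words X n) = card (X n) + card (long_words X n)"
proof -
  have "basis_words X n = (\<lambda>b. [(n, b)]) ` X n \<union> long_words X n"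
  proof (intro equalityI subsetI)
    fix w assume "w \<in> basis_words X n"
    then show "w \<in> (\<lambda>b. [(n, b)]) ` X n \<union> long_words X n"
      by (cases "length w = 1") (auto simp: long_words_def length_Suc_conv basis_words_def)
  qed (auto simp: long_words_def basis_words_def)
  moreover have "(\<lambda>b. [(n, b)]) ` X n \<inter> long_words X n = {}"
    by (auto simp: long_words_def)
  moreover have "card ((\<lambda>b. [(n, b)]) ` X n) = card (X n)"
    by (rule card_image) (auto simp: inj_on_def)
  ultimately show ?thesis
    using finite_X finite_long_words by (simp add: card_Un_disjoint)
qed

text \<open>Besides \<open>x\<close> the word has a further letter, which takes up positive
  degree.\<close>

lemma long_words_letter:
  assumes "w \<in> long_words X n" "x \<in> set w" "n > 0" shows "fst x < n" "snd x \<in> X (fst x)"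
proof -
  have w: "\<forall>(m, b)\<in>set w. b \<in> X m" "wdeg w = n" "length w \<noteq> 1"
    using assms(1) by (auto simp: long_words_def basis_words_def)
  obtain us ws where split: "w = us @ x # ws" using assms(2) by (meson split_list)
  have "length us \<le> wdeg us" "length ws \<le> wdeg ws"
    using w(1) split by (auto intro!: length_le_wdeg)
  moreover have "length us + length ws > 0" using w(3) split by simp
  moreover have "wdeg us + fst x + wdeg ws = n" using w(2) split by simp
  ultimately show "fst x < n" by linarith
  show "snd x \<in> X (fst x)" using w(1) assms(2) by (cases x) auto
qed

end

text \<open>Bijections in the degrees below \<open>n\<close>, applied letterwise, embed the long
  words over \<open>X\<close> into those over \<open>Y\<close>. The reverse inequality follows by
  exchanging \<open>X\<close> and \<open>Y\<close>.\<close>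

lemma card_long_words_le:
  assumes "graded_set X" "graded_set Y" and eq: "\<And>k. k < n \<Longrightarrow> card (X k) = card (Y k)" and "n > 0"
  shows "card (long_words X n) \<le> card (long_words Y n)"
proof -
  interpret X: graded_set X by fact
  interpret Y: graded_set Y by fact
  have "\<exists>f. bij_betw f (X k) (Y k)" if "k < n" for k
    using finite_same_card_bij[OF X.finite_X Y.finite_X eq[OF that]] .
  then obtain f where f: "\<And>k. k < n \<Longrightarrow> bij_betw (f k) (X k) (Y k)" by metis
  show ?thesis
  proof (rule card_inj_on_le[OF _ _ Y.finite_long_words])
    show "inj_on (map_word f) (long_words X n)"
      unfolding map_word_def
    proof (intro inj_on_mapI inj_onI)
      fix x y assume xy: "x \<in> \<Union> (set ` long_words X n)" "y \<in> \<Union> (set ` long_words X n)"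
        "(case x of (m, v) \<Rightarrow> (m, f m v)) = (case y of (m, v) \<Rightarrow> (m, f m v))"
      then have "fst x < n" "snd x \<in> X (fst x)" "snd y \<in> X (fst y)"
        using X.long_words_letter[OF _ _ \<open>n > 0\<close>] by blast+
      with xy(3) f[of "fst x"] show "x = y"
        by (auto simp: bij_betw_def inj_on_def split: prod.splits)
    qed
    show "map_word f ` long_words X n \<subseteq> long_words Y n"
    proof clarify
      fix w assume w: "w \<in> long_words X n"
      have "f (fst x) (snd x) \<in> Y (fst x)" if "x \<in> set w" for x
        using X.long_words_letter[OF w that \<open>n > 0\<close>] f[of "fst x"] by (auto simp: bij_betw_def)
      then have "\<forall>(m, b)\<in>set (map_word f w). b \<in> Y m" by (force simp: map_word_def)
      with w show "map_word f w \<in> long_words Y n"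
        by (simp add: long_words_def basis_words_def)
    qed
  qed
qed

lemma card_eq_of_card_basis_words_eq:
  assumes "graded_set X" "graded_set Y" and eq: "\<And>n. card (basis_words X n) = card (basis_words Y n)"
  shows "card (X n) = card (Y n)"
proof (induction n rule: less_induct)
  case (less n)
  show ?case
  proof (cases "n = 0")
    case True
    with assms(1,2) show ?thesis by (simp add: graded_set_def)
  next
    case False
    then have "card (long_words X n) = card (long_words Y n)"
      using card_long_words_le[OF assms(1,2), of n] card_long_words_le[OF assms(2,1), of n] less
      by (intro antisym) auto
    with eq[of n] False show ?thesis
      using graded_set.card_basis_words[OF assms(1), of n] graded_set.card_basis_words[OF assms(2), of n]
      by simp
  qed
qed


section \<open>Words in a basis are a basis of the tensor powers\<close>

lemma card_gen_image: "card (gen ` S :: ('x \<Rightarrow>\<^sub>0 'k::field) set) = card S"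
proof (rule card_image, rule inj_onI)
  fix x y assume "(gen x :: 'x \<Rightarrow>\<^sub>0 'k) = gen y"
  then have "Poly_Mapping.keys (gen x :: 'x \<Rightarrow>\<^sub>0 'k) = Poly_Mapping.keys (gen y :: 'x \<Rightarrow>\<^sub>0 'k)" by simp
  then show "x = y" by simp
qed

lemma independent_gen: "\<not> free.dependent (gen ` S :: ('x \<Rightarrow>\<^sub>0 'k::field) set)"
proof
  assume "free.dependent (gen ` S :: ('x \<Rightarrow>\<^sub>0 'k) set)"
  then obtain w where w: "(gen w :: 'x \<Rightarrow>\<^sub>0 'k) \<in> free.span (gen ` S - {gen w})"
    by (auto simp: free.dependent_def)
  have "gen ` S - {gen w :: 'x \<Rightarrow>\<^sub>0 'k} \<subseteq> gen ` (S - {w})" by auto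
  with w have "(gen w :: 'x \<Rightarrow>\<^sub>0 'k) \<in> free.span (gen ` (S - {w}))"
    using free.span_mono by blast
  then show False by (simp add: in_span_gen_iff)
qed

context connected_commutative_graded_algebra
begin

definition bas :: "nat \<Rightarrow> 'b set" where
  "bas n = (SOME b. b \<subseteq> part V n \<and> independent b \<and> part V n \<subseteq> span b)"

lemma bas: "bas n \<subseteq> part V n" "independent (bas n)" "part V n \<subseteq> span (bas n)"
proof -
  have "\<exists>b. b \<subseteq> part V n \<and> independent b \<and> part V n \<subseteq> span b"
    using basis_exists[of "part V n"] by metis
  from someI_ex[OF this] show "bas n \<subseteq> part V n" "independent (bas n)" "part V n \<subseteq> span (bas n)"
    by (simp_all add: bas_def)
qed

lemma span_bas: "span (bas n) = part V n"
  using bas[of n] span_minimal[OF _ subspace_V] by blast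

lemma finite_bas: "finite (bas n)"
proof -
  obtain S where S: "finite S" "A n = span S" using finite_type by blast
  then have "bas n \<subseteq> span S" using bas(1)[of n] part_V_subset by blast
  then show ?thesis using independent_span_bound[OF S(1) bas(2)] by blast
qed

lemma graded_set_bas: "graded_set bas"
proof
  have "bas 0 \<subseteq> {0}" using bas(1)[of 0] by (simp add: part_V)
  moreover have "0 \<notin> bas 0" using bas(2)[of 0] dependent_zero by blast
  ultimately show "bas 0 = {}" by auto
qed (rule finite_bas)

lemma basis_words_bas: "basis_words bas n \<subseteq> homs V n"
  using bas(1) by (fastforce simp: basis_words_def homs_def words_def)

text \<open>Coordinates of a pure tensor in the words over the basis. It shows these words
  independent modulo the relations, as it kills the relations and fixes every basis word; it shows
  that they span, as its value is congruent to its argument.\<close>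

fun expand :: "'b word \<Rightarrow> ('b word \<Rightarrow>\<^sub>0 'a)" where
  "expand [] = gen []"
| "expand (x # w) = (\<Sum>b\<in>bas (fst x). fscale (representation (bas (fst x)) (snd x) b) (prep (fst x, b) (expand w)))"

lemma expand_multilinear: "multilinear_mod V {0} expand"
proof (rule multilinear_modI)
  show "free.subspace {0}" by (auto simp: free.subspace_def)
  fix us n c x y ws assume *: "us \<in> words V" "ws \<in> words V" "x \<in> part V n" "y \<in> part V n"
  have xy: "x \<in> span (bas n)" "y \<in> span (bas n)" using * bas(3) by blast+
  have "expand (us @ (n, scale c x + y) # ws) = fscale c (expand (us @ (n, x) # ws)) + expand (us @ (n, y) # ws)"
  proof (induction us)
    case Nil
    then show ?case using xy
      by (simp add: representation_add representation_scale bas(2) span_scale free.scale_left_distrib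
          sum.distrib free.scale_sum_right)
  next
    case (Cons a us)
    then show ?case
      by (simp add: free.scale_right_distrib sum.distrib free.scale_sum_right mult.commute)
  qed
  then show "expand (us @ (n, scale c x + y) # ws) - (fscale c (expand (us @ (n, x) # ws)) + expand (us @ (n, y) # ws)) \<in> {0}"
    by simp
qed

lemma expand_relations: "eqv V p q \<Longrightarrow> lin_extend expand p = lin_extend expand q"
  using lin_relations_subspace[OF lin_lin_extend _ _, of "{0}" V expand "p - q"] expand_multilinear
  by (simp add: eqv_def free.subspace_def)

lemma letter_sum:
  assumes "finite S" "S \<subseteq> part V n" "Poly_Mapping.keys q \<subseteq> words V"
  shows "eqv V (prep (n, \<Sum>b\<in>S. scale (r b) b) q) (\<Sum>b\<in>S. fscale (r b) (prep (n, b) q))"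
  using assms(1,2)
proof (induction S rule: finite_induct)
  case empty
  show ?case using eqv_letter_scale[OF V_closed(1) assms(3), of n 0] by simp
next
  case (insert b S)
  have "(\<Sum>b\<in>S. scale (r b) b) \<in> part V n"
    using insert.prems by (intro subspace_sum[OF subspace_V] V_closed) auto
  then have "eqv V (prep (n, scale (r b) b + (\<Sum>b\<in>S. scale (r b) b)) q)
      (fscale (r b) (prep (n, b) q) + prep (n, \<Sum>b\<in>S. scale (r b) b) q)"
    using lcomb_letter[of b n _ q] insert.prems assms(3) by (simp add: lcomb_def)
  also have "eqv V \<dots> (fscale (r b) (prep (n, b) q) + (\<Sum>b\<in>S. fscale (r b) (prep (n, b) q)))"
    using insert by (intro eqv_add) auto
  finally show ?case using insert by simp
qed

lemma eqv_expand_word: "w \<in> words V \<Longrightarrow> eqv V (expand w) (gen w)"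
proof (induction w)
  case (Cons x w)
  let ?n = "fst x" and ?r = "representation (bas (fst x)) (snd x)"
  have "eqv V (expand (x # w)) (\<Sum>b\<in>bas ?n. fscale (?r b) (prep (?n, b) (gen w)))"
    unfolding expand.simps
    by (intro eqv_sum eqv_fscale eqv_prep) (use Cons bas(1) in auto)
  also have "eqv V \<dots> (prep (?n, \<Sum>b\<in>bas ?n. scale (?r b) b) (gen w))"
    using Cons by (intro eqv_sym[OF letter_sum] finite_bas bas(1)) auto
  also have "(\<Sum>b\<in>bas ?n. scale (?r b) b) = snd x"
    using Cons bas(3)[of ?n] by (intro sum_representation_eq bas(2) finite_bas) auto
  finally show ?case by simp
qed simp

lemma eqv_expand: "Poly_Mapping.keys p \<subseteq> words V \<Longrightarrow> eqv V (lin_extend expand p) p"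
  by (rule lin_eqvI[where g = "\<lambda>p. p"]) (auto intro!: lin_intros lin_id eqv_expand_word)

lemma keys_expand: "w \<in> words V \<Longrightarrow> Poly_Mapping.keys (expand w) \<subseteq> basis_words bas (wdeg w)"
proof (induction w)
  case (Cons x w)
  have "Poly_Mapping.keys (prep (fst x, b) (expand w)) \<subseteq> basis_words bas (wdeg (x # w))" if "b \<in> bas (fst x)" for b
    using keys_prep[of "(fst x, b)" "expand w"] Cons that by (fastforce simp: basis_words_Cons)
  then show ?case
    unfolding expand.simps by (intro keys_sum_subset keys_fscale_subset)
qed simp

lemma expand_basis_word: "w \<in> basis_words bas n \<Longrightarrow> expand w = gen w"
proof (induction w arbitrary: n)
  case (Cons x w)
  then have x: "snd x \<in> bas (fst x)" and w: "expand w = gen w" by (auto simp: basis_words_Cons)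
  have "expand (x # w) = (\<Sum>b\<in>bas (fst x). if b = snd x then gen ((fst x, b) # w) else 0)"
    by (simp add: representation_basis[OF bas(2) x] w) (intro sum.cong refl, auto)
  also have "\<dots> = gen (x # w)" using x finite_bas by (simp add: sum.delta)
  finally show ?case .
qed simp

lemma expand_id: "Poly_Mapping.keys p \<subseteq> basis_words bas n \<Longrightarrow> lin_extend expand p = p"
  by (rule lin_eqI[where g = "\<lambda>p. p"]) (auto intro!: lin_intros lin_id expand_basis_word)

end

text \<open>The isomorphism is lifted to an injective linear map between free spaces on basis words,
  where linear independence bounds cardinalities.\<close>

lemma card_basis_words_le:
  fixes scaleA :: "'k::field \<Rightarrow> 'a::ring_1 \<Rightarrow> 'a" and scaleB :: "'k \<Rightarrow> 'b::ring_1 \<Rightarrow> 'b"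
  assumes "connected_commutative_graded_algebra scaleA A" "connected_commutative_graded_algebra scaleB B"
    and iso: "graded_space_iso (J_alg scaleA A) (J_alg scaleB B) \<Phi>"
  shows "card (basis_words (connected_commutative_graded_algebra.bas scaleA A) n) \<le>
    card (basis_words (connected_commutative_graded_algebra.bas scaleB B) n)"
proof -
  interpret A: connected_commutative_graded_algebra scaleA A by fact
  interpret B: connected_commutative_graded_algebra scaleB B by fact
  let ?X = "basis_words A.bas n" and ?Y = "basis_words B.bas n"
  have bij: "bij_betw (\<Phi> n) (part A.JA n) (part B.JA n)"
    and add: "\<And>X Y. X \<in> part A.JA n \<Longrightarrow> Y \<in> part A.JA n \<Longrightarrow> \<Phi> n (vadd A.JA X Y) = vadd B.JA (\<Phi> n X) (\<Phi> n Y)"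
    and scale: "\<And>c X. X \<in> part A.JA n \<Longrightarrow> \<Phi> n (vscale A.JA c X) = vscale B.JA c (\<Phi> n X)"
    using iso by (auto simp: graded_space_iso_def)
  have in_J: "coset A.V p \<in> part A.JA n" if "Poly_Mapping.keys p \<subseteq> ?X" for p
    using that A.basis_words_bas[of n] unfolding A.part_J by blast
  \<comment> \<open>\<open>rep\<close> is not linear, so the lift is fixed on basis words,
    normalized by \<open>expand\<close>, and then extended linearly to \<open>H\<close>.\<close>
  define h where "h w = lin_extend B.expand (rep (\<Phi> n (coset A.V (gen w))))" for w
  define H where "H = lin_extend h"
  have h: "Poly_Mapping.keys (h w) \<subseteq> ?Y \<and> coset B.V (h w) = \<Phi> n (coset A.V (gen w))" if "w \<in> ?X" for w
  proof -
    have "\<Phi> n (coset A.V (gen w)) \<in> part B.JA n"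
      using bij in_J[of "gen w"] that by (auto simp: bij_betw_def)
    then obtain q where q: "\<Phi> n (coset A.V (gen w)) = coset B.V q" "Poly_Mapping.keys q \<subseteq> homs B.V n"
      by (auto simp: B.part_J)
    have h: "h w = lin_extend B.expand q"
      unfolding h_def q(1) by (rule B.expand_relations[OF rep_coset])
    have "Poly_Mapping.keys (h w) \<subseteq> ?Y"
      unfolding h
    proof (rule keys_lin_subset[OF lin_lin_extend])
      fix t assume "t \<in> Poly_Mapping.keys q"
      then have "t \<in> words B.V" "wdeg t = n" using q(2) by (auto simp: homs_def)
      then show "Poly_Mapping.keys (lin_extend B.expand (gen t)) \<subseteq> ?Y" using B.keys_expand[of t] by simp
    qed
    moreover have "Poly_Mapping.keys q \<subseteq> words B.V" using q(2) by (auto simp: homs_def)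
    ultimately show ?thesis unfolding h q(1) coset_eq_iff using B.eqv_expand by blast
  qed
  have H: "coset B.V (H p) = \<Phi> n (coset A.V p)" if "Poly_Mapping.keys p \<subseteq> ?X" for p
  proof -
    have "p \<in> free.span (gen ` ?X)" using that by (simp only: in_span_gen_iff)
    then have "Poly_Mapping.keys p \<subseteq> ?X \<and> coset B.V (H p) = \<Phi> n (coset A.V p)"
    proof (induction rule: free.span_induct_alt)
      case base
      \<comment> \<open>That \<open>\<Phi>\<close> preserves zero follows from homogeneity with
        scalar \<open>0\<close>, once the image is known to be a coset.\<close>
      have "\<Phi> n (vscale A.JA 0 (coset A.V 0)) = vscale B.JA 0 (coset B.V (rep (\<Phi> n (coset A.V 0))))"
      proof -
        have "\<Phi> n (coset A.V 0) \<in> part B.JA n"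
          using bij in_J[of 0] by (auto simp: bij_betw_def)
        then obtain q where "\<Phi> n (coset A.V 0) = coset B.V q"
          by (auto simp: B.part_J)
        then have "coset B.V (rep (\<Phi> n (coset A.V 0))) = \<Phi> n (coset A.V 0)"
          by (simp add: coset_eq_iff rep_coset)
        then show ?thesis using scale[OF in_J[of 0]] by simp
      qed
      then show ?case by (simp add: A.vscale_J B.vscale_J H_def)
    next
      case (step c x y)
      then obtain w where w: "x = gen w" "w \<in> ?X" by blast
      have keys: "Poly_Mapping.keys x \<subseteq> ?X" "Poly_Mapping.keys (fscale c x) \<subseteq> ?X" "Poly_Mapping.keys y \<subseteq> ?X"
        using w step.IH by (auto intro!: keys_fscale_subset simp del: in_keys_iff)
      have "coset B.V (H (fscale c x + y)) = vadd B.JA (vscale B.JA c (coset B.V (H x))) (coset B.V (H y))"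
        by (simp add: B.vadd_J B.vscale_J H_def)
      also have "coset B.V (H x) = \<Phi> n (coset A.V x)" using h w by (simp add: H_def)
      also have "vscale B.JA c \<dots> = \<Phi> n (coset A.V (fscale c x))"
        using scale[OF in_J[OF keys(1)]] by (simp add: A.vscale_J)
      also have "vadd B.JA \<dots> (coset B.V (H y)) = \<Phi> n (coset A.V (fscale c x + y))"
        using add[OF in_J[OF keys(2)] in_J[OF keys(3)]] step.IH by (simp add: A.vadd_J)
      finally show ?case using keys_plus_subset[OF keys(2,3)] by blast
    qed
    then show ?thesis by blast
  qed
  \<comment> \<open>\<open>\<Phi>\<close> is injective on classes, and \<open>expand\<close>
    separates the classes of combinations of basis words.\<close>
  have H_inj: "p = 0" if "Poly_Mapping.keys p \<subseteq> ?X" "H p = 0" for p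
  proof -
    have "\<Phi> n (coset A.V p) = \<Phi> n (coset A.V 0)"
      using H[OF that(1)] H[of 0] that(2) by (simp add: H_def)
    then have "coset A.V p = coset A.V 0"
      using bij in_J[OF that(1)] in_J[of 0] by (auto simp: bij_betw_def inj_on_def)
    then have "lin_extend A.expand p = lin_extend A.expand 0"
      unfolding coset_eq_iff by (rule A.expand_relations)
    then show ?thesis using A.expand_id[OF that(1)] by simp
  qed
  interpret H: Vector_Spaces.linear fscale fscale H
    unfolding H_def by (rule lin_lin_extend)
  have inj: "inj_on H (free.span (gen ` ?X))"
    by (subst H.inj_on_iff_eq_0[OF free.subspace_span]) (use H_inj in \<open>auto simp only: in_span_gen_iff\<close>)
  have "H ` gen ` ?X \<subseteq> free.span (gen ` ?Y)"
    using h by (auto simp: H_def in_span_gen_iff)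
  moreover have "\<not> free.dependent (H ` gen ` ?X)"
    by (rule H.independent_inj_on_image[OF independent_gen inj])
  moreover have "finite (gen ` ?Y :: ('b word \<Rightarrow>\<^sub>0 'k) set)"
    using graded_set.finite_basis_words[OF B.graded_set_bas] by simp
  ultimately have "card (H ` gen ` ?X) \<le> card (gen ` ?Y :: ('b word \<Rightarrow>\<^sub>0 'k) set)"
    using free.independent_span_bound by blast
  moreover have "card (H ` gen ` ?X) = card ?X"
    using card_image[OF inj_on_subset[OF inj free.span_superset]] by (simp only: card_gen_image)
  ultimately show ?thesis by (simp only: card_gen_image)
qed

lemma graded_space_iso_of_card_bas:
  assumes "connected_commutative_graded_algebra scaleA A" "connected_commutative_graded_algebra scaleB B"
    and card: "\<And>n. card (connected_commutative_graded_algebra.bas scaleA A n) =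
      card (connected_commutative_graded_algebra.bas scaleB B n)"
  shows "\<exists>\<phi>. graded_space_iso (positive_part scaleA A) (positive_part scaleB B) \<phi>"
proof -
  interpret A: connected_commutative_graded_algebra scaleA A by fact
  interpret B: connected_commutative_graded_algebra scaleB B by fact
  interpret vector_space_pair scaleA scaleB by unfold_locales
  have "\<exists>f. Vector_Spaces.linear scaleA scaleB f \<and> bij_betw f (part A.V n) (part B.V n)" for n
  proof -
    obtain g where g: "bij_betw g (A.bas n) (B.bas n)"
      using finite_same_card_bij[OF A.finite_bas B.finite_bas card] by blast
    let ?f = "construct (A.bas n) g"
    have lin: "Vector_Spaces.linear scaleA scaleB ?f" by (rule linear_construct[OF A.bas(2)])
    have eq: "?f b = g b" if "b \<in> A.bas n" for b by (rule construct_basis[OF A.bas(2) that])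
    then have im: "?f ` A.bas n = B.bas n" and inj: "inj_on ?f (A.bas n)"
      using g by (auto simp: bij_betw_def inj_on_def)
    have "inj_on ?f (A.span (A.bas n))"
      using linear_inj_on_span_iff_independent_image[OF lin] im inj B.bas(2) by auto
    moreover have "?f ` A.span (A.bas n) = B.span (B.bas n)"
      using linear_span_image[OF lin] im by metis
    ultimately show ?thesis using lin by (auto simp: bij_betw_def A.span_bas B.span_bas)
  qed
  then obtain \<phi> where \<phi>: "\<And>n. Vector_Spaces.linear scaleA scaleB (\<phi> n)" "\<And>n. bij_betw (\<phi> n) (part A.V n) (part B.V n)"
    by metis
  have "graded_space_iso A.V B.V \<phi>"
    unfolding graded_space_iso_def using \<phi> by (auto simp: linear_add linear_scale)
  then show ?thesis by blast
qed

theorem theorem1p5: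
  fixes scaleA :: "'k::field_char_0 \<Rightarrow> 'a::ring_1 \<Rightarrow> 'a" and A :: "nat \<Rightarrow> 'a set"
    and scaleB :: "'k \<Rightarrow> 'b::ring_1 \<Rightarrow> 'b" and B :: "nat \<Rightarrow> 'b set"
  assumes "connected_commutative_graded_algebra scaleA A"
    and "connected_commutative_graded_algebra scaleB B"
  shows "((\<exists>\<phi>. graded_space_iso (positive_part scaleA A) (positive_part scaleB B) \<phi>) \<longleftrightarrow>
          (\<exists>\<phi>. graded_alg_iso (J scaleA A) (J scaleB B) \<phi>)) \<and>
         ((\<exists>\<phi>. graded_alg_iso (J scaleA A) (J scaleB B) \<phi>) \<longleftrightarrow>
          (\<exists>\<phi>. graded_hopf_iso (J scaleA A) (J scaleB B) \<phi>))"
proof -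
  interpret A: connected_commutative_graded_algebra scaleA A by fact
  interpret B: connected_commutative_graded_algebra scaleB B by fact
  have "\<exists>\<Phi>. graded_hopf_iso (J scaleA A) (J scaleB B) \<Phi>"
    if "graded_space_iso (positive_part scaleA A) (positive_part scaleB B) \<phi>" for \<phi>
  proof -
    interpret positive_iso scaleA A scaleB B \<phi>
      by unfold_locales (rule that)
    show ?thesis using \<Phi>_hopf_iso by blast
  qed
  moreover have "\<exists>\<phi>. graded_space_iso (positive_part scaleA A) (positive_part scaleB B) \<phi>"
    if "graded_alg_iso (J scaleA A) (J scaleB B) \<Phi>" for \<Phi>
  proof (rule graded_space_iso_of_card_bas[OF assms])
    have iso: "graded_space_iso A.JA B.JA \<Phi>"
      using that by (simp add: graded_alg_iso_def graded_space_iso_def)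
    \<comment> \<open>The inverse supplies the reverse inequality between the numbers of basis
      words.\<close>
    have iso': "graded_space_iso B.JA A.JA (\<lambda>n. inv_into (part A.JA n) (\<Phi> n))"
      by (rule graded_space_iso_inverse[OF iso A.J_closed])
    show "card (A.bas n) = card (B.bas n)" for n
      by (rule card_eq_of_card_basis_words_eq[OF A.graded_set_bas B.graded_set_bas])
        (intro antisym card_basis_words_le[OF assms iso] card_basis_words_le[OF assms(2,1) iso'])
  qed
  \<comment> \<open>The implication from (c) to (b) is contained in the definition of
    \<open>graded_hopf_iso\<close>.\<close>
  ultimately show ?thesis
    unfolding graded_hopf_iso_def by blast
qed

end
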